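(* Consider the asymptotic framework in which $K$ and the densities $\{f_x,g_x\}$ are fixed and the change-point model $\{\pi_t\}=\{\pi_t(\cdot;\alpha)\}$ may depend on $\alpha\in(0,1)$. Suppose that: (1) for each $x\in[K]$, $0<V_x^I<\infty$ and $V_x^J<\infty$; (2) there exists a constant $c\in(0,1)$ such that $\sup_{t\ge0,z\in[K]^t}\pi_t(z;\alpha)\le1-c$ for all small enough $\alpha$; (3) there exists a block $\Xi$ (possibly depending on $\alpha$) such that $\alpha\,\widetilde\lambda(\Xi)=o(\lambda^*+|\log\alpha|)$ as $\alpha\to0$, where $\lambda^*=\inf_{\mathcal X}\mathsf E[\Theta_{\mathcal X}]$; (4) there is a positive quantity $\mathsf D^*$, depending on $\alpha$, with $\mathsf D^*=O(1)$, such that for every $\epsilon\in(0,1)$, with $N_{\epsilon,\alpha}=\lfloor(1-\epsilon)|\log\alpha|/\mathsf D^*\rfloor$, $$\limsup_{\alpha\to0}\ \sup_{t\ge0,\,\mathcal X}\ \frac{1}{\mathsf D^*N_{\epsilon,\alpha}}\sum_{s=1}^{N_{\epsilon,\alpha}}\big(I_{X_{t+s}}+\omega(\Pi_{t+s}(\mathcal X))\big)\le1+\epsilon/2,$$ where the supremum is over all assignment rules $\mathcal X=\{X_t\}$. Then, as $\alpha\to0$, $$\inf_{(\mathcal X,T)\in\mathcal C_\alpha}\mathsf E[T]\ \ge\ \Big(\lambda^*+\frac{|\log\alpha|}{\mathsf D^*}\Big)(1+o(1)).$$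
   Context: Setup. Fix $2\le K<\infty$, $[K]=\{1,\dots,K\}$, $\mathbb N=\{1,2,\dots\}$. There is a latent process $L_t\in\{0,1\}$, $t\ge0$, with $L_t=0$ for $t<\Theta$ and $L_t=1$ for $t\ge\Theta$ ($\Theta$ is the change-point). At each $t\in\mathbb N$ a treatment $X_t\in[K]$ is selected and a response $Y_t$ in a Polish space $\mathbb Y$ is observed; $\mathcal F_t=\sigma(X_s,Y_s:1\le s\le t)$, $\mathcal F_0$ trivial. An assignment rule $\mathcal X=\{X_t\}$ has $X_1$ deterministic and $X_t$ a measurable function of $X_1,\dots,X_{t-1},Y_1,\dots,Y_{t-1}$. Response model: for each $x\in[K]$, $f_x,g_x$ are densities with respect to a $\sigma$-finite measure $\mu$ on $\mathbb Y$; given $X_t=x,L_t=i,\mathcal F_{t-1},L_0,\dots,L_{t-1}$, $Y_t$ has density $f_x$ if $i=0$, $g_x$ if $i=1$. Change-point model: $\pi_0\in[0,1)$ and functions $\pi_t:[K]^t\to[0,1)$ with $\mathsf P(L_0=1)=\pi_0$ and $\mathsf P(L_t=1\mid L_{t-1}=0,\mathcal F_{t-1},X_t)=\Pi_t=\Pi_t(\mathcal X):=\pi_t(X_1,\dots,X_t)$. The change-point under $\mathcal X$ is written $\Theta_{\mathcal X}$. $\mathcal C_\alpha$ is the class of pairs $(\mathcal X,T)$ with $\mathcal X$ an assignment rule, $T$ an $\{\mathcal F_t\}$-stopping time and $\mathsf P(T<\Theta_{\mathcal X})\le\alpha$. $I_x=\int\log(g_x/f_x)g_x\,d\mu$, $J_x=\int\log(f_x/g_x)f_x\,d\mu$,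 $V_x^I=\int(\log(g_x/f_x)-I_x)^2g_x\,d\mu$, $V_x^J=\int(\log(f_x/g_x)-J_x)^2f_x\,d\mu$; $\omega(x)=|\log(1-x)|$. A block is $\Xi\in[K]^\ell$ for some $\ell\in\mathbb N$, extended cyclically by $\Xi(j\ell+i)=\Xi(i)$, with $\Xi(1:s)=(\Xi(1),\dots,\Xi(s))$. $\widetilde\lambda(\Xi)=\sup_{m\ge0,z\in[K]^m}\big\{1+\sum_{t\ge1}\prod_{s=1}^t(1-\pi_{m+s}(z,\Xi(1:s)))\big\}$. Asymptotic notation, for quantities depending on $\alpha$ with limits as $\alpha\to0$: $x=o(y)$ if $x/y\to0$; $x=O(y)$ if $\limsup x/y<\infty$; $x\ge y(1+o(1))$ if $\liminf x/y\ge1$. *)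

theory Defs
  imports "HOL-Probability.Probability"
begin

definition is_density :: "'y measure \<Rightarrow> ('y \<Rightarrow> real) \<Rightarrow> bool" where
  "is_density \<mu> p \<longleftrightarrow>
     p \<in> borel_measurable \<mu> \<and> (\<forall>y. 0 \<le> p y) \<and> (\<integral>\<^sup>+ y. ennreal (p y) \<partial>\<mu>) = 1"

text \<open>The densities may vanish, so the logarithm is extended-valued
  (\<open>ln 0\<close> and \<open>x / 0\<close> are \<open>0\<close> for type \<^typ>\<open>real\<close>). The value at \<open>p y = q y = 0\<close> is irrelevant:
  below it is always multiplied by \<open>p y\<close>, and \<open>\<infinity> * 0 = 0\<close> in \<^typ>\<open>ereal\<close>.\<close>

definition log_ratio :: "('y \<Rightarrow> real) \<Rightarrow> ('y \<Rightarrow> real) \<Rightarrow> 'y \<Rightarrow> ereal" where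
  "log_ratio p q y =
     (if p y = 0 then - \<infinity> else if q y = 0 then \<infinity> else ereal (ln (p y / q y)))"

text \<open>Integral of \<open>log (p / q) p\<close>, as positive part minus negative part. For densities the
  negative part is always finite, so no \<open>\<infinity> - \<infinity>\<close> arises. With densities \<open>f x\<close>, \<open>g x\<close>,
  \<open>I\<^sub>x = log_div \<mu> (g x) (f x)\<close> and \<open>J\<^sub>x = log_div \<mu> (f x) (g x)\<close>.\<close>

definition log_div :: "'y measure \<Rightarrow> ('y \<Rightarrow> real) \<Rightarrow> ('y \<Rightarrow> real) \<Rightarrow> ereal" where
  "log_div \<mu> p q =
     enn2ereal (\<integral>\<^sup>+ y. e2ennreal (log_ratio p q y * ereal (p y)) \<partial>\<mu>)
     - enn2ereal (\<integral>\<^sup>+ y. e2ennreal (- (log_ratio p q y * ereal (p y))) \<partial>\<mu>)"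

definition log_div_var :: "'y measure \<Rightarrow> ('y \<Rightarrow> real) \<Rightarrow> ('y \<Rightarrow> real) \<Rightarrow> ennreal" where
  "log_div_var \<mu> p q =
     (\<integral>\<^sup>+ y. e2ennreal ((log_ratio p q y - log_div \<mu> p q)\<^sup>2 * ereal (p y)) \<partial>\<mu>)"

definition omega :: "real \<Rightarrow> real" where
  "omega x = \<bar>ln (1 - x)\<bar>"

text \<open>\<open>\<phi> t\<close> maps the first \<open>t\<close> treatment/response pairs to the treatment at time \<open>t + 1\<close>;
  \<open>\<phi> 0\<close> has only the empty history as argument, so the first treatment is deterministic.\<close>

type_synonym 'y rule = "nat \<Rightarrow> (nat \<Rightarrow> nat \<times> 'y) \<Rightarrow> nat"

definition assignment_rule :: "nat \<Rightarrow> 'y::polish_space rule \<Rightarrow> bool" where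
  "assignment_rule K \<phi> \<longleftrightarrow>
     (\<forall>t. \<phi> t \<in> (\<Pi>\<^sub>M s\<in>{1..t}. count_space {1..K} \<Otimes>\<^sub>M borel) \<rightarrow>\<^sub>M count_space {1..K})"

definition hist :: "(nat \<Rightarrow> 'w \<Rightarrow> nat) \<Rightarrow> (nat \<Rightarrow> 'w \<Rightarrow> 'y) \<Rightarrow> nat \<Rightarrow> 'w \<Rightarrow> nat \<Rightarrow> nat \<times> 'y" where
  "hist X Y t \<omega> = (\<lambda>s\<in>{1..t}. (X s \<omega>, Y s \<omega>))"

abbreviation hist_space :: "nat \<Rightarrow> (nat \<Rightarrow> nat \<times> 'y::polish_space) measure" where
  "hist_space t \<equiv> \<Pi>\<^sub>M s\<in>{1..t}. count_space UNIV \<Otimes>\<^sub>M borel"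

definition obs_filtration ::
    "'w measure \<Rightarrow> (nat \<Rightarrow> 'w \<Rightarrow> nat) \<Rightarrow> (nat \<Rightarrow> 'w \<Rightarrow> 'y::polish_space) \<Rightarrow> nat \<Rightarrow> 'w measure" where
  "obs_filtration M X Y t = vimage_algebra (space M) (hist X Y t) (hist_space t)"

text \<open>A function \<open>\<pi>\<close> on lists encodes the whole family \<open>(\<pi>\<^sub>t)\<close>: \<open>\<pi>\<^sub>t (x\<^sub>1, \<dots>, x\<^sub>t) = \<pi> [x\<^sub>1, \<dots>, x\<^sub>t]\<close>,
  and \<open>\<pi>\<^sub>0 = \<pi> []\<close>.\<close>

definition Pi_t :: "(nat list \<Rightarrow> real) \<Rightarrow> (nat \<Rightarrow> 'w \<Rightarrow> nat) \<Rightarrow> nat \<Rightarrow> 'w \<Rightarrow> real" where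
  "Pi_t \<pi> X t \<omega> = \<pi> (map (\<lambda>s. X s \<omega>) [1..<Suc t])"

text \<open>A probability space carrying latent states \<open>L t\<close> (\<open>t \<ge> 0\<close>, \<open>True\<close> meaning \<open>1\<close>), treatments
  \<open>X t\<close> and responses \<open>Y t\<close> (\<open>t \<ge> 1\<close>) generated under the rule \<open>\<phi>\<close>.\<close>

locale change_point_model = prob_space M
  for M :: "'w measure" +
  fixes \<mu> :: "'y::polish_space measure"
    and f g :: "nat \<Rightarrow> 'y \<Rightarrow> real"
    and \<pi> :: "nat list \<Rightarrow> real"
    and \<phi> :: "'y rule"
    and L :: "nat \<Rightarrow> 'w \<Rightarrow> bool"
    and X :: "nat \<Rightarrow> 'w \<Rightarrow> nat"
    and Y :: "nat \<Rightarrow> 'w \<Rightarrow> 'y"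
  assumes L_measurable: "\<And>t. L t \<in> M \<rightarrow>\<^sub>M count_space UNIV"
    and Y_measurable: "\<And>t. Y (Suc t) \<in> M \<rightarrow>\<^sub>M borel"
    and L_mono: "\<And>t \<omega>. \<omega> \<in> space M \<Longrightarrow> L t \<omega> \<Longrightarrow> L (Suc t) \<omega>"
    and X_rule: "\<And>t \<omega>. \<omega> \<in> space M \<Longrightarrow> X (Suc t) \<omega> = \<phi> t (hist X Y t \<omega>)"
    and L_initial: "prob {\<omega> \<in> space M. L 0 \<omega>} = \<pi> []"
    and L_transition:
      "\<And>t. AE \<omega> in M. \<not> L t \<omega> \<longrightarrow>
         real_cond_exp M
           (vimage_algebra (space M) (\<lambda>\<omega>. (L t \<omega>, hist X Y t \<omega>, X (Suc t) \<omega>))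
              (count_space UNIV \<Otimes>\<^sub>M hist_space t \<Otimes>\<^sub>M count_space UNIV))
           (indicator {\<omega>. L (Suc t) \<omega>}) \<omega>
         = Pi_t \<pi> X (Suc t) \<omega>"
    and Y_response:
      "\<And>t B. B \<in> sets borel \<Longrightarrow> AE \<omega> in M.
         real_cond_exp M
           (vimage_algebra (space M) (\<lambda>\<omega>. (X (Suc t) \<omega>, hist X Y t \<omega>, \<lambda>s\<in>{..Suc t}. L s \<omega>))
              (count_space UNIV \<Otimes>\<^sub>M hist_space t \<Otimes>\<^sub>M (\<Pi>\<^sub>M s\<in>{..Suc t}. count_space UNIV)))
           (indicator {\<omega>. Y (Suc t) \<omega> \<in> B}) \<omega>
         = measure (density \<mu> (\<lambda>y. ennreal ((if L (Suc t) \<omega> then g else f) (X (Suc t) \<omega>) y))) B"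

definition change_point :: "(nat \<Rightarrow> 'w \<Rightarrow> bool) \<Rightarrow> 'w \<Rightarrow> enat" where
  "change_point L \<omega> = (INF t\<in>{t. L t \<omega>}. enat t)"

text \<open>Stopping times may be infinite, so the notion of \<^theory>\<open>HOL-Probability.Stopping_Time\<close>,
  whose values lie in the index set of the filtration, does not apply.\<close>

definition enat_stopping_time :: "(nat \<Rightarrow> 'w measure) \<Rightarrow> ('w \<Rightarrow> enat) \<Rightarrow> bool" where
  "enat_stopping_time F T \<longleftrightarrow> (\<forall>t. Measurable.pred (F t) (\<lambda>\<omega>. T \<omega> \<le> enat t))"

definition expect_enat :: "'w measure \<Rightarrow> ('w \<Rightarrow> enat) \<Rightarrow> ennreal" where
  "expect_enat M T = (\<integral>\<^sup>+ \<omega>. ennreal_of_enat (T \<omega>) \<partial>M)"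

text \<open>Below, \<open>M\<close>, \<open>L\<close>, \<open>X\<close>, \<open>Y\<close> give the probability space and processes for each rule.\<close>

definition procedure_class ::
    "nat \<Rightarrow> ('y::polish_space rule \<Rightarrow> 'w measure) \<Rightarrow> ('y rule \<Rightarrow> nat \<Rightarrow> 'w \<Rightarrow> bool) \<Rightarrow>
     ('y rule \<Rightarrow> nat \<Rightarrow> 'w \<Rightarrow> nat) \<Rightarrow> ('y rule \<Rightarrow> nat \<Rightarrow> 'w \<Rightarrow> 'y) \<Rightarrow> real \<Rightarrow>
     ('y rule \<times> ('w \<Rightarrow> enat)) set" where
  "procedure_class K M L X Y \<alpha> =
     {(\<phi>, T). assignment_rule K \<phi> \<and>
        enat_stopping_time (obs_filtration (M \<phi>) (X \<phi>) (Y \<phi>)) T \<and>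
        measure (M \<phi>) {\<omega> \<in> space (M \<phi>). T \<omega> < change_point (L \<phi>) \<omega>} \<le> \<alpha>}"

definition lambda_star ::
    "nat \<Rightarrow> ('y::polish_space rule \<Rightarrow> 'w measure) \<Rightarrow> ('y rule \<Rightarrow> nat \<Rightarrow> 'w \<Rightarrow> bool) \<Rightarrow> ennreal" where
  "lambda_star K M L = (INF \<phi>\<in>{\<phi>. assignment_rule K \<phi>}. expect_enat (M \<phi>) (change_point (L \<phi>)))"

definition is_block :: "nat \<Rightarrow> nat list \<Rightarrow> bool" where
  "is_block K \<Xi> \<longleftrightarrow> \<Xi> \<noteq> [] \<and> set \<Xi> \<subseteq> {1..K}"

definition block_prefix :: "nat list \<Rightarrow> nat \<Rightarrow> nat list" where
  "block_prefix \<Xi> s = map (\<lambda>i. \<Xi> ! (i mod length \<Xi>)) [0..<s]"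

definition lambda_tilde :: "nat \<Rightarrow> (nat list \<Rightarrow> real) \<Rightarrow> nat list \<Rightarrow> ennreal" where
  "lambda_tilde K \<pi> \<Xi> =
     (SUP z\<in>lists {1..K}. 1 + (\<Sum>t. ennreal (\<Prod>s=1..Suc t. 1 - \<pi> (z @ block_prefix \<Xi> s))))"

end

theory Submission
  imports Defs "HOL-Real_Asymp.Real_Asymp"
begin

text \<open>
  Write \<open>\<Theta>\<close> for the change-point. For every horizon \<open>N\<close>,
  \<open>E T \<ge> E (min T \<Theta>) + N * P (T \<ge> \<Theta> + N)\<close>.

  The first term is almost \<open>\<lambda>\<^sup>*\<close>: follow the given rule until \<open>T\<close> and the block from then on. The new
  rule has the same law up to \<open>T\<close>, and after a false alarm its change-point arrives within
  \<open>lambda_tilde\<close> steps on average, so \<open>\<lambda>\<^sup>* \<le> E (min T \<Theta>) + \<alpha> * lambda_tilde\<close>.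

  The second term is almost \<open>N\<close> for \<open>N = (1 - \<epsilon>) \<bar>ln \<alpha>\<bar> / D\<close>. On \<open>\<Theta> = k\<close> and \<open>T = t\<close>, the law of the history has
  density \<open>w * \<Lambda>\<close> with respect to its restriction to \<open>\<Theta> > t\<close>, where \<open>w\<close> is a bounded prior weight and \<open>\<Lambda>\<close> is
  the product over \<open>k \<le> s \<le> t\<close> of the likelihood ratios divided by \<open>1 - \<Pi>\<^sub>s\<close>. If \<open>\<Lambda> \<le> e\<^sup>a\<close> with
  \<open>a = (1 - \<epsilon> / 8) \<bar>ln \<alpha>\<bar>\<close>, the early stop is charged to the event \<open>T < \<Theta>\<close> of probability at most \<open>\<alpha>\<close>, which
  costs \<open>O(N e\<^sup>a \<alpha>)\<close>. Otherwise the log-likelihood ratios, centred at their means \<open>I\<close>, exceed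
  \<open>\<epsilon> / 8 * \<bar>ln \<alpha>\<bar>\<close> at time \<open>T\<close>; stopped at \<open>T\<close> and restricted to the window \<open>[\<Theta>, \<Theta> + N)\<close> they form a martingale
  with second moment \<open>O(N)\<close>, so Chebyshev's inequality applies without a maximal inequality. Finally
  \<open>D\<close> is bounded away from \<open>0\<close> because \<open>I\<^sub>x > 0\<close>, which is where positivity of the variances enters.
\<close>

section \<open>Conditional densities\<close>

text \<open>Each rule comes with its own probability space, so the paths under the switched rule
  cannot be compared pointwise with those under the given one. All comparisons are made between
  laws: one step of the model is written with functions of the observed history alone, and
  identities of integrals are proved by induction over time for all nonnegative test functions of
  the history.

  The reference law of the change of measure is the model's own law restricted to the event of no
  change up to time t, not an auxiliary law without change. Hence each step carries the survival
  factor 1 - \<Pi> besides the density ratio, which is why \<open>omega\<close> of \<Pi> joins the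
  information in the drift, and the false-alarm probability appears directly.

  With \<open>l = \<bar>ln \<alpha>\<bar>\<close>, small likelihoods contribute an error of order
  \<open>l * exp (- \<epsilon> / 8 * l)\<close>, the factor \<open>l\<close> counting the
  change-points whose window contains a given time; Chebyshev's inequality contributes order
  \<open>1 / l\<close>. Both vanish for fixed \<epsilon>, and \<epsilon> tends to 0 only at the very
  end.\<close>

lemma (in sigma_finite_subalgebra) nn_integral_indicator_real_cond_exp:
  fixes A :: "'a set" and q :: "'a \<Rightarrow> real" and W :: "'a \<Rightarrow> ennreal"
  assumes A: "A \<inter> space M \<in> sets M"
    and q: "AE \<omega> in M. real_cond_exp M F (indicator A) \<omega> = q \<omega>"
    and W: "W \<in> borel_measurable F"
  shows "(\<integral>\<^sup>+\<omega>. W \<omega> * indicator A \<omega> \<partial>M) = (\<integral>\<^sup>+\<omega>. W \<omega> * ennreal (q \<omega>) \<partial>M)"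
proof -
  have ind [measurable]: "(indicator A :: 'a \<Rightarrow> real) \<in> borel_measurable M"
    using A by (simp add: borel_measurable_indicator_iff)
  have ind' [measurable]: "(\<lambda>x. ennreal (indicator A x)) \<in> borel_measurable M"
    by simp
  have W' [measurable]: "W \<in> borel_measurable M"
    using W measurable_from_subalg subalg by blast
  \<comment> \<open>\<open>real_cond_exp\<close> is the difference of \<open>nn_cond_exp\<close> of
    the positive and of the negative part. For an indicator the second is 0 and the first at most 1,
    hence finite, so the difference can be undone and the identity holds for extended weights
    \<open>W\<close> without integrability.\<close>
  have z: "AE \<omega> in M. nn_cond_exp M F (\<lambda>x. ennreal (- indicator A x)) \<omega> = 0"
  proof -
    have "(\<lambda>x. ennreal (- indicator A x)) = (\<lambda>x. 0)"
      by (auto simp: ennreal_neg)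
    then show ?thesis using nn_cond_exp_F_meas[of "\<lambda>_. 0"] by auto
  qed
  have fin: "AE \<omega> in M. nn_cond_exp M F (\<lambda>x. ennreal (indicator A x)) \<omega> \<le> 1"
  proof -
    have "AE \<omega> in M. nn_cond_exp M F (\<lambda>x. ennreal (indicator A x)) \<omega> \<le> nn_cond_exp M F (\<lambda>_. 1) \<omega>"
      by (rule nn_cond_exp_mono) (auto split: split_indicator)
    moreover have "AE \<omega> in M. nn_cond_exp M F (\<lambda>_. 1) \<omega> = 1"
      using nn_cond_exp_F_meas[of "\<lambda>_. 1"] by auto
    ultimately show ?thesis by auto
  qed
  have eq: "AE \<omega> in M. nn_cond_exp M F (\<lambda>x. ennreal (indicator A x)) \<omega> = ennreal (q \<omega>)"
    using q z fin
  proof eventually_elim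
    case (elim \<omega>)
    have "nn_cond_exp M F (\<lambda>x. ennreal (indicator A x)) \<omega> < \<top>"
      using elim(3) by (meson ennreal_one_less_top le_less_trans)
    moreover have "q \<omega> = enn2real (nn_cond_exp M F (\<lambda>x. ennreal (indicator A x)) \<omega>)"
      using elim(1,2) by (simp add: real_cond_exp_def)
    ultimately show ?case by (simp only: ennreal_enn2real)
  qed
  have "(\<integral>\<^sup>+\<omega>. W \<omega> * indicator A \<omega> \<partial>M) = (\<integral>\<^sup>+\<omega>. W \<omega> * ennreal (indicator A \<omega>) \<partial>M)"
    by (simp add: ennreal_indicator)
  also have "\<dots> = (\<integral>\<^sup>+\<omega>. W \<omega> * nn_cond_exp M F (\<lambda>x. ennreal (indicator A x)) \<omega> \<partial>M)"
    using W by (intro nn_cond_exp_intg[symmetric]) auto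
  also have "\<dots> = (\<integral>\<^sup>+\<omega>. W \<omega> * ennreal (q \<omega>) \<partial>M)"
    by (rule nn_integral_cong_AE) (use eq in auto)
  finally show ?thesis .
qed

text \<open>The joint law of \<open>(\<omega>, Y \<omega>)\<close> on
  \<open>F \<Otimes>\<^sub>M S\<close> has density \<open>p\<close> with respect to the product of
  \<open>M\<close> restricted to \<open>F\<close> with \<open>S\<close>: both measures agree on
  rectangles by the hypothesis on conditional probabilities, and rectangles form an Int-stable
  generator. A statement for each event \<open>B\<close>, with a null set depending on
  \<open>B\<close>, thus becomes one for all \<open>h\<close>.\<close>

lemma (in sigma_finite_subalgebra) nn_integral_conditional_density:
  fixes S :: "'b measure" and Y :: "'a \<Rightarrow> 'b" and p :: "'a \<Rightarrow> 'b \<Rightarrow> ennreal"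
  assumes fin: "finite_measure M"
    and S: "sigma_finite_measure S"
    and Y: "Y \<in> M \<rightarrow>\<^sub>M S"
    and p: "case_prod p \<in> borel_measurable (F \<Otimes>\<^sub>M S)"
    and prob: "\<And>\<omega>. \<omega> \<in> space M \<Longrightarrow> (\<integral>\<^sup>+y. p \<omega> y \<partial>S) = 1"
    and cond: "\<And>B. B \<in> sets S \<Longrightarrow> AE \<omega> in M.
        real_cond_exp M F (indicator {\<omega>. Y \<omega> \<in> B}) \<omega> = measure (density S (p \<omega>)) B"
    and h: "h \<in> borel_measurable (F \<Otimes>\<^sub>M S)"
  shows "(\<integral>\<^sup>+\<omega>. h (\<omega>, Y \<omega>) \<partial>M) = (\<integral>\<^sup>+\<omega>. \<integral>\<^sup>+y. p \<omega> y * h (\<omega>, y) \<partial>S \<partial>M)"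
proof -
  interpret S: sigma_finite_measure S by fact
  interpret M: finite_measure M by fact
  note [measurable] = Y p h
  let ?R = "restr_to_subalg M F"
  have setsR: "sets ?R = sets F" and spR: "space ?R = space M" and spF: "space F = space M"
    using subalg by (auto simp: sets_restr_to_subalg space_restr_to_subalg subalgebra_def)
  have RS: "sets (?R \<Otimes>\<^sub>M S) = sets (F \<Otimes>\<^sub>M S)"
    by (intro sets_pair_measure_cong setsR refl)
  have id: "(\<lambda>\<omega>. \<omega>) \<in> M \<rightarrow>\<^sub>M F"
    using subalg by (auto simp: subalgebra_def measurable_def)
  have pair [measurable]: "(\<lambda>\<omega>. (\<omega>, Y \<omega>)) \<in> M \<rightarrow>\<^sub>M (F \<Otimes>\<^sub>M S)"
    by (intro measurable_Pair id Y)
  have p' [measurable]: "case_prod p \<in> borel_measurable (?R \<Otimes>\<^sub>M S)"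
    using p measurable_cong_sets[OF RS refl] by blast
  have h' [measurable]: "h \<in> borel_measurable (?R \<Otimes>\<^sub>M S)"
    using h measurable_cong_sets[OF RS refl] by blast
  have nnR: "(\<integral>\<^sup>+\<omega>. k \<omega> \<partial>?R) = (\<integral>\<^sup>+\<omega>. k \<omega> \<partial>M)" if "k \<in> borel_measurable F" for k
    by (rule nn_integral_subalgebra2[OF subalg that])
  have key: "distr M (F \<Otimes>\<^sub>M S) (\<lambda>\<omega>. (\<omega>, Y \<omega>)) = density (?R \<Otimes>\<^sub>M S) (case_prod p)"
  proof (rule measure_eqI_generator_eq[OF Int_stable_pair_measure_generator[of F S], where A="\<lambda>_. space F \<times> space S"])
    show "{a \<times> b |a b. a \<in> sets F \<and> b \<in> sets S} \<subseteq> Pow (space F \<times> space S)"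
      by (auto dest: sets.sets_into_space)
    show "sets (distr M (F \<Otimes>\<^sub>M S) (\<lambda>\<omega>. (\<omega>, Y \<omega>))) = sigma_sets (space F \<times> space S) {a \<times> b |a b. a \<in> sets F \<and> b \<in> sets S}"
      by (simp add: sets_pair_measure)
    show "sets (density (?R \<Otimes>\<^sub>M S) (case_prod p)) = sigma_sets (space F \<times> space S) {a \<times> b |a b. a \<in> sets F \<and> b \<in> sets S}"
      by (simp add: setsR spR spF sets_pair_measure)
    show "range (\<lambda>_. space F \<times> space S) \<subseteq> {a \<times> b |a b. a \<in> sets F \<and> b \<in> sets S}" by auto
    show "(\<Union>i. space F \<times> space S) = space F \<times> space S" by auto
    show "emeasure (distr M (F \<Otimes>\<^sub>M S) (\<lambda>\<omega>. (\<omega>, Y \<omega>))) (space F \<times> space S) \<noteq> \<infinity>"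
      by (subst emeasure_distr) (auto simp: M.emeasure_finite)
  next
    fix Z assume "Z \<in> {a \<times> b |a b. a \<in> sets F \<and> b \<in> sets S}"
    then obtain A B where Z: "Z = A \<times> B" and A [measurable]: "A \<in> sets F" and B [measurable]: "B \<in> sets S"
      by auto
    have ZR: "Z \<in> sets (?R \<Otimes>\<^sub>M S)" unfolding Z RS using A B by (rule pair_measureI)
    have pm: "p \<omega> \<in> borel_measurable S" if "\<omega> \<in> space M" for \<omega>
      using measurable_compose[OF measurable_Pair1'[of \<omega> F S] p] that spF by simp
    \<comment> \<open>The hypothesis \<open>cond\<close> uses the real-valued
      \<open>measure\<close>, which is 0 for infinite mass; total mass 1 makes it agree with
      \<open>emeasure\<close>.\<close>
    have e1: "ennreal (measure (density S (p \<omega>)) B) = (\<integral>\<^sup>+y. p \<omega> y * indicator B y \<partial>S)" if "\<omega> \<in> space M" for \<omega>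
    proof -
      have "emeasure (density S (p \<omega>)) (space S) = (\<integral>\<^sup>+y. p \<omega> y * indicator (space S) y \<partial>S)"
        using pm[OF that] by (rule emeasure_density) simp
      also have "\<dots> = 1"
        by (subst prob[OF that, symmetric], rule nn_integral_cong) simp
      finally have "emeasure (density S (p \<omega>)) (space S) = 1" .
      then have "prob_space (density S (p \<omega>))" by (intro prob_spaceI) simp
      then interpret P: prob_space "density S (p \<omega>)" .
      have "ennreal (measure (density S (p \<omega>)) B) = emeasure (density S (p \<omega>)) B"
        by (rule P.emeasure_eq_measure[symmetric])
      also have "\<dots> = (\<integral>\<^sup>+y. p \<omega> y * indicator B y \<partial>S)"
        using pm[OF that] B by (rule emeasure_density)
      finally show ?thesis .
    qed
    have AM: "A \<in> sets M" using A subalg by (auto simp: subalgebra_def)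
    have "emeasure (distr M (F \<Otimes>\<^sub>M S) (\<lambda>\<omega>. (\<omega>, Y \<omega>))) Z = emeasure M ((\<lambda>\<omega>. (\<omega>, Y \<omega>)) -` Z \<inter> space M)"
      unfolding Z by (rule emeasure_distr) auto
    also have "\<dots> = (\<integral>\<^sup>+\<omega>. indicator ((\<lambda>\<omega>. (\<omega>, Y \<omega>)) -` Z \<inter> space M) \<omega> \<partial>M)"
      unfolding Z by (subst nn_integral_indicator) auto
    also have "\<dots> = (\<integral>\<^sup>+\<omega>. indicator A \<omega> * indicator {\<omega>. Y \<omega> \<in> B} \<omega> \<partial>M)"
      by (rule nn_integral_cong) (auto simp: Z indicator_def)
    also have "\<dots> = (\<integral>\<^sup>+\<omega>. indicator A \<omega> * ennreal (measure (density S (p \<omega>)) B) \<partial>M)"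
    proof (rule nn_integral_indicator_real_cond_exp[OF _ cond[OF B]])
      have "Y -` B \<inter> space M \<in> sets M" by simp
      moreover have "{\<omega>. Y \<omega> \<in> B} \<inter> space M = Y -` B \<inter> space M" by auto
      ultimately show "{\<omega>. Y \<omega> \<in> B} \<inter> space M \<in> sets M" by simp
    qed auto
    also have "\<dots> = (\<integral>\<^sup>+\<omega>. indicator A \<omega> * (\<integral>\<^sup>+y. p \<omega> y * indicator B y \<partial>S) \<partial>M)"
      by (rule nn_integral_cong) (simp add: e1)
    also have "\<dots> = (\<integral>\<^sup>+\<omega>. (\<integral>\<^sup>+y. p \<omega> y * indicator Z (\<omega>, y) \<partial>S) \<partial>M)"
    proof (rule nn_integral_cong)
      fix \<omega>
      show "indicator A \<omega> * (\<integral>\<^sup>+y. p \<omega> y * indicator B y \<partial>S) = (\<integral>\<^sup>+y. p \<omega> y * indicator Z (\<omega>, y) \<partial>S)"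
        by (cases "\<omega> \<in> A") (simp_all add: Z indicator_times)
    qed
    also have "\<dots> = (\<integral>\<^sup>+\<omega>. (\<integral>\<^sup>+y. p \<omega> y * indicator Z (\<omega>, y) \<partial>S) \<partial>?R)"
    proof (rule nnR[symmetric])
      have "Z \<in> sets (F \<Otimes>\<^sub>M S)" unfolding Z using A B by (rule pair_measureI)
      then have "(\<lambda>z. case_prod p z * indicator Z z) \<in> borel_measurable (F \<Otimes>\<^sub>M S)"
        by (intro borel_measurable_times_ennreal p borel_measurable_indicator)
      from S.borel_measurable_nn_integral_fst[OF this]
      show "(\<lambda>\<omega>. \<integral>\<^sup>+y. p \<omega> y * indicator Z (\<omega>, y) \<partial>S) \<in> borel_measurable F"
        by (simp only: prod.case)
    qed
    also have "\<dots> = (\<integral>\<^sup>+z. case_prod p z * indicator Z z \<partial>(?R \<Otimes>\<^sub>M S))"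
      using S.nn_integral_fst[OF borel_measurable_times_ennreal[OF p' borel_measurable_indicator[OF ZR]]]
      by (simp only: prod.case)
    also have "\<dots> = emeasure (density (?R \<Otimes>\<^sub>M S) (case_prod p)) Z"
      by (rule emeasure_density[OF p' ZR, symmetric])
    finally show "emeasure (distr M (F \<Otimes>\<^sub>M S) (\<lambda>\<omega>. (\<omega>, Y \<omega>))) Z = emeasure (density (?R \<Otimes>\<^sub>M S) (case_prod p)) Z" .
  qed
  have "(\<integral>\<^sup>+\<omega>. h (\<omega>, Y \<omega>) \<partial>M) = (\<integral>\<^sup>+z. h z \<partial>distr M (F \<Otimes>\<^sub>M S) (\<lambda>\<omega>. (\<omega>, Y \<omega>)))"
    by (subst nn_integral_distr) auto
  also have "\<dots> = (\<integral>\<^sup>+z. case_prod p z * h z \<partial>(?R \<Otimes>\<^sub>M S))"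
    unfolding key by (rule nn_integral_density[OF p' h'])
  also have "\<dots> = (\<integral>\<^sup>+\<omega>. \<integral>\<^sup>+y. p \<omega> y * h (\<omega>, y) \<partial>S \<partial>?R)"
    using S.nn_integral_fst[OF borel_measurable_times_ennreal[OF p' h']] by (simp only: prod.case)
  also have "\<dots> = (\<integral>\<^sup>+\<omega>. \<integral>\<^sup>+y. p \<omega> y * h (\<omega>, y) \<partial>S \<partial>M)"
    using S.borel_measurable_nn_integral_fst[OF borel_measurable_times_ennreal[OF p h]]
    by (intro nnR) (simp only: prod.case)
  finally show ?thesis .
qed


section \<open>Moments of the log-likelihood ratio\<close>

text \<open>Finite variance excludes an infinite mean and any mass of \<open>p\<close> where
  \<open>q\<close> vanishes, since either would make the squared deviation infinite on a set of
  positive mass. After that the extended logarithm can be replaced by the real \<open>ln\<close>.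
  The moment identity has the form of one step of the score martingale: \<open>z\<close> is the sum
  so far, \<open>w\<close> a predictable factor, and the cross term has mean zero.\<close>

lemma log_div_moments:
  fixes p q :: "'y \<Rightarrow> real"
  assumes p: "is_density \<mu> p" and q: "is_density \<mu> q"
    and V0: "0 < log_div_var \<mu> p q" and Vfin: "log_div_var \<mu> p q < \<infinity>"
  obtains I V where "log_div \<mu> p q = ereal I" "0 < I" "0 \<le> V"
    "AE y in \<mu>. q y = 0 \<longrightarrow> p y = 0"
    "\<And>z w. (\<integral>\<^sup>+y. ennreal (p y) * ennreal ((z + w * (ln (p y / q y) - I))\<^sup>2) \<partial>\<mu>) = ennreal (z\<^sup>2 + w\<^sup>2 * V)"
proof -
  define J where "J = log_div \<mu> p q"
  have [measurable]: "p \<in> borel_measurable \<mu>" "q \<in> borel_measurable \<mu>"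
    and p0: "\<And>y. 0 \<le> p y" and q0: "\<And>y. 0 \<le> q y"
    and p1: "(\<integral>\<^sup>+y. ennreal (p y) \<partial>\<mu>) = 1" and q1: "(\<integral>\<^sup>+y. ennreal (q y) \<partial>\<mu>) = 1"
    using p q by (auto simp: is_density_def)
  have ip: "integrable \<mu> p" and iq: "integrable \<mu> q"
    using p1 q1 p0 q0 by (auto intro!: integrableI_nonneg)
  have lp: "(\<integral>y. p y \<partial>\<mu>) = 1" and lq: "(\<integral>y. q y \<partial>\<mu>) = 1"
    using p1 q1 p0 q0 by (auto simp: integral_eq_nn_integral)
  have [measurable]: "log_ratio p q \<in> borel_measurable \<mu>"
    unfolding log_ratio_def[abs_def] by measurable
  have [measurable]: "(\<lambda>y. e2ennreal ((log_ratio p q y - J)\<^sup>2 * ereal (p y))) \<in> borel_measurable \<mu>"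
    unfolding power2_eq_square by measurable
  have fin: "AE y in \<mu>. e2ennreal ((log_ratio p q y - J)\<^sup>2 * ereal (p y)) \<noteq> \<infinity>"
    using Vfin unfolding log_div_var_def J_def[symmetric]
    by (intro nn_integral_noteq_infinite) auto
  have Jfin: "\<bar>J\<bar> \<noteq> \<infinity>"
  proof
    assume J: "\<bar>J\<bar> = \<infinity>"
    have "AE y in \<mu>. ennreal (p y) = 0"
      using fin
    proof eventually_elim
      case (elim y)
      show ?case
      proof (rule ccontr)
        assume "ennreal (p y) \<noteq> 0"
        then have py: "p y > 0" using p0[of y] by (auto simp: ennreal_eq_0_iff)
        then have "log_ratio p q y \<noteq> - \<infinity>" by (auto simp: log_ratio_def)
        \<comment> \<open>This includes the case of two infinities: \<infinity> - \<infinity> =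
          \<infinity> in \<open>ereal\<close>.\<close>
        then have "\<bar>log_ratio p q y - J\<bar> = \<infinity>"
          using J by (cases "log_ratio p q y"; cases J) auto
        then have "(log_ratio p q y - J)\<^sup>2 = \<infinity>"
          by (cases "log_ratio p q y - J") (auto simp: power2_eq_square)
        then show False using elim py by simp
      qed
    qed
    then have "(\<integral>\<^sup>+y. ennreal (p y) \<partial>\<mu>) = 0"
      by (subst nn_integral_0_iff_AE) auto
    then show False using p1 by simp
  qed
  then obtain I where I: "J = ereal I" by (cases J) auto
  have ac: "AE y in \<mu>. q y = 0 \<longrightarrow> p y = 0"
    using fin
  proof eventually_elim
    case (elim y)
    show ?case
    proof (intro impI, rule ccontr)
      assume "q y = 0" "p y \<noteq> 0"
      then have "log_ratio p q y = \<infinity>" "p y > 0" using p0[of y] by (auto simp: log_ratio_def)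
      then show False using elim by (simp add: I power2_eq_square)
    qed
  qed
  define l where "l y = ln (p y / q y)" for y
  have [measurable]: "l \<in> borel_measurable \<mu>" unfolding l_def[abs_def] by measurable
  have lr: "AE y in \<mu>. log_ratio p q y * ereal (p y) = ereal (l y * p y)"
    using ac by eventually_elim (auto simp: log_ratio_def l_def)
  have lr2: "AE y in \<mu>. (log_ratio p q y - J)\<^sup>2 * ereal (p y) = ereal ((l y - I)\<^sup>2 * p y)"
    using ac by eventually_elim (auto simp: log_ratio_def l_def I power2_eq_square)
  have Veq: "log_div_var \<mu> p q = (\<integral>\<^sup>+y. ennreal ((l y - I)\<^sup>2 * p y) \<partial>\<mu>)"
    unfolding log_div_var_def J_def[symmetric]
    by (rule nn_integral_cong_AE) (use lr2 in \<open>auto simp: e2ennreal_ereal\<close>)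
  have i2: "integrable \<mu> (\<lambda>y. (l y - I)\<^sup>2 * p y)"
    using Vfin Veq p0 by (intro integrableI_nonneg) auto
  have i1: "integrable \<mu> (\<lambda>y. (l y - I) * p y)"
  proof (rule Bochner_Integration.integrable_bound)
    show "integrable \<mu> (\<lambda>y. p y + (l y - I)\<^sup>2 * p y)" using ip i2 by auto
    have "\<bar>u\<bar> \<le> 1 + u\<^sup>2" for u :: real
    proof -
      have "0 \<le> (\<bar>u\<bar> - 1)\<^sup>2" by simp
      then have "2 * \<bar>u\<bar> \<le> u\<^sup>2 + 1" by (simp add: power2_eq_square algebra_simps)
      then show ?thesis using abs_ge_zero[of u] zero_le_power2[of u] by linarith
    qed
    then have "\<bar>l y - I\<bar> * p y \<le> (1 + (l y - I)\<^sup>2) * p y" for y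
      by (intro mult_right_mono p0)
    then show "AE y in \<mu>. norm ((l y - I) * p y) \<le> norm (p y + (l y - I)\<^sup>2 * p y)"
      using p0 by (intro AE_I2) (simp add: abs_mult distrib_right)
  qed auto
  have il: "integrable \<mu> (\<lambda>y. l y * p y)"
  proof -
    have "integrable \<mu> (\<lambda>y. (l y - I) * p y + I * p y)" using i1 ip by auto
    then show ?thesis by (simp add: algebra_simps)
  qed
  have lI: "(\<integral>y. l y * p y \<partial>\<mu>) = I"
  proof -
    have e: "J = enn2ereal (\<integral>\<^sup>+y. ennreal (l y * p y) \<partial>\<mu>) - enn2ereal (\<integral>\<^sup>+y. ennreal (- (l y * p y)) \<partial>\<mu>)"
    proof -
      have "(\<integral>\<^sup>+y. e2ennreal (log_ratio p q y * ereal (p y)) \<partial>\<mu>) = (\<integral>\<^sup>+y. ennreal (l y * p y) \<partial>\<mu>)"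
        by (rule nn_integral_cong_AE) (use lr in \<open>eventually_elim, simp add: e2ennreal_ereal\<close>)
      moreover have "(\<integral>\<^sup>+y. e2ennreal (- (log_ratio p q y * ereal (p y))) \<partial>\<mu>) = (\<integral>\<^sup>+y. ennreal (- (l y * p y)) \<partial>\<mu>)"
        by (rule nn_integral_cong_AE) (use lr in \<open>eventually_elim, simp add: e2ennreal_ereal\<close>)
      ultimately show ?thesis by (simp add: J_def log_div_def)
    qed
    have f1: "(\<integral>\<^sup>+y. ennreal (l y * p y) \<partial>\<mu>) \<noteq> \<top>" "(\<integral>\<^sup>+y. ennreal (- (l y * p y)) \<partial>\<mu>) \<noteq> \<top>"
      using il unfolding real_integrable_def by auto
    have f2: "enn2ereal u = ereal (enn2real u)" if "u \<noteq> \<top>" for u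
      using that by (cases u) auto
    have "J = ereal (\<integral>y. l y * p y \<partial>\<mu>)"
      unfolding e real_lebesgue_integral_def[OF il] using f1 by (simp add: f2)
    then show ?thesis by (simp add: I)
  qed
  define V where "V = (\<integral>y. (l y - I)\<^sup>2 * p y \<partial>\<mu>)"
  have V: "0 \<le> V" unfolding V_def using p0 by (intro integral_nonneg_AE) auto
  have m0: "(\<integral>y. (l y - I) * p y \<partial>\<mu>) = 0"
    using il ip lI lp by (simp add: left_diff_distrib)
  have mom: "(\<integral>\<^sup>+y. ennreal (p y) * ennreal ((z + w * (ln (p y / q y) - I))\<^sup>2) \<partial>\<mu>) = ennreal (z\<^sup>2 + w\<^sup>2 * V)" for z w
  proof -
    have ex: "(z + w * (l y - I))\<^sup>2 * p y = z\<^sup>2 * p y + (2 * z * w) * ((l y - I) * p y) + w\<^sup>2 * ((l y - I)\<^sup>2 * p y)" for y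
      by (simp add: power2_eq_square algebra_simps)
    have ii: "integrable \<mu> (\<lambda>y. (z + w * (l y - I))\<^sup>2 * p y)"
      unfolding ex using ip i1 i2 by auto
    have "(\<integral>y. (z + w * (l y - I))\<^sup>2 * p y \<partial>\<mu>) = z\<^sup>2 + w\<^sup>2 * V"
      unfolding ex using ip i1 i2 by (simp add: lp m0 V_def)
    moreover have "(\<integral>\<^sup>+y. ennreal ((z + w * (l y - I))\<^sup>2 * p y) \<partial>\<mu>) = ennreal (\<integral>y. (z + w * (l y - I))\<^sup>2 * p y \<partial>\<mu>)"
      using ii p0 by (intro nn_integral_eq_integral) auto
    ultimately show ?thesis
      by (simp add: l_def ennreal_mult'[OF p0, symmetric] mult.commute)
  qed
  have Ipos: "0 < I"
  proof (rule ccontr)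
    assume "\<not> 0 < I"
    \<comment> \<open>By ln u \<le> u - 1 this is nonnegative, and it integrates to \<open>I\<close>
      because \<open>p\<close> and \<open>q\<close> have the same mass. If \<open>I \<le> 0\<close>,
      then \<open>r\<close> is 0 almost everywhere, equality in the logarithm inequality forces
      \<open>p = q\<close> where \<open>p > 0\<close>, and the variance would vanish.\<close>
    define r where "r y = l y * p y - (p y - q y)" for y
    have ir: "integrable \<mu> r" unfolding r_def[abs_def] using il ip iq by auto
    have r0: "AE y in \<mu>. 0 \<le> r y"
      using ac
    proof eventually_elim
      case (elim y)
      show ?case
      proof (cases "p y = 0")
        case False
        then have pq: "p y > 0" "q y > 0" using p0[of y] q0[of y] elim by (auto simp: order_less_le)
        have "ln (q y / p y) \<le> q y / p y - 1" using pq by (intro ln_le_minus_one) auto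
        moreover have "ln (q y / p y) = - l y" using pq by (simp add: l_def ln_div)
        ultimately have "(1 - q y / p y) * p y \<le> l y * p y" using pq by (intro mult_right_mono) auto
        moreover have "(1 - q y / p y) * p y = p y - q y" using pq by (simp add: field_simps)
        ultimately show ?thesis by (simp add: r_def)
      qed (use q0 in \<open>auto simp: r_def\<close>)
    qed
    have "(\<integral>y. r y \<partial>\<mu>) = I" unfolding r_def using il ip iq lI lp lq by simp
    moreover have "0 \<le> (\<integral>y. r y \<partial>\<mu>)" using r0 by (rule integral_nonneg_AE)
    ultimately have I0: "I = 0" and "(\<integral>y. r y \<partial>\<mu>) = 0" using \<open>\<not> 0 < I\<close> by auto
    then have "AE y in \<mu>. r y = 0" using integral_nonneg_eq_0_iff_AE[OF ir r0] by auto
    then have "AE y in \<mu>. ennreal ((l y - I)\<^sup>2 * p y) = 0"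
      using ac
    proof eventually_elim
      case (elim y)
      show ?case
      proof (cases "p y = 0")
        case False
        then have pq: "p y > 0" "q y > 0" using p0[of y] q0[of y] elim by (auto simp: order_less_le)
        have "l y * p y = p y - q y" using elim by (simp add: r_def)
        then have "ln (q y / p y) = q y / p y - 1" using pq by (simp add: l_def ln_div field_simps)
        then have "q y / p y = 1" using pq by (intro ln_eq_minus_one) auto
        then have "l y = 0" using pq by (simp add: l_def)
        then show ?thesis by (simp add: I0)
      qed auto
    qed
    then have "log_div_var \<mu> p q = 0" unfolding Veq by (subst nn_integral_0_iff_AE) auto
    then show False using V0 by simp
  qed
  show thesis
    by (rule that[OF _ Ipos V ac mom]) (use I in \<open>simp add: J_def\<close>)
qed

section \<open>One step of the model\<close>

lemma measurable_map_list_count_space: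
  fixes X :: "nat \<Rightarrow> 'w \<Rightarrow> 'b::countable"
  assumes "\<And>s. s \<in> set xs \<Longrightarrow> X s \<in> F \<rightarrow>\<^sub>M count_space UNIV"
  shows "(\<lambda>\<omega>. map (\<lambda>s. X s \<omega>) xs) \<in> F \<rightarrow>\<^sub>M count_space UNIV"
  using assms
proof (induction xs)
  case (Cons a xs)
  have 1: "(\<lambda>\<omega>. X a \<omega> # i) \<in> F \<rightarrow>\<^sub>M count_space UNIV" for i
    by (rule measurable_compose[where N="count_space UNIV"]) (use Cons.prems in auto)
  have 2: "(\<lambda>\<omega>. map (\<lambda>s. X s \<omega>) xs) \<in> F \<rightarrow>\<^sub>M count_space UNIV"
    using Cons by auto
  show ?case
    unfolding list.map by (rule measurable_compose_countable[OF 1 2])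
qed simp

section \<open>Observed histories and the standing assumptions\<close>

lemma hist_0: "hist X Y 0 \<omega> = (\<lambda>_. undefined)"
  by (auto simp: hist_def)

lemma hist_Suc: "hist X Y (Suc t) \<omega> = (hist X Y t \<omega>)(Suc t := (X (Suc t) \<omega>, Y (Suc t) \<omega>))"
  by (auto simp: hist_def fun_eq_iff)

lemma hist_apply: "s \<in> {1..t} \<Longrightarrow> hist X Y t \<omega> s = (X s \<omega>, Y s \<omega>)"
  by (simp add: hist_def)

lemma restrict_hist: "s \<le> t \<Longrightarrow> restrict (hist X Y t \<omega>) {1..s} = hist X Y s \<omega>"
  by (auto simp: hist_def fun_eq_iff)

text \<open>Extending by \<open>0\<close> outside the treatments makes \<open>d\<close> jointly measurable: nothing is known
  about the densities at other indices.\<close>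

definition on_treatments :: "nat \<Rightarrow> (nat \<Rightarrow> 'y \<Rightarrow> real) \<Rightarrow> nat \<Rightarrow> 'y \<Rightarrow> real" where
  "on_treatments K d x y = (if x \<in> {1..K} then d x y else 0)"

lemma measurable_on_treatments:
  assumes "\<And>x. x \<in> {1..K} \<Longrightarrow> d x \<in> borel_measurable borel"
  shows "(\<lambda>(x, y). on_treatments K d x y) \<in> borel_measurable (count_space UNIV \<Otimes>\<^sub>M borel)"
proof -
  have "on_treatments K d x \<in> borel_measurable borel" for x
  proof (cases "x \<in> {1..K}")
    case True
    then have "on_treatments K d x = d x" by (auto simp: on_treatments_def)
    with assms[OF True] show ?thesis by simp
  next
    case False
    then have "on_treatments K d x = (\<lambda>_. 0)" by (auto simp: on_treatments_def)
    then show ?thesis by simp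
  qed
  then show ?thesis
    by (intro measurable_pair_measure_countable1) simp_all
qed

text \<open>One value of \<alpha> and one rule are fixed. Densities and transition probabilities are
  constrained only for treatments in \<open>{1..K}\<close>, as in the theorem.\<close>

locale ruled_change_point_model = change_point_model M \<mu> f g \<pi> \<phi> L X Y + mu: sigma_finite_measure \<mu>
  for M :: "'w measure"
    and \<mu> :: "'y::polish_space measure"
    and f g :: "nat \<Rightarrow> 'y \<Rightarrow> real"
    and \<pi> :: "nat list \<Rightarrow> real"
    and \<phi> :: "'y rule"
    and L :: "nat \<Rightarrow> 'w \<Rightarrow> bool"
    and X :: "nat \<Rightarrow> 'w \<Rightarrow> nat"
    and Y :: "nat \<Rightarrow> 'w \<Rightarrow> 'y" +
  fixes K :: nat
  assumes sets_mu [measurable_cong]: "sets \<mu> = sets borel"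
    and rule: "assignment_rule K \<phi>"
    and densities: "\<And>x. x \<in> {1..K} \<Longrightarrow> is_density \<mu> (f x) \<and> is_density \<mu> (g x)"
    and pi_range: "\<And>z. z \<in> lists {1..K} \<Longrightarrow> 0 \<le> \<pi> z \<and> \<pi> z < 1"
begin

abbreviation past :: "nat \<Rightarrow> 'w \<Rightarrow> nat \<Rightarrow> nat \<times> 'y" where "past \<equiv> hist X Y"

text \<open>The model does not state that treatments lie in \<open>{1..K}\<close>. This comes from
  the rule, which maps histories with treatments in \<open>{1..K}\<close> to \<open>{1..K}\<close>,
  by induction on time. Measurability of the treatments is obtained in the same way.\<close>

lemma X_in: "\<omega> \<in> space M \<Longrightarrow> s \<in> {1..t} \<Longrightarrow> X s \<omega> \<in> {1..K}"
proof (induction t arbitrary: s)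
  case (Suc t)
  show ?case
  proof (cases "s = Suc t")
    case True
    have "past t \<omega> \<in> space (\<Pi>\<^sub>M s\<in>{1..t}. count_space {1..K} \<Otimes>\<^sub>M (borel :: 'y measure))"
      using Suc.IH[OF Suc.prems(1)] by (auto simp: space_PiM space_pair_measure hist_def)
    moreover have "\<phi> t \<in> (\<Pi>\<^sub>M s\<in>{1..t}. count_space {1..K} \<Otimes>\<^sub>M borel) \<rightarrow>\<^sub>M count_space {1..K}"
      using rule by (simp add: assignment_rule_def)
    ultimately have "\<phi> t (past t \<omega>) \<in> {1..K}"
      by (metis measurable_space space_count_space)
    then show ?thesis using True X_rule[OF Suc.prems(1)] by simp
  qed (use Suc in auto)
qed simp

lemma X_Suc_in: "\<omega> \<in> space M \<Longrightarrow> X (Suc t) \<omega> \<in> {1..K}"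
  by (rule X_in[of _ _ "Suc t"]) auto

lemma X_list_in: "\<omega> \<in> space M \<Longrightarrow> map (\<lambda>s. X s \<omega>) [1..<Suc t] \<in> lists {1..K}"
proof (rule in_listsI, rule ballI)
  fix x assume \<omega>: "\<omega> \<in> space M" and "x \<in> set (map (\<lambda>s. X s \<omega>) [1..<Suc t])"
  then obtain s where "x = X s \<omega>" "s \<in> {1..t}" by (auto simp del: upt_Suc)
  then show "x \<in> {1..K}" using X_in[OF \<omega>, of s t] by simp
qed

lemma Pi_range: "\<omega> \<in> space M \<Longrightarrow> 0 \<le> Pi_t \<pi> X t \<omega> \<and> Pi_t \<pi> X t \<omega> < 1"
  unfolding Pi_t_def using X_list_in[of \<omega> t] by (intro pi_range)

lemma measurable_X: "s \<in> {1..t} \<Longrightarrow> X s \<in> M \<rightarrow>\<^sub>M count_space {1..K}"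
proof (induction t arbitrary: s)
  case (Suc t)
  show ?case
  proof (cases "s = Suc t")
    case True
    have "past t \<in> M \<rightarrow>\<^sub>M (\<Pi>\<^sub>M s\<in>{1..t}. count_space {1..K} \<Otimes>\<^sub>M borel)"
      unfolding hist_def[abs_def]
    proof (rule measurable_restrict)
      fix s assume s: "s \<in> {1..t}"
      then obtain r where "s = Suc r" by (cases s) auto
      then show "(\<lambda>\<omega>. (X s \<omega>, Y s \<omega>)) \<in> M \<rightarrow>\<^sub>M count_space {1..K} \<Otimes>\<^sub>M borel"
        using Suc.IH[OF s] Y_measurable by (intro measurable_Pair) auto
    qed
    moreover have "\<phi> t \<in> (\<Pi>\<^sub>M s\<in>{1..t}. count_space {1..K} \<Otimes>\<^sub>M borel) \<rightarrow>\<^sub>M count_space {1..K}"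
      using rule by (simp add: assignment_rule_def)
    ultimately have "(\<lambda>\<omega>. \<phi> t (past t \<omega>)) \<in> M \<rightarrow>\<^sub>M count_space {1..K}"
      by (rule measurable_compose)
    then show ?thesis
      unfolding True by (subst measurable_cong[OF X_rule])
  qed (use Suc in auto)
qed simp

lemma measurable_X_UNIV [measurable]: "X (Suc t) \<in> M \<rightarrow>\<^sub>M count_space UNIV"
  by (rule measurable_compose[OF measurable_X[of "Suc t" "Suc t"]]) auto

lemma measurable_Y [measurable]: "Y (Suc t) \<in> M \<rightarrow>\<^sub>M borel"
  by (rule Y_measurable)

lemma measurable_L [measurable]: "L t \<in> M \<rightarrow>\<^sub>M count_space UNIV"
  by (rule L_measurable)

lemma measurable_hist [measurable]: "past t \<in> M \<rightarrow>\<^sub>M hist_space t"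
  unfolding hist_def[abs_def]
proof (rule measurable_restrict)
  fix s assume s: "s \<in> {1..t}"
  then obtain r where "s = Suc r" by (cases s) auto
  then show "(\<lambda>\<omega>. (X s \<omega>, Y s \<omega>)) \<in> M \<rightarrow>\<^sub>M count_space UNIV \<Otimes>\<^sub>M borel"
    by (auto intro: measurable_Pair)
qed

abbreviation fK :: "nat \<Rightarrow> 'y \<Rightarrow> real" where "fK \<equiv> on_treatments K f"
abbreviation gK :: "nat \<Rightarrow> 'y \<Rightarrow> real" where "gK \<equiv> on_treatments K g"

lemma measurable_fK_gK [measurable]:
  "(\<lambda>(x, y). fK x y) \<in> borel_measurable (count_space UNIV \<Otimes>\<^sub>M borel)"
  "(\<lambda>(x, y). gK x y) \<in> borel_measurable (count_space UNIV \<Otimes>\<^sub>M borel)"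
proof -
  have "f x \<in> borel_measurable borel \<and> g x \<in> borel_measurable borel" if "x \<in> {1..K}" for x
    using densities[OF that] unfolding is_density_def measurable_cong_sets[OF sets_mu refl] by blast
  then show "(\<lambda>(x, y). fK x y) \<in> borel_measurable (count_space UNIV \<Otimes>\<^sub>M borel)"
    "(\<lambda>(x, y). gK x y) \<in> borel_measurable (count_space UNIV \<Otimes>\<^sub>M borel)"
    by (blast intro: measurable_on_treatments)+
qed

lemma nn_integral_fK_gK:
  assumes "x \<in> {1..K}"
  shows "(\<integral>\<^sup>+y. ennreal (fK x y) \<partial>\<mu>) = 1" "(\<integral>\<^sup>+y. ennreal (gK x y) \<partial>\<mu>) = 1"
  using densities[OF assms] assms by (simp_all add: on_treatments_def is_density_def)

section \<open>Information before a response and before a transition\<close>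

definition pre_response :: "nat \<Rightarrow> 'w measure" where
  "pre_response t = vimage_algebra (space M) (\<lambda>\<omega>. (X (Suc t) \<omega>, past t \<omega>, \<lambda>s\<in>{..Suc t}. L s \<omega>))
     (count_space UNIV \<Otimes>\<^sub>M hist_space t \<Otimes>\<^sub>M (\<Pi>\<^sub>M s\<in>{..Suc t}. count_space UNIV))"

definition pre_transition :: "nat \<Rightarrow> 'w measure" where
  "pre_transition t = vimage_algebra (space M) (\<lambda>\<omega>. (L t \<omega>, past t \<omega>, X (Suc t) \<omega>))
              (count_space UNIV \<Otimes>\<^sub>M hist_space t \<Otimes>\<^sub>M count_space UNIV)"

lemma subalgebra_vimage:
  assumes "U \<in> M \<rightarrow>\<^sub>M N" shows "subalgebra M (vimage_algebra (space M) U N)"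
  using assms by (auto simp: subalgebra_def sets_vimage_algebra2 measurable_def)

lemma finite_subalgebra_sigma_finite:
  assumes "subalgebra M F" shows "sigma_finite_subalgebra M F"
proof -
  interpret finite_measure_subalgebra M F
    by unfold_locales (rule assms)
  show ?thesis by (rule sigma_finite_subalgebra_axioms)
qed

lemma pre_response_map:
  "(\<lambda>\<omega>. (X (Suc t) \<omega>, past t \<omega>, \<lambda>s\<in>{..Suc t}. L s \<omega>)) \<in> M \<rightarrow>\<^sub>M
     count_space UNIV \<Otimes>\<^sub>M hist_space t \<Otimes>\<^sub>M (\<Pi>\<^sub>M s\<in>{..Suc t}. count_space UNIV)"
  by (intro measurable_Pair measurable_X_UNIV measurable_hist measurable_restrict measurable_L)

lemma pre_transition_map:
  "(\<lambda>\<omega>. (L t \<omega>, past t \<omega>, X (Suc t) \<omega>)) \<in> M \<rightarrow>\<^sub>M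
     count_space UNIV \<Otimes>\<^sub>M hist_space t \<Otimes>\<^sub>M count_space UNIV"
  by (intro measurable_Pair measurable_X_UNIV measurable_hist measurable_L)

lemma subalgebra_pre: "subalgebra M (pre_response t)" "subalgebra M (pre_transition t)"
  unfolding pre_response_def pre_transition_def
  by (intro subalgebra_vimage pre_response_map pre_transition_map)+

lemma space_pre [simp]: "space (pre_response t) = space M" "space (pre_transition t) = space M"
  using subalgebra_pre by (auto simp: subalgebra_def)

lemma pre_response_self:
  "(\<lambda>\<omega>. (X (Suc t) \<omega>, past t \<omega>, \<lambda>s\<in>{..Suc t}. L s \<omega>)) \<in> pre_response t \<rightarrow>\<^sub>M
     count_space UNIV \<Otimes>\<^sub>M hist_space t \<Otimes>\<^sub>M (\<Pi>\<^sub>M s\<in>{..Suc t}. count_space UNIV)"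
  unfolding pre_response_def
  by (rule measurable_vimage_algebra1) (use pre_response_map[THEN measurable_space] in auto)

lemma measurable_pre_response [measurable]:
  "X (Suc t) \<in> pre_response t \<rightarrow>\<^sub>M count_space UNIV"
  "past t \<in> pre_response t \<rightarrow>\<^sub>M hist_space t"
proof -
  note * = pre_response_self[of t]
  show "X (Suc t) \<in> pre_response t \<rightarrow>\<^sub>M count_space UNIV"
    using measurable_compose[OF * measurable_fst] by simp
  show "past t \<in> pre_response t \<rightarrow>\<^sub>M hist_space t"
    using measurable_compose[OF measurable_compose[OF * measurable_snd] measurable_fst] by simp
qed

lemma measurable_L_pre_response [measurable (raw)]:
  assumes "s \<le> Suc t" shows "L s \<in> pre_response t \<rightarrow>\<^sub>M count_space UNIV"
proof -
  note * = pre_response_self[of t]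
  have "(\<lambda>\<omega>. (\<lambda>s\<in>{..Suc t}. L s \<omega>) s) \<in> pre_response t \<rightarrow>\<^sub>M count_space UNIV"
    using measurable_compose[OF measurable_compose[OF measurable_compose[OF * measurable_snd] measurable_snd]
       measurable_component_singleton[of s]] assms by simp
  then show ?thesis using assms by simp
qed

lemma measurable_pre_transition [measurable]:
  "L t \<in> pre_transition t \<rightarrow>\<^sub>M count_space UNIV"
  "X (Suc t) \<in> pre_transition t \<rightarrow>\<^sub>M count_space UNIV"
  "past t \<in> pre_transition t \<rightarrow>\<^sub>M hist_space t"
proof -
  have *: "(\<lambda>\<omega>. (L t \<omega>, past t \<omega>, X (Suc t) \<omega>)) \<in> pre_transition t \<rightarrow>\<^sub>M
     count_space UNIV \<Otimes>\<^sub>M hist_space t \<Otimes>\<^sub>M count_space UNIV"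
    unfolding pre_transition_def
    by (rule measurable_vimage_algebra1) (use pre_transition_map[THEN measurable_space] in auto)
  show "L t \<in> pre_transition t \<rightarrow>\<^sub>M count_space UNIV"
    using measurable_compose[OF * measurable_fst] by simp
  show "X (Suc t) \<in> pre_transition t \<rightarrow>\<^sub>M count_space UNIV"
    using measurable_compose[OF measurable_compose[OF * measurable_snd] measurable_snd] by simp
  show "past t \<in> pre_transition t \<rightarrow>\<^sub>M hist_space t"
    using measurable_compose[OF measurable_compose[OF * measurable_snd] measurable_fst] by simp
qed

text \<open>The response is integrated out given all that precedes it. \<open>fK\<close> and
  \<open>gK\<close> may replace \<open>f\<close> and \<open>g\<close> because the next treatment
  lies in \<open>{1..K}\<close>, and with them the integrand is jointly measurable.\<close>

lemma nn_integral_response: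
  assumes h: "h \<in> borel_measurable (pre_response t \<Otimes>\<^sub>M \<mu>)"
  shows "(\<integral>\<^sup>+\<omega>. h (\<omega>, Y (Suc t) \<omega>) \<partial>M) =
    (\<integral>\<^sup>+\<omega>. \<integral>\<^sup>+y. ennreal ((if L (Suc t) \<omega> then gK else fK) (X (Suc t) \<omega>) y) * h (\<omega>, y) \<partial>\<mu> \<partial>M)"
proof -
  interpret F: sigma_finite_subalgebra M "pre_response t"
    by (rule finite_subalgebra_sigma_finite[OF subalgebra_pre(1)])
  show ?thesis
  proof (rule F.nn_integral_conditional_density[OF finite_measure_axioms mu.sigma_finite_measure_axioms _ _ _ _ h])
    show "Y (Suc t) \<in> M \<rightarrow>\<^sub>M \<mu>"
      using Y_measurable measurable_cong_sets[OF refl sets_mu] by blast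
    have [measurable]: "(\<lambda>z. L (Suc t) (fst z)) \<in> pre_response t \<Otimes>\<^sub>M \<mu> \<rightarrow>\<^sub>M count_space UNIV"
      by (rule measurable_compose[OF measurable_fst]) simp
    have 2: "(\<lambda>z. (X (Suc t) (fst z), snd z)) \<in> pre_response t \<Otimes>\<^sub>M \<mu> \<rightarrow>\<^sub>M count_space UNIV \<Otimes>\<^sub>M borel"
      by measurable
    have "(\<lambda>z. ennreal (if L (Suc t) (fst z) then case_prod gK (X (Suc t) (fst z), snd z) else case_prod fK (X (Suc t) (fst z), snd z)))
       \<in> borel_measurable (pre_response t \<Otimes>\<^sub>M \<mu>)"
      using measurable_compose[OF 2 measurable_fK_gK(1)] measurable_compose[OF 2 measurable_fK_gK(2)]
      by (intro measurable_compose[OF _ measurable_ennreal] measurable_If) auto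
    then show "(\<lambda>(\<omega>, y). ennreal ((if L (Suc t) \<omega> then gK else fK) (X (Suc t) \<omega>) y)) \<in> borel_measurable (pre_response t \<Otimes>\<^sub>M \<mu>)"
      by (simp add: case_prod_beta if_distrib[of "\<lambda>h. h _ _"])
    show "(\<integral>\<^sup>+y. ennreal ((if L (Suc t) \<omega> then gK else fK) (X (Suc t) \<omega>) y) \<partial>\<mu>) = 1" if "\<omega> \<in> space M" for \<omega>
      using nn_integral_fK_gK[OF X_Suc_in[OF that]] by simp
    fix B assume "B \<in> sets \<mu>"
    then have "B \<in> sets borel" by (simp add: sets_mu)
    from Y_response[OF this, of t]
    show "AE \<omega> in M. real_cond_exp M (pre_response t) (indicator {\<omega>. Y (Suc t) \<omega> \<in> B}) \<omega> =
      measure (density \<mu> (\<lambda>y. ennreal ((if L (Suc t) \<omega> then gK else fK) (X (Suc t) \<omega>) y))) B"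
      unfolding pre_response_def[symmetric]
      using AE_space
      by eventually_elim (use X_Suc_in in \<open>simp add: on_treatments_def if_distrib[of "\<lambda>h. h _ _"] cong: if_cong\<close>)
  qed
qed

end

text \<open>Assignment rules are measurable only on histories whose treatments lie in \<open>{1..K}\<close>, whereas
  stopping times refer to histories with arbitrary treatments. Clipping is a measurable retraction
  between the two spaces that fixes every history of the model.\<close>

definition clip :: "nat \<Rightarrow> nat \<Rightarrow> (nat \<Rightarrow> nat \<times> 'y) \<Rightarrow> nat \<Rightarrow> nat \<times> 'y" where
  "clip K t v = (\<lambda>s\<in>{1..t}. (if fst (v s) \<in> {1..K} then fst (v s) else 1, snd (v s)))"

definition treat :: "nat \<Rightarrow> 'y rule \<Rightarrow> nat \<Rightarrow> (nat \<Rightarrow> nat \<times> 'y) \<Rightarrow> nat" where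
  "treat K \<phi> t v = \<phi> t (clip K t v)"

text \<open>This and \<open>next_exp\<close> describe one step by functions of the history instead
  of the sample point, so that models on different probability spaces can share them.
  \<open>next_exp\<close> is the conditional expectation of \<open>h\<close> at the extended history
  when the treatment is \<open>x\<close> and the response has density \<open>d x\<close>.\<close>

definition next_prob :: "(nat list \<Rightarrow> real) \<Rightarrow> nat \<Rightarrow> nat \<Rightarrow> (nat \<Rightarrow> nat \<times> 'y) \<Rightarrow> real" where
  "next_prob \<pi> t x v = \<pi> (map (\<lambda>s. fst (v s)) [1..<Suc t] @ [x])"

definition next_exp :: "'y measure \<Rightarrow> (nat \<Rightarrow> 'y \<Rightarrow> real) \<Rightarrow> nat \<Rightarrow> nat \<Rightarrow>
    ((nat \<Rightarrow> nat \<times> 'y) \<Rightarrow> ennreal) \<Rightarrow> (nat \<Rightarrow> nat \<times> 'y) \<Rightarrow> ennreal" where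
  "next_exp \<mu> d t x h v = (\<integral>\<^sup>+y. ennreal (d x y) * h (v(Suc t := (x, y))) \<partial>\<mu>)"

lemma measurable_fst_component:
  assumes "s \<in> {1..t}"
  shows "(\<lambda>v. fst (v s)) \<in> (\<Pi>\<^sub>M s\<in>{1..t}. count_space A \<Otimes>\<^sub>M borel) \<rightarrow>\<^sub>M count_space A"
  by (rule measurable_compose[OF measurable_component_singleton[OF assms] measurable_fst])

lemma measurable_snd_component:
  assumes "s \<in> {1..t}"
  shows "(\<lambda>v. snd (v s)) \<in> (\<Pi>\<^sub>M s\<in>{1..t}. count_space A \<Otimes>\<^sub>M borel) \<rightarrow>\<^sub>M borel"
  by (rule measurable_compose[OF measurable_component_singleton[OF assms] measurable_snd])

lemma measurable_clip:
  assumes B: "insert 1 {1..K} \<subseteq> B" and "s \<le> t"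
  shows "clip K s \<in> (\<Pi>\<^sub>M s\<in>{1..t}. count_space A \<Otimes>\<^sub>M (borel :: 'y::polish_space measure)) \<rightarrow>\<^sub>M
    (\<Pi>\<^sub>M s\<in>{1..s}. count_space B \<Otimes>\<^sub>M borel)"
  unfolding clip_def[abs_def]
proof (rule measurable_restrict, rule measurable_Pair)
  fix r assume "r \<in> {1..s}"
  then have r: "r \<in> {1..t}" using assms by auto
  show "(\<lambda>v. snd (v r)) \<in> (\<Pi>\<^sub>M s\<in>{1..t}. count_space A \<Otimes>\<^sub>M (borel :: 'y measure)) \<rightarrow>\<^sub>M borel"
    by (rule measurable_snd_component[OF r])
  show "(\<lambda>v. if fst (v r) \<in> {1..K} then fst (v r) else 1) \<in>
     (\<Pi>\<^sub>M s\<in>{1..t}. count_space A \<Otimes>\<^sub>M (borel :: 'y measure)) \<rightarrow>\<^sub>M count_space B"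
    by (rule measurable_compose[OF measurable_fst_component[OF r]]) (use B in auto)
qed

lemma clip_clip: "s \<le> t \<Longrightarrow> clip K s (clip K t v) = clip K s v"
  by (auto simp: clip_def fun_eq_iff)

lemma clip_fun_upd: "s < r \<Longrightarrow> clip K s (v(r := z)) = clip K s v"
  by (auto simp: clip_def fun_eq_iff)

lemma measurable_treat:
  assumes "assignment_rule K \<phi>" "1 \<le> K"
  shows "treat K \<phi> t \<in> hist_space t \<rightarrow>\<^sub>M count_space UNIV"
proof -
  have "\<phi> t \<in> (\<Pi>\<^sub>M s\<in>{1..t}. count_space {1..K} \<Otimes>\<^sub>M borel) \<rightarrow>\<^sub>M count_space {1..K}"
    using assms by (simp add: assignment_rule_def)
  moreover have "clip K t \<in> hist_space t \<rightarrow>\<^sub>M (\<Pi>\<^sub>M s\<in>{1..t}. count_space {1..K} \<Otimes>\<^sub>M (borel :: 'a measure))"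
    using assms(2) by (intro measurable_clip) auto
  ultimately have "(\<lambda>v. \<phi> t (clip K t v)) \<in> hist_space t \<rightarrow>\<^sub>M count_space {1..K}"
    by (rule measurable_compose[rotated])
  from measurable_compose[OF this, of id "count_space UNIV"]
  show ?thesis by (simp add: treat_def[abs_def])
qed

lemma measurable_next_prob:
  fixes x :: "(nat \<Rightarrow> nat \<times> 'y::polish_space) \<Rightarrow> nat"
  assumes x: "x \<in> hist_space t \<rightarrow>\<^sub>M count_space UNIV"
  shows "(\<lambda>v. next_prob \<pi> t (x v) v) \<in> borel_measurable (hist_space t)"
proof -
  have "(\<lambda>v. map (\<lambda>s. fst (v s)) [1..<Suc t]) \<in> (hist_space t :: (nat \<Rightarrow> nat \<times> 'y) measure) \<rightarrow>\<^sub>M count_space UNIV"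
    by (rule measurable_map_list_count_space) (rule measurable_fst_component, auto)
  moreover have "(\<lambda>v. \<pi> (l @ [x v])) \<in> borel_measurable (hist_space t)" for l
    by (rule measurable_compose[OF x]) simp
  ultimately show ?thesis
    unfolding next_prob_def by (rule measurable_compose_countable[rotated])
qed

lemma measurable_next_exp:
  fixes x :: "(nat \<Rightarrow> nat \<times> 'y::polish_space) \<Rightarrow> nat"
  assumes mu: "sigma_finite_measure \<mu>" "sets \<mu> = sets borel"
    and d: "(\<lambda>(x, y). d x y) \<in> borel_measurable (count_space UNIV \<Otimes>\<^sub>M borel)"
    and x: "x \<in> hist_space t \<rightarrow>\<^sub>M count_space UNIV"
    and h: "h \<in> borel_measurable (hist_space (Suc t))"
  shows "(\<lambda>v. next_exp \<mu> d t (x v) h v) \<in> borel_measurable (hist_space t)"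
proof -
  interpret sigma_finite_measure \<mu> by fact
  let ?N = "hist_space t \<Otimes>\<^sub>M \<mu>"
  have xy: "(\<lambda>z. (x (fst z), snd z)) \<in> ?N \<rightarrow>\<^sub>M count_space UNIV \<Otimes>\<^sub>M borel"
    by (intro measurable_Pair measurable_compose[OF measurable_fst x])
       (simp add: measurable_cong_sets[OF refl mu(2)[symmetric]])
  have "(\<lambda>z. (fst z)(Suc t := (x (fst z), snd z))) \<in> ?N \<rightarrow>\<^sub>M hist_space (Suc t)"
    by (rule measurable_fun_upd[OF _ measurable_fst xy]) auto
  then have 1: "(\<lambda>z. h ((fst z)(Suc t := (x (fst z), snd z)))) \<in> borel_measurable ?N"
    by (rule measurable_compose[OF _ h])
  have 2: "(\<lambda>z. ennreal (case_prod d (x (fst z), snd z))) \<in> borel_measurable ?N"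
    by (rule measurable_compose[OF measurable_compose[OF xy d] measurable_ennreal])
  from borel_measurable_nn_integral_fst[OF borel_measurable_times_ennreal[OF 2 1]]
  show ?thesis by (simp add: next_exp_def)
qed

context ruled_change_point_model
begin

lemma K_pos: "1 \<le> K"
proof -
  obtain \<omega> where "\<omega> \<in> space M" using not_empty by auto
  from X_Suc_in[OF this, of 0] show ?thesis by auto
qed

lemma clip_hist: "\<omega> \<in> space M \<Longrightarrow> s \<le> t \<Longrightarrow> clip K s (past t \<omega>) = past s \<omega>"
  using X_in[of \<omega> _ t] by (auto simp: clip_def hist_def fun_eq_iff)

lemma treat_hist: "\<omega> \<in> space M \<Longrightarrow> treat K \<phi> t (past t \<omega>) = X (Suc t) \<omega>"
  by (simp add: treat_def clip_hist X_rule)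

lemma next_prob_hist: "next_prob \<pi> t (X (Suc t) \<omega>) (past t \<omega>) = Pi_t \<pi> X (Suc t) \<omega>"
proof -
  have "map (\<lambda>s. fst (past t \<omega> s)) [1..<Suc t] = map (\<lambda>s. X s \<omega>) [1..<Suc t]"
    by (rule map_cong) (auto simp: hist_def)
  moreover have "[1..<Suc (Suc t)] = [1..<Suc t] @ [Suc t]" by simp
  ultimately show ?thesis unfolding next_prob_def Pi_t_def by (simp only: map_append list.map)
qed

lemma hist_space_hist: "\<omega> \<in> space M \<Longrightarrow> past t \<omega> \<in> space (hist_space t)"
  by (rule measurable_space[OF measurable_hist])

section \<open>Recursions for the law of the history\<close>

definition unchanged :: "nat \<Rightarrow> 'w \<Rightarrow> ennreal" where
  "unchanged t \<omega> = (if L t \<omega> then 0 else 1)"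

text \<open>Indicator of \<Theta> = k, as the states are monotone. For \<open>k = 0\<close> the
  subtraction \<open>k - 1\<close> gives 0 again, hence the separate case.\<close>

definition changed_at :: "nat \<Rightarrow> 'w \<Rightarrow> ennreal" where
  "changed_at k \<omega> = (if L k \<omega> \<and> (k = 0 \<or> \<not> L (k - 1) \<omega>) then 1 else 0)"

lemma measurable_unchanged: "unchanged t \<in> borel_measurable M"
  unfolding unchanged_def[abs_def] by (intro measurable_If) auto

lemma measurable_changed_at: "changed_at t \<in> borel_measurable M"
  unfolding changed_at_def[abs_def] by (intro measurable_If) auto

lemma measurable_unchanged_pre_response:
  assumes "t \<le> Suc r" shows "unchanged t \<in> borel_measurable (pre_response r)"
proof -
  note [measurable] = measurable_L_pre_response[OF assms]
  show ?thesis unfolding unchanged_def[abs_def] by measurable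
qed

lemma measurable_changed_at_pre_response:
  assumes "k \<le> Suc r" shows "changed_at k \<in> borel_measurable (pre_response r)"
proof -
  have [measurable]: "L k \<in> pre_response r \<rightarrow>\<^sub>M count_space UNIV" "L (k - 1) \<in> pre_response r \<rightarrow>\<^sub>M count_space UNIV"
    using assms by (intro measurable_L_pre_response; simp)+
  show ?thesis unfolding changed_at_def[abs_def] by measurable
qed

lemma measurable_next_hist:
  assumes "h \<in> borel_measurable (hist_space (Suc t))"
  shows "(\<lambda>v. next_exp \<mu> fK t (treat K \<phi> t v) h v) \<in> borel_measurable (hist_space t)"
    "(\<lambda>v. next_exp \<mu> gK t (treat K \<phi> t v) h v) \<in> borel_measurable (hist_space t)"
  by (intro measurable_next_exp mu.sigma_finite_measure_axioms sets_mu measurable_fK_gK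
      measurable_treat rule K_pos assms)+

text \<open>The response enters the history only through its last coordinate, so integrating it out
  leaves a function of the history up to \<open>t\<close>. The weight \<open>W\<close> may use all
  states up to \<open>t + 1\<close>, in particular the one that selects the density.\<close>

lemma nn_integral_next:
  assumes W: "W \<in> borel_measurable (pre_response t)"
    and h: "h \<in> borel_measurable (hist_space (Suc t))"
  shows "(\<integral>\<^sup>+\<omega>. W \<omega> * h (past (Suc t) \<omega>) \<partial>M) =
    (\<integral>\<^sup>+\<omega>. W \<omega> * next_exp \<mu> (if L (Suc t) \<omega> then gK else fK) t (X (Suc t) \<omega>) h (past t \<omega>) \<partial>M)"
proof -
  let ?N = "pre_response t \<Otimes>\<^sub>M \<mu>"
  define H where "H z = W (fst z) * h ((past t (fst z))(Suc t := (X (Suc t) (fst z), snd z)))" for z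
  have xy: "(\<lambda>z. (X (Suc t) (fst z), snd z)) \<in> ?N \<rightarrow>\<^sub>M count_space UNIV \<Otimes>\<^sub>M borel"
    by (intro measurable_Pair measurable_compose[OF measurable_fst measurable_pre_response(1)])
       (simp add: measurable_cong_sets[OF refl sets_mu[symmetric]])
  have upd: "(\<lambda>z. (past t (fst z))(Suc t := (X (Suc t) (fst z), snd z))) \<in> ?N \<rightarrow>\<^sub>M hist_space (Suc t)"
    by (rule measurable_fun_upd[OF _ measurable_compose[OF measurable_fst measurable_pre_response(2)] xy]) auto
  have H: "H \<in> borel_measurable ?N"
    unfolding H_def[abs_def]
    by (intro borel_measurable_times_ennreal measurable_compose[OF measurable_fst W] measurable_compose[OF upd h])
  have "(\<integral>\<^sup>+\<omega>. W \<omega> * h (past (Suc t) \<omega>) \<partial>M) = (\<integral>\<^sup>+\<omega>. H (\<omega>, Y (Suc t) \<omega>) \<partial>M)"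
    by (simp add: H_def hist_Suc)
  also have "\<dots> = (\<integral>\<^sup>+\<omega>. \<integral>\<^sup>+y. ennreal ((if L (Suc t) \<omega> then gK else fK) (X (Suc t) \<omega>) y) * H (\<omega>, y) \<partial>\<mu> \<partial>M)"
    by (rule nn_integral_response[OF H])
  also have "\<dots> = (\<integral>\<^sup>+\<omega>. W \<omega> * next_exp \<mu> (if L (Suc t) \<omega> then gK else fK) t (X (Suc t) \<omega>) h (past t \<omega>) \<partial>M)"
  proof (rule nn_integral_cong)
    fix \<omega> assume \<omega>: "\<omega> \<in> space M"
    let ?d = "if L (Suc t) \<omega> then gK else fK"
    have d: "(\<lambda>(x, y). ?d x y) \<in> borel_measurable (count_space UNIV \<Otimes>\<^sub>M borel)"
      using measurable_fK_gK by simp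
    have y: "(\<lambda>y. (X (Suc t) \<omega>, y)) \<in> \<mu> \<rightarrow>\<^sub>M count_space UNIV \<Otimes>\<^sub>M borel"
      by (intro measurable_Pair) (simp_all add: measurable_cong_sets[OF refl sets_mu[symmetric]])
    have "(\<lambda>y. (past t \<omega>)(Suc t := (X (Suc t) \<omega>, y))) \<in> \<mu> \<rightarrow>\<^sub>M hist_space (Suc t)"
      by (rule measurable_fun_upd[where J="{1..t}"]) (use y hist_space_hist[OF \<omega>] in auto)
    from borel_measurable_times_ennreal[OF measurable_compose[OF measurable_compose[OF y d] measurable_ennreal] measurable_compose[OF this h]]
    have "(\<lambda>y. ennreal (?d (X (Suc t) \<omega>) y) * h ((past t \<omega>)(Suc t := (X (Suc t) \<omega>, y)))) \<in> borel_measurable \<mu>"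
      by simp
    from nn_integral_cmult[OF this, of "W \<omega>"]
    show "(\<integral>\<^sup>+y. ennreal (?d (X (Suc t) \<omega>) y) * H (\<omega>, y) \<partial>\<mu>) =
      W \<omega> * next_exp \<mu> ?d t (X (Suc t) \<omega>) h (past t \<omega>)"
      by (simp add: next_exp_def H_def mult.left_commute)
  qed
  finally show ?thesis .
qed

text \<open>\<open>changed_at (Suc t)\<close> is \<open>unchanged t\<close> times the indicator of
  \<open>L (Suc t)\<close>, and by monotonicity \<open>unchanged (Suc t)\<close> is
  \<open>unchanged t\<close> times the indicator of the complement. The transition hypothesis speaks
  only of points where \<open>L t\<close> fails, which is where the weight
  \<open>unchanged t\<close> lives.\<close>

lemma nn_integral_transition:
  assumes r: "r \<in> borel_measurable (hist_space t)"
  shows "(\<integral>\<^sup>+\<omega>. unchanged (Suc t) \<omega> * r (past t \<omega>) \<partial>M) =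
      (\<integral>\<^sup>+\<omega>. unchanged t \<omega> * (ennreal (1 - Pi_t \<pi> X (Suc t) \<omega>) * r (past t \<omega>)) \<partial>M)" (is ?A)
    and "(\<integral>\<^sup>+\<omega>. changed_at (Suc t) \<omega> * r (past t \<omega>) \<partial>M) =
      (\<integral>\<^sup>+\<omega>. unchanged t \<omega> * (ennreal (Pi_t \<pi> X (Suc t) \<omega>) * r (past t \<omega>)) \<partial>M)" (is ?B)
proof -
  interpret F: sigma_finite_subalgebra M "pre_transition t"
    by (rule finite_subalgebra_sigma_finite[OF subalgebra_pre(2)])
  let ?S = "{\<omega>. L (Suc t) \<omega>}"
  define W where "W \<omega> = unchanged t \<omega> * r (past t \<omega>)" for \<omega>
  have un: "unchanged t \<in> borel_measurable (pre_transition t)"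
    unfolding unchanged_def[abs_def] by measurable
  have W: "W \<in> borel_measurable (pre_transition t)"
    unfolding W_def[abs_def]
    by (intro borel_measurable_times_ennreal un measurable_compose[OF measurable_pre_transition(3) r])
  have S: "{\<omega>. L (Suc t) \<omega>} \<inter> space M \<in> sets M" "{\<omega>. \<not> L (Suc t) \<omega>} \<inter> space M \<in> sets M"
  proof -
    have "{\<omega> \<in> space M. L (Suc t) \<omega>} \<in> sets M" "{\<omega> \<in> space M. \<not> L (Suc t) \<omega>} \<in> sets M"
      by measurable
    moreover have "{\<omega>. L (Suc t) \<omega>} \<inter> space M = {\<omega> \<in> space M. L (Suc t) \<omega>}"
       "{\<omega>. \<not> L (Suc t) \<omega>} \<inter> space M = {\<omega> \<in> space M. \<not> L (Suc t) \<omega>}" by auto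
    ultimately show "{\<omega>. L (Suc t) \<omega>} \<inter> space M \<in> sets M" "{\<omega>. \<not> L (Suc t) \<omega>} \<inter> space M \<in> sets M"
      by simp_all
  qed
  have tr: "AE \<omega> in M. \<not> L t \<omega> \<longrightarrow> real_cond_exp M (pre_transition t) (indicator ?S) \<omega> = Pi_t \<pi> X (Suc t) \<omega>"
    using L_transition[of t] unfolding pre_transition_def .
  have iS: "integrable M (indicator ?S :: 'w \<Rightarrow> real)"
    using S by (simp add: integrable_indicator_iff less_top[symmetric])
  have compl: "(\<lambda>\<omega>. 1 - indicator ?S \<omega> :: real) = indicator {\<omega>. \<not> L (Suc t) \<omega>}"
    by (auto simp: fun_eq_iff indicator_def)
  have diff: "AE \<omega> in M. real_cond_exp M (pre_transition t) (\<lambda>\<omega>. 1 - indicator ?S \<omega>) \<omega> =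
     real_cond_exp M (pre_transition t) (\<lambda>_. 1) \<omega> - real_cond_exp M (pre_transition t) (indicator ?S) \<omega>"
    by (rule F.real_cond_exp_diff[OF _ iS]) simp
  have one: "AE \<omega> in M. real_cond_exp M (pre_transition t) (\<lambda>_. 1) \<omega> = 1"
    by (rule F.real_cond_exp_F_meas) auto
  have tr': "AE \<omega> in M. \<not> L t \<omega> \<longrightarrow> real_cond_exp M (pre_transition t) (indicator {\<omega>. \<not> L (Suc t) \<omega>}) \<omega> = 1 - Pi_t \<pi> X (Suc t) \<omega>"
    using diff one tr unfolding compl by eventually_elim simp
  have "(\<integral>\<^sup>+\<omega>. unchanged (Suc t) \<omega> * r (past t \<omega>) \<partial>M) = (\<integral>\<^sup>+\<omega>. W \<omega> * indicator {\<omega>. \<not> L (Suc t) \<omega>} \<omega> \<partial>M)"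
    by (rule nn_integral_cong) (use L_mono in \<open>auto simp: W_def unchanged_def\<close>)
  also have "\<dots> = (\<integral>\<^sup>+\<omega>. W \<omega> * ennreal (real_cond_exp M (pre_transition t) (indicator {\<omega>. \<not> L (Suc t) \<omega>}) \<omega>) \<partial>M)"
    by (rule F.nn_integral_indicator_real_cond_exp[OF S(2) _ W]) simp
  also have "\<dots> = (\<integral>\<^sup>+\<omega>. unchanged t \<omega> * (ennreal (1 - Pi_t \<pi> X (Suc t) \<omega>) * r (past t \<omega>)) \<partial>M)"
    by (rule nn_integral_cong_AE) (use tr' in \<open>auto simp: W_def unchanged_def mult.commute\<close>)
  finally show ?A .
  have "(\<integral>\<^sup>+\<omega>. changed_at (Suc t) \<omega> * r (past t \<omega>) \<partial>M) = (\<integral>\<^sup>+\<omega>. W \<omega> * indicator ?S \<omega> \<partial>M)"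
    by (rule nn_integral_cong) (auto simp: W_def unchanged_def changed_at_def)
  also have "\<dots> = (\<integral>\<^sup>+\<omega>. W \<omega> * ennreal (real_cond_exp M (pre_transition t) (indicator ?S) \<omega>) \<partial>M)"
    by (rule F.nn_integral_indicator_real_cond_exp[OF S(1) _ W]) simp
  also have "\<dots> = (\<integral>\<^sup>+\<omega>. unchanged t \<omega> * (ennreal (Pi_t \<pi> X (Suc t) \<omega>) * r (past t \<omega>)) \<partial>M)"
    by (rule nn_integral_cong_AE) (use tr in \<open>auto simp: W_def unchanged_def mult.commute\<close>)
  finally show ?B .
qed

lemma nn_integral_next_at:
  assumes W: "W \<in> borel_measurable (pre_response t)"
    and h: "h \<in> borel_measurable (hist_space (Suc t))"
    and d: "\<And>\<omega>. \<omega> \<in> space M \<Longrightarrow> W \<omega> \<noteq> 0 \<Longrightarrow> (if L (Suc t) \<omega> then gK else fK) = d"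
  shows "(\<integral>\<^sup>+\<omega>. W \<omega> * h (past (Suc t) \<omega>) \<partial>M) =
    (\<integral>\<^sup>+\<omega>. W \<omega> * next_exp \<mu> d t (treat K \<phi> t (past t \<omega>)) h (past t \<omega>) \<partial>M)"
  unfolding nn_integral_next[OF W h]
proof (rule nn_integral_cong)
  fix \<omega> assume "\<omega> \<in> space M"
  then show "W \<omega> * next_exp \<mu> (if L (Suc t) \<omega> then gK else fK) t (X (Suc t) \<omega>) h (past t \<omega>) =
    W \<omega> * next_exp \<mu> d t (treat K \<phi> t (past t \<omega>)) h (past t \<omega>)"
    using d[of \<omega>] by (cases "W \<omega> = 0") (simp_all add: treat_hist)
qed

text \<open>The response is integrated out first: without a change its density is given by
  \<open>fK\<close>, and what remains depends on the history up to \<open>t\<close>, as the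
  transition formula requires. For \<open>changed_at (Suc t)\<close> the same is done with
  \<open>gK\<close>.\<close>

lemma nn_integral_unchanged_Suc:
  assumes h: "h \<in> borel_measurable (hist_space (Suc t))"
  shows "(\<integral>\<^sup>+\<omega>. unchanged (Suc t) \<omega> * h (past (Suc t) \<omega>) \<partial>M) =
    (\<integral>\<^sup>+\<omega>. unchanged t \<omega> * (ennreal (1 - Pi_t \<pi> X (Suc t) \<omega>) *
       next_exp \<mu> fK t (X (Suc t) \<omega>) h (past t \<omega>)) \<partial>M)"
proof -
  have "(\<integral>\<^sup>+\<omega>. unchanged (Suc t) \<omega> * h (past (Suc t) \<omega>) \<partial>M) =
    (\<integral>\<^sup>+\<omega>. unchanged (Suc t) \<omega> * next_exp \<mu> fK t (treat K \<phi> t (past t \<omega>)) h (past t \<omega>) \<partial>M)"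
    by (rule nn_integral_next_at[OF measurable_unchanged_pre_response h]) (simp_all add: unchanged_def split: if_splits)
  also note nn_integral_transition(1)[OF measurable_next_hist(1)[OF h]]
  finally show ?thesis by (rule trans) (rule nn_integral_cong, simp add: treat_hist)
qed

lemma nn_integral_changed_at_Suc:
  assumes h: "h \<in> borel_measurable (hist_space (Suc t))"
  shows "(\<integral>\<^sup>+\<omega>. changed_at (Suc t) \<omega> * h (past (Suc t) \<omega>) \<partial>M) =
    (\<integral>\<^sup>+\<omega>. unchanged t \<omega> * (ennreal (Pi_t \<pi> X (Suc t) \<omega>) *
       next_exp \<mu> gK t (X (Suc t) \<omega>) h (past t \<omega>)) \<partial>M)"
proof -
  have "(\<integral>\<^sup>+\<omega>. changed_at (Suc t) \<omega> * h (past (Suc t) \<omega>) \<partial>M) =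
    (\<integral>\<^sup>+\<omega>. changed_at (Suc t) \<omega> * next_exp \<mu> gK t (treat K \<phi> t (past t \<omega>)) h (past t \<omega>) \<partial>M)"
    by (rule nn_integral_next_at[OF measurable_changed_at_pre_response h]) (simp_all add: changed_at_def split: if_splits)
  also note nn_integral_transition(2)[OF measurable_next_hist(2)[OF h]]
  finally show ?thesis by (rule trans) (rule nn_integral_cong, simp add: treat_hist)
qed

lemma L_mono_le: "\<omega> \<in> space M \<Longrightarrow> s \<le> t \<Longrightarrow> L s \<omega> \<Longrightarrow> L t \<omega>"
  by (induction t) (auto simp: le_Suc_eq intro: L_mono)

lemma nn_integral_after_change:
  assumes h: "h \<in> borel_measurable (hist_space (Suc t))" and k: "k \<le> t"
  shows "(\<integral>\<^sup>+\<omega>. changed_at k \<omega> * h (past (Suc t) \<omega>) \<partial>M) =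
    (\<integral>\<^sup>+\<omega>. changed_at k \<omega> * next_exp \<mu> gK t (treat K \<phi> t (past t \<omega>)) h (past t \<omega>) \<partial>M)"
proof (rule nn_integral_next_at[OF measurable_changed_at_pre_response h])
  show "k \<le> Suc t" using k by simp
  fix \<omega> assume "\<omega> \<in> space M" "changed_at k \<omega> \<noteq> 0"
  then show "(if L (Suc t) \<omega> then gK else fK) = gK"
    using L_mono_le[of \<omega> k "Suc t"] k by (auto simp: changed_at_def split: if_splits)
qed

end

section \<open>Change of measure\<close>

lemma measurable_hist_extend:
  fixes h :: "(nat \<Rightarrow> nat \<times> 'y::polish_space) \<Rightarrow> ennreal"
  assumes mu: "sets \<mu> = sets borel" and v: "v \<in> space (hist_space t)"
    and h: "h \<in> borel_measurable (hist_space (Suc t))"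
  shows "(\<lambda>y. h (v(Suc t := (x, y)))) \<in> borel_measurable \<mu>"
proof -
  have y: "(\<lambda>y. (x, y)) \<in> \<mu> \<rightarrow>\<^sub>M count_space UNIV \<Otimes>\<^sub>M borel"
    by (intro measurable_Pair) (simp_all add: measurable_cong_sets[OF refl mu[symmetric]])
  have "(\<lambda>y. v(Suc t := (x, y))) \<in> \<mu> \<rightarrow>\<^sub>M hist_space (Suc t)"
    by (rule measurable_fun_upd[where J="{1..t}"]) (use y v in auto)
  then show ?thesis by (rule measurable_compose[OF _ h])
qed

lemma next_exp_cmult:
  fixes h :: "(nat \<Rightarrow> nat \<times> 'y::polish_space) \<Rightarrow> ennreal"
  assumes mu: "sets \<mu> = sets borel" and v: "v \<in> space (hist_space t)"
    and h: "h \<in> borel_measurable (hist_space (Suc t))" and d: "d x \<in> borel_measurable borel"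
    and c: "\<And>y. c (v(Suc t := (x, y))) = c'"
  shows "next_exp \<mu> d t x (\<lambda>v. c v * h v) v = c' * next_exp \<mu> d t x h v"
proof -
  have d': "d x \<in> borel_measurable \<mu>" using d by (simp add: measurable_cong_sets[OF mu refl])
  have "(\<lambda>y. ennreal (d x y) * h (v(Suc t := (x, y)))) \<in> borel_measurable \<mu>"
    by (intro borel_measurable_times_ennreal measurable_hist_extend[OF mu v h]
        measurable_compose[OF d' measurable_ennreal])
  from nn_integral_cmult[OF this, of c'] show ?thesis
    by (simp add: next_exp_def c mult.left_commute)
qed

context ruled_change_point_model
begin

lemma measurable_fK_gK_at: "fK x \<in> borel_measurable borel" "gK x \<in> borel_measurable borel"
  using measurable_compose[OF _ measurable_fK_gK(1), of "\<lambda>y. (x, y)" borel]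
    measurable_compose[OF _ measurable_fK_gK(2), of "\<lambda>y. (x, y)" borel] by simp_all

lemma fK_gK_nonneg: "0 \<le> fK x y" "0 \<le> gK x y"
  using densities by (auto simp: on_treatments_def is_density_def)

text \<open>With \<open>x / 0 = 0\<close> the ratio vanishes where \<open>f\<close> does, a set that is null under both densities.\<close>

definition lik :: "nat \<Rightarrow> (nat \<Rightarrow> nat \<times> 'y) \<Rightarrow> ennreal" where
  "lik s v = ennreal (gK (fst (v s)) (snd (v s)) / fK (fst (v s)) (snd (v s)) /
     (1 - \<pi> (map (\<lambda>r. fst (v r)) [1..<Suc s])))"

text \<open>There is no response at time 0, so for \<open>k = 0\<close> the product starts at
  1.\<close>

definition Lik :: "nat \<Rightarrow> nat \<Rightarrow> (nat \<Rightarrow> nat \<times> 'y) \<Rightarrow> ennreal" where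
  "Lik k t v = (\<Prod>s\<in>{max 1 k..t}. lik s v)"

text \<open>For \<open>k > 0\<close> the factor \<open>1 - \<Pi>\<^sub>k\<close> of the odds is already contained in \<open>lik k\<close>.\<close>

definition prior_odds :: "nat \<Rightarrow> (nat \<Rightarrow> nat \<times> 'y) \<Rightarrow> ennreal" where
  "prior_odds k v = ennreal (if k = 0 then \<pi> [] / (1 - \<pi> []) else \<pi> (map (\<lambda>r. fst (v r)) [1..<Suc k]))"

lemma measurable_prior:
  assumes "s \<le> t"
  shows "(\<lambda>v. \<pi> (map (\<lambda>r. fst (v r)) [1..<Suc s])) \<in> borel_measurable (hist_space t :: (nat \<Rightarrow> nat \<times> 'y) measure)"
proof -
  have "(\<lambda>v. map (\<lambda>s. fst (v s)) [1..<Suc s]) \<in> (hist_space t :: (nat \<Rightarrow> nat \<times> 'y) measure) \<rightarrow>\<^sub>M count_space UNIV"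
    by (rule measurable_map_list_count_space, rule measurable_fst_component) (use assms in auto)
  from measurable_compose[OF this, of \<pi> borel] show ?thesis by (simp del: upt_Suc)
qed

lemma measurable_lik:
  assumes s: "s \<in> {1..t}" shows "lik s \<in> borel_measurable (hist_space t)"
proof -
  note v = measurable_component_singleton[OF s, of "\<lambda>_. count_space UNIV \<Otimes>\<^sub>M (borel :: 'y measure)"]
  have "(\<lambda>v. case_prod gK (v s)) \<in> borel_measurable (hist_space t)"
    "(\<lambda>v. case_prod fK (v s)) \<in> borel_measurable (hist_space t)"
    by (rule measurable_compose[OF v measurable_fK_gK(2)], rule measurable_compose[OF v measurable_fK_gK(1)])
  moreover have "(\<lambda>v. \<pi> (map (\<lambda>r. fst (v r)) [1..<Suc s])) \<in> borel_measurable (hist_space t :: (nat \<Rightarrow> nat \<times> 'y) measure)"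
    by (rule measurable_prior) (use s in auto)
  ultimately show ?thesis
    unfolding lik_def[abs_def] case_prod_beta
    by (intro measurable_compose[OF _ measurable_ennreal] borel_measurable_divide borel_measurable_diff borel_measurable_const)
qed

lemma measurable_Lik: "Lik k t \<in> borel_measurable (hist_space t)"
  unfolding Lik_def[abs_def] by (intro borel_measurable_prod_ennreal measurable_lik) auto

lemma measurable_prior_odds: "k \<le> t \<Longrightarrow> prior_odds k \<in> borel_measurable (hist_space t)"
  using measurable_compose[OF measurable_prior[of k t] measurable_ennreal] unfolding prior_odds_def[abs_def]
  by (cases "k = 0") (simp_all del: upt_Suc)

lemma map_fst_upd: "s \<le> t \<Longrightarrow> map (\<lambda>r. fst ((v(Suc t := z)) r)) [1..<Suc s] = map (\<lambda>r. fst (v r)) [1..<Suc s]"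
  by (rule map_cong) auto

lemma map_fst_upd_Suc:
  "map (\<lambda>r. fst ((v(Suc t := (x, y))) r)) [1..<Suc (Suc t)] = map (\<lambda>r. fst (v r)) [1..<Suc t] @ [x]"
proof -
  have "[1..<Suc (Suc t)] = [1..<Suc t] @ [Suc t]" by simp
  then show ?thesis using map_fst_upd[of t t v "(x, y)"] by (simp only: map_append list.map) simp
qed

lemma lik_upd: "s \<le> t \<Longrightarrow> lik s (v(Suc t := z)) = lik s v"
  unfolding lik_def by (simp only: map_fst_upd) simp

lemma Lik_upd: "Lik k t (v(Suc t := z)) = Lik k t v"
  unfolding Lik_def by (rule prod.cong) (auto simp: lik_upd)

lemma prior_odds_upd: "k \<le> t \<Longrightarrow> prior_odds k (v(Suc t := z)) = prior_odds k v"
  unfolding prior_odds_def by (simp only: map_fst_upd)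

lemma prior_odds_upd_Suc: "prior_odds (Suc t) (v(Suc t := (x, y))) = ennreal (next_prob \<pi> t x v)"
  unfolding prior_odds_def next_prob_def map_fst_upd_Suc by simp

lemma Lik_Suc: "k \<le> Suc t \<Longrightarrow> Lik k (Suc t) v = lik (Suc t) v * Lik k t v"
proof -
  assume "k \<le> Suc t"
  then have "{max 1 k..Suc t} = insert (Suc t) {max 1 k..t}" by auto
  then show ?thesis by (simp add: Lik_def)
qed

text \<open>The factor \<open>lik (Suc t)\<close> turns one unchanged step into a changed one:
  \<open>1 - \<Pi>\<close> cancels, and \<open>fK * (gK / fK) = gK\<close>. Where \<open>fK\<close>
  vanishes the last cancellation still holds, because \<open>gK\<close> vanishes there almost
  everywhere.\<close>

lemma next_exp_lik:
  assumes v: "v \<in> space (hist_space t)" and h: "h \<in> borel_measurable (hist_space (Suc t))"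
    and x: "x \<in> {1..K}" and q: "next_prob \<pi> t x v < 1"
    and ac: "AE y in \<mu>. f x y = 0 \<longrightarrow> g x y = 0"
  shows "ennreal (1 - next_prob \<pi> t x v) * next_exp \<mu> fK t x (\<lambda>v. lik (Suc t) v * h v) v = next_exp \<mu> gK t x h v"
proof -
  let ?q = "1 - next_prob \<pi> t x v"
  have m: "(\<lambda>v. lik (Suc t) v * h v) \<in> borel_measurable (hist_space (Suc t))"
    by (intro borel_measurable_times_ennreal measurable_lik h) auto
  have fm: "fK x \<in> borel_measurable \<mu>"
    using measurable_fK_gK_at(1) by (simp add: measurable_cong_sets[OF sets_mu refl])
  have "ennreal ?q * next_exp \<mu> fK t x (\<lambda>v. lik (Suc t) v * h v) v =
    (\<integral>\<^sup>+y. ennreal ?q * (ennreal (fK x y) * (lik (Suc t) (v(Suc t := (x, y))) * h (v(Suc t := (x, y))))) \<partial>\<mu>)"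
    unfolding next_exp_def
    by (rule nn_integral_cmult[symmetric])
       (intro borel_measurable_times_ennreal measurable_hist_extend[OF sets_mu v m]
        measurable_compose[OF fm measurable_ennreal])
  also have "\<dots> = next_exp \<mu> gK t x h v"
    unfolding next_exp_def
  proof (rule nn_integral_cong_AE)
    have eq: "ennreal ?q * (ennreal (fK x y) * lik (Suc t) (v(Suc t := (x, y)))) = ennreal (gK x y)"
      if "fK x y = 0 \<longrightarrow> gK x y = 0" for y
    proof -
      have "lik (Suc t) (v(Suc t := (x, y))) = ennreal (gK x y / fK x y / ?q)"
        unfolding lik_def map_fst_upd_Suc by (simp add: next_prob_def)
      moreover have "?q * (fK x y * (gK x y / fK x y / ?q)) = gK x y"
        using that q by (cases "fK x y = 0") auto
      moreover have "0 \<le> gK x y / fK x y / ?q" using fK_gK_nonneg q by simp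
      ultimately show ?thesis using fK_gK_nonneg q by (simp add: ennreal_mult'[symmetric])
    qed
    show "AE y in \<mu>. ennreal ?q * (ennreal (fK x y) * (lik (Suc t) (v(Suc t := (x, y))) * h (v(Suc t := (x, y))))) =
      ennreal (gK x y) * h (v(Suc t := (x, y)))"
      using ac
    proof eventually_elim
      case (elim y)
      then have "fK x y = 0 \<longrightarrow> gK x y = 0" using x by (simp add: on_treatments_def)
      from eq[OF this] show ?case by (simp add: mult.assoc[symmetric])
    qed
  qed
  finally show ?thesis .
qed

text \<open>Both cases of the inductive step of the change of measure use this. \<open>c\<close>
  collects the factors that are fixed before the response at time \<open>t + 1\<close>, so they
  leave the integral with their value \<open>c'\<close>.\<close>

lemma nn_integral_unchanged_lik:
  assumes h: "h \<in> borel_measurable (hist_space (Suc t))"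
    and c: "c \<in> borel_measurable (hist_space (Suc t))"
    and c': "\<And>\<omega> y. \<omega> \<in> space M \<Longrightarrow> c ((past t \<omega>)(Suc t := (X (Suc t) \<omega>, y))) = c' \<omega>"
    and ac: "\<And>x. x \<in> {1..K} \<Longrightarrow> AE y in \<mu>. f x y = 0 \<longrightarrow> g x y = 0"
  shows "(\<integral>\<^sup>+\<omega>. unchanged (Suc t) \<omega> * (lik (Suc t) (past (Suc t) \<omega>) * (c (past (Suc t) \<omega>) * h (past (Suc t) \<omega>))) \<partial>M) =
    (\<integral>\<^sup>+\<omega>. unchanged t \<omega> * (c' \<omega> * next_exp \<mu> gK t (X (Suc t) \<omega>) h (past t \<omega>)) \<partial>M)"
proof -
  have ch: "(\<lambda>v. c v * h v) \<in> borel_measurable (hist_space (Suc t))"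
    by (intro borel_measurable_times_ennreal c h)
  have "(\<integral>\<^sup>+\<omega>. unchanged (Suc t) \<omega> * (lik (Suc t) (past (Suc t) \<omega>) * (c (past (Suc t) \<omega>) * h (past (Suc t) \<omega>))) \<partial>M) =
    (\<integral>\<^sup>+\<omega>. unchanged t \<omega> * (ennreal (1 - Pi_t \<pi> X (Suc t) \<omega>) *
       next_exp \<mu> fK t (X (Suc t) \<omega>) (\<lambda>v. lik (Suc t) v * (c v * h v)) (past t \<omega>)) \<partial>M)"
    by (rule nn_integral_unchanged_Suc) (intro borel_measurable_times_ennreal measurable_lik ch, simp)
  also have "\<dots> = (\<integral>\<^sup>+\<omega>. unchanged t \<omega> * (c' \<omega> * next_exp \<mu> gK t (X (Suc t) \<omega>) h (past t \<omega>)) \<partial>M)"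
  proof (rule nn_integral_cong)
    fix \<omega> assume \<omega>: "\<omega> \<in> space M"
    have "ennreal (1 - Pi_t \<pi> X (Suc t) \<omega>) *
       next_exp \<mu> fK t (X (Suc t) \<omega>) (\<lambda>v. lik (Suc t) v * (c v * h v)) (past t \<omega>) =
       next_exp \<mu> gK t (X (Suc t) \<omega>) (\<lambda>v. c v * h v) (past t \<omega>)"
      using next_exp_lik[OF hist_space_hist[OF \<omega>] ch X_Suc_in[OF \<omega>, of t] _ ac[OF X_Suc_in[OF \<omega>]]] Pi_range[OF \<omega>, of "Suc t"]
      unfolding next_prob_hist by simp
    also have "\<dots> = c' \<omega> * next_exp \<mu> gK t (X (Suc t) \<omega>) h (past t \<omega>)"
      by (rule next_exp_cmult[OF sets_mu hist_space_hist[OF \<omega>] h]) (rule measurable_fK_gK_at(2), rule c'[OF \<omega>])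
    finally show "unchanged t \<omega> * (ennreal (1 - Pi_t \<pi> X (Suc t) \<omega>) *
       next_exp \<mu> fK t (X (Suc t) \<omega>) (\<lambda>v. lik (Suc t) v * (c v * h v)) (past t \<omega>)) =
       unchanged t \<omega> * (c' \<omega> * next_exp \<mu> gK t (X (Suc t) \<omega>) h (past t \<omega>))" by simp
  qed
  finally show ?thesis .
qed

lemma nn_integral_changed_at_0: "(\<integral>\<^sup>+\<omega>. changed_at 0 \<omega> \<partial>M) = ennreal (\<pi> [])"
proof -
  have "(\<integral>\<^sup>+\<omega>. changed_at 0 \<omega> \<partial>M) = (\<integral>\<^sup>+\<omega>. indicator {\<omega> \<in> space M. L 0 \<omega>} \<omega> \<partial>M)"
    by (rule nn_integral_cong) (auto simp: changed_at_def)
  also have "\<dots> = ennreal (\<pi> [])"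
    by (subst nn_integral_indicator) (auto simp: emeasure_eq_measure L_initial)
  finally show ?thesis .
qed

lemma nn_integral_unchanged_0: "(\<integral>\<^sup>+\<omega>. unchanged 0 \<omega> \<partial>M) = ennreal (1 - \<pi> [])"
proof -
  have "(\<integral>\<^sup>+\<omega>. unchanged 0 \<omega> \<partial>M) = (\<integral>\<^sup>+\<omega>. indicator {\<omega> \<in> space M. \<not> L 0 \<omega>} \<omega> \<partial>M)"
    by (rule nn_integral_cong) (auto simp: unchanged_def)
  also have "\<dots> = ennreal (prob {\<omega> \<in> space M. \<not> L 0 \<omega>})"
    by (subst nn_integral_indicator) (auto simp: emeasure_eq_measure)
  also have "prob {\<omega> \<in> space M. \<not> L 0 \<omega>} = 1 - \<pi> []"
    using prob_neg[of "\<lambda>\<omega>. L 0 \<omega>"] by (simp add: L_initial)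
  finally show ?thesis .
qed

text \<open>At \<open>t = k > 0\<close> the prior weight supplies the factor \<Pi> of the
  transition, while \<open>lik k\<close> cancels \<open>1 - \<Pi>\<close> and exchanges the density.
  From then on each step under \<open>gK\<close> is matched by an unchanged step weighted with
  \<open>lik\<close>. For \<open>t = k = 0\<close> the identity says that \<pi>() is
  \<open>1 - \<pi> []\<close> times the prior odds.\<close>

lemma change_of_measure:
  assumes ac: "\<And>x. x \<in> {1..K} \<Longrightarrow> AE y in \<mu>. f x y = 0 \<longrightarrow> g x y = 0"
  shows "h \<in> borel_measurable (hist_space t) \<Longrightarrow> k \<le> t \<Longrightarrow>
    (\<integral>\<^sup>+\<omega>. changed_at k \<omega> * h (past t \<omega>) \<partial>M) =
    (\<integral>\<^sup>+\<omega>. unchanged t \<omega> * (prior_odds k (past t \<omega>) * (Lik k t (past t \<omega>) * h (past t \<omega>))) \<partial>M)"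
proof (induction t arbitrary: h)
  case 0
  have p: "0 \<le> \<pi> []" "\<pi> [] < 1" using pi_range[of "[]"] by auto
  let ?v = "\<lambda>_. undefined :: nat \<times> 'y"
  have "(\<integral>\<^sup>+\<omega>. changed_at k \<omega> * h (past 0 \<omega>) \<partial>M) = ennreal (\<pi> []) * h ?v"
    using 0 nn_integral_changed_at_0 by (simp add: hist_0 nn_integral_multc measurable_changed_at)
  also have "ennreal (\<pi> []) = ennreal (1 - \<pi> []) * ennreal (\<pi> [] / (1 - \<pi> []))"
    using p by (simp add: ennreal_mult'[symmetric])
  also have "\<dots> * h ?v = (\<integral>\<^sup>+\<omega>. unchanged 0 \<omega> * (ennreal (\<pi> [] / (1 - \<pi> [])) * h ?v) \<partial>M)"
    using nn_integral_unchanged_0 by (simp add: nn_integral_multc measurable_unchanged mult.assoc)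
  also have "\<dots> = (\<integral>\<^sup>+\<omega>. unchanged 0 \<omega> * (prior_odds k (past 0 \<omega>) * (Lik k 0 (past 0 \<omega>) * h (past 0 \<omega>))) \<partial>M)"
    using 0 by (simp add: prior_odds_def Lik_def hist_0)
  finally show ?case .
next
  case (Suc t)
  let ?c = "\<lambda>v. prior_odds k v * Lik k t v"
  have Lm: "Lik k t \<in> borel_measurable (hist_space (Suc t))"
    unfolding Lik_def[abs_def] by (intro borel_measurable_prod_ennreal measurable_lik) auto
  have cm: "?c \<in> borel_measurable (hist_space (Suc t))"
    by (intro borel_measurable_times_ennreal measurable_prior_odds Lm Suc.prems)
  have split: "prior_odds k v * (Lik k (Suc t) v * h v) = lik (Suc t) v * (?c v * h v)" for v
    by (simp add: Lik_Suc[OF Suc.prems(2)] ac_simps)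
  show ?case
  proof (cases "k = Suc t")
    case True
    have "Lik k t v = 1" for v by (simp add: Lik_def True)
    then have c': "?c ((past t \<omega>)(Suc t := (X (Suc t) \<omega>, y))) = ennreal (Pi_t \<pi> X (Suc t) \<omega>)" for \<omega> y
      by (simp add: True prior_odds_upd_Suc next_prob_hist)
    have "(\<integral>\<^sup>+\<omega>. unchanged (Suc t) \<omega> * (lik (Suc t) (past (Suc t) \<omega>) * (?c (past (Suc t) \<omega>) * h (past (Suc t) \<omega>))) \<partial>M) =
      (\<integral>\<^sup>+\<omega>. unchanged t \<omega> * (ennreal (Pi_t \<pi> X (Suc t) \<omega>) * next_exp \<mu> gK t (X (Suc t) \<omega>) h (past t \<omega>)) \<partial>M)"
      by (rule nn_integral_unchanged_lik[OF Suc.prems(1) cm _ ac]) (rule c')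
    also have "\<dots> = (\<integral>\<^sup>+\<omega>. changed_at k \<omega> * h (past (Suc t) \<omega>) \<partial>M)"
      unfolding True by (rule nn_integral_changed_at_Suc[OF Suc.prems(1), symmetric])
    finally show ?thesis unfolding split by (rule sym)
  next
    case False
    then have k: "k \<le> t" using Suc.prems by simp
    have c': "?c ((past t \<omega>)(Suc t := (X (Suc t) \<omega>, y))) = prior_odds k (past t \<omega>) * Lik k t (past t \<omega>)" for \<omega> y
      by (simp add: prior_odds_upd[OF k] Lik_upd)
    have "(\<integral>\<^sup>+\<omega>. changed_at k \<omega> * h (past (Suc t) \<omega>) \<partial>M) =
      (\<integral>\<^sup>+\<omega>. changed_at k \<omega> * next_exp \<mu> gK t (treat K \<phi> t (past t \<omega>)) h (past t \<omega>) \<partial>M)"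
      by (rule nn_integral_after_change[OF Suc.prems(1) k])
    also have "\<dots> = (\<integral>\<^sup>+\<omega>. unchanged t \<omega> * (prior_odds k (past t \<omega>) * (Lik k t (past t \<omega>) *
        next_exp \<mu> gK t (treat K \<phi> t (past t \<omega>)) h (past t \<omega>))) \<partial>M)"
      by (rule Suc.IH[OF measurable_next_hist(2)[OF Suc.prems(1)] k])
    also have "\<dots> = (\<integral>\<^sup>+\<omega>. unchanged t \<omega> * (prior_odds k (past t \<omega>) * Lik k t (past t \<omega>) *
        next_exp \<mu> gK t (X (Suc t) \<omega>) h (past t \<omega>)) \<partial>M)"
      by (rule nn_integral_cong) (simp add: treat_hist mult.assoc)
    also have "\<dots> = (\<integral>\<^sup>+\<omega>. unchanged (Suc t) \<omega> * (lik (Suc t) (past (Suc t) \<omega>) * (?c (past (Suc t) \<omega>) * h (past (Suc t) \<omega>))) \<partial>M)"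
      by (rule nn_integral_unchanged_lik[OF Suc.prems(1) cm _ ac, symmetric]) (rule c')
    finally show ?thesis unfolding split .
  qed
qed

end

section \<open>Stopping soon after the change\<close>

lemma enat_eq_iff_le: "T = enat t \<longleftrightarrow> T \<le> enat t \<and> (\<forall>s<t. \<not> T \<le> enat s)"
  by (cases T) (auto simp: not_le le_less)

context ruled_change_point_model
begin

lemma change_point_le_iff:
  assumes \<omega>: "\<omega> \<in> space M" shows "change_point L \<omega> \<le> enat t \<longleftrightarrow> L t \<omega>"
proof
  assume "L t \<omega>" then show "change_point L \<omega> \<le> enat t"
    unfolding change_point_def by (intro INF_lower) simp
next
  assume le: "change_point L \<omega> \<le> enat t"
  show "L t \<omega>"
  proof (rule ccontr)
    assume "\<not> L t \<omega>"
    then have "t < s" if "L s \<omega>" for s using L_mono_le[OF \<omega>, of s t] that by (meson not_le)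
    then have "enat (Suc t) \<le> change_point L \<omega>"
      unfolding change_point_def by (intro INF_greatest) (auto simp: Suc_le_eq)
    from order_trans[OF this le] show False by simp
  qed
qed

lemma change_point_eq_iff:
  assumes \<omega>: "\<omega> \<in> space M"
  shows "change_point L \<omega> = enat k \<longleftrightarrow> L k \<omega> \<and> (k = 0 \<or> \<not> L (k - 1) \<omega>)"
proof -
  have "change_point L \<omega> = enat k \<longleftrightarrow> L k \<omega> \<and> (\<forall>s<k. \<not> L s \<omega>)"
    by (simp add: enat_eq_iff_le change_point_le_iff[OF \<omega>])
  also have "(\<forall>s<k. \<not> L s \<omega>) \<longleftrightarrow> k = 0 \<or> \<not> L (k - 1) \<omega>"
    using L_mono_le[OF \<omega>, of _ "k - 1"] by (cases k) (auto simp: less_Suc_eq_le)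
  finally show ?thesis .
qed

lemma less_change_point_iff:
  assumes \<omega>: "\<omega> \<in> space M"
  shows "T < change_point L \<omega> \<longleftrightarrow> (\<exists>t. T = enat t \<and> \<not> L t \<omega>)"
  by (cases T) (simp_all add: change_point_le_iff[OF \<omega>, symmetric] not_le)

lemma measurable_change_point: "change_point L \<in> M \<rightarrow>\<^sub>M count_space UNIV"
proof (rule measurable_count_space_eq2_countable[THEN iffD2], safe)
  fix a :: enat
  have fin: "{\<omega> \<in> space M. change_point L \<omega> = enat k} \<in> sets M" for k
  proof -
    have "{\<omega> \<in> space M. change_point L \<omega> = enat k} = {\<omega> \<in> space M. L k \<omega> \<and> (k = 0 \<or> \<not> L (k - 1) \<omega>)}"
      by (auto simp: change_point_eq_iff)
    also have "\<dots> \<in> sets M" by measurable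
    finally show ?thesis .
  qed
  show "change_point L -` {a} \<inter> space M \<in> sets M"
  proof (cases a)
    case (enat k)
    then have "change_point L -` {a} \<inter> space M = {\<omega> \<in> space M. change_point L \<omega> = enat k}" by auto
    then show ?thesis using fin by simp
  next
    case infinity
    then have "change_point L -` {a} \<inter> space M = space M - (\<Union>k. {\<omega> \<in> space M. change_point L \<omega> = enat k})"
      by auto
    then show ?thesis using fin by auto
  qed
qed auto

text \<open>Measurability with respect to the history makes \<open>T \<le> s\<close> the preimage of
  a set of histories. Such sets keep a meaning on the probability space of another rule, which
  \<open>T\<close> itself does not.\<close>

lemma stopping_time_hist_events:
  assumes T: "enat_stopping_time (obs_filtration M X Y) T"
  obtains A where "\<And>s. A s \<in> sets (hist_space s)"
    "\<And>s \<omega>. \<omega> \<in> space M \<Longrightarrow> T \<omega> \<le> enat s \<longleftrightarrow> past s \<omega> \<in> A s"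
proof -
  have "\<exists>A. A \<in> sets (hist_space s) \<and> (\<forall>\<omega>\<in>space M. T \<omega> \<le> enat s \<longleftrightarrow> past s \<omega> \<in> A)" for s
  proof -
    have "Measurable.pred (obs_filtration M X Y s) (\<lambda>\<omega>. T \<omega> \<le> enat s)"
      using T by (simp add: enat_stopping_time_def)
    then have "{\<omega> \<in> space M. T \<omega> \<le> enat s} \<in> sets (vimage_algebra (space M) (past s) (hist_space s))"
      unfolding pred_def obs_filtration_def by simp
    moreover have "past s \<in> space M \<rightarrow> space (hist_space s)"
      using hist_space_hist by blast
    ultimately obtain A where "A \<in> sets (hist_space s)" "{\<omega> \<in> space M. T \<omega> \<le> enat s} = past s -` A \<inter> space M"
      by (auto simp: sets_vimage_algebra2)
    then show ?thesis by (intro exI[of _ A]) blast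
  qed
  then obtain A where "\<forall>s. A s \<in> sets (hist_space s) \<and> (\<forall>\<omega>\<in>space M. T \<omega> \<le> enat s \<longleftrightarrow> past s \<omega> \<in> A s)"
    by metis
  then show thesis by (intro that[of A]) auto
qed

context
  fixes T :: "'w \<Rightarrow> enat" and A :: "nat \<Rightarrow> (nat \<Rightarrow> nat \<times> 'y) set"
  assumes A: "\<And>s. A s \<in> sets (hist_space s)"
    and TA: "\<And>s \<omega>. \<omega> \<in> space M \<Longrightarrow> T \<omega> \<le> enat s \<longleftrightarrow> past s \<omega> \<in> A s"
begin

definition stop_at :: "nat \<Rightarrow> (nat \<Rightarrow> nat \<times> 'y) set" where
  "stop_at t = {v \<in> space (hist_space t). v \<in> A t \<and> (\<forall>s<t. restrict v {1..s} \<notin> A s)}"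

lemma measurable_restrict_hist: "s \<le> t \<Longrightarrow> (\<lambda>v. restrict v {1..s}) \<in> hist_space t \<rightarrow>\<^sub>M (hist_space s :: (nat \<Rightarrow> nat \<times> 'y) measure)"
  by (rule measurable_restrict_subset) auto

lemma sets_stop_at: "stop_at t \<in> sets (hist_space t)"
proof -
  have [measurable]: "Measurable.pred (hist_space t) (\<lambda>v. restrict v {1..s} \<in> A s)" if "s < t" for s
    using measurable_sets_Collect[OF measurable_restrict_hist[of s t], of "\<lambda>v. v \<in> A s"] that A sets.sets_into_space[OF A[of s]]
    by (auto simp: pred_def Collect_conj_eq Int_absorb1 inf_commute cong: conj_cong)
  have [measurable]: "A t \<in> sets (hist_space t)" by (rule A)
  have "{v \<in> space (hist_space t). v \<in> A t \<and> (\<forall>s\<in>{..<t}. restrict v {1..s} \<notin> A s)} \<in> sets (hist_space t)"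
    by (intro sets.sets_Collect_conj sets.sets_Collect_finite_All sets.sets_Collect_neg) (use A in \<open>auto simp: pred_def[symmetric]\<close>)
  then show ?thesis by (simp add: stop_at_def Ball_def)
qed

lemma stop_at_hist:
  assumes \<omega>: "\<omega> \<in> space M" shows "past t \<omega> \<in> stop_at t \<longleftrightarrow> T \<omega> = enat t"
proof -
  have "restrict (past t \<omega>) {1..s} \<in> A s \<longleftrightarrow> T \<omega> \<le> enat s" if "s < t" for s
    using restrict_hist[of s t X Y \<omega>] that TA[OF \<omega>, of s] by simp
  then show ?thesis
    using hist_space_hist[OF \<omega>, of t] TA[OF \<omega>, of t] by (simp add: stop_at_def enat_eq_iff_le)
qed

lemma sets_T_eq: "{\<omega> \<in> space M. T \<omega> = enat t} \<in> sets M"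
proof -
  have "{\<omega> \<in> space M. T \<omega> = enat t} = past t -` stop_at t \<inter> space M"
    by (auto simp: stop_at_hist)
  then show ?thesis using measurable_sets[OF measurable_hist sets_stop_at] by simp
qed

lemma sets_T_le: "{\<omega> \<in> space M. T \<omega> \<le> enat t} \<in> sets M"
proof -
  have "{\<omega> \<in> space M. T \<omega> \<le> enat t} = past t -` A t \<inter> space M"
    by (auto simp: TA)
  then show ?thesis using measurable_sets[OF measurable_hist A] by simp
qed

lemma measurable_T: "T \<in> M \<rightarrow>\<^sub>M count_space UNIV"
proof (rule measurable_count_space_eq2_countable[THEN iffD2], safe)
  fix a :: enat
  show "T -` {a} \<inter> space M \<in> sets M"
  proof (cases a)
    case (enat t)
    then have "T -` {a} \<inter> space M = {\<omega> \<in> space M. T \<omega> = enat t}" by auto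
    then show ?thesis using sets_T_eq by simp
  next
    case infinity
    then have "T -` {a} \<inter> space M = space M - (\<Union>t. {\<omega> \<in> space M. T \<omega> = enat t})"
      by auto
    then show ?thesis using sets_T_eq by auto
  qed
qed auto

lemma sets_T_change_point: "{\<omega> \<in> space M. P (T \<omega>) (change_point L \<omega>)} \<in> sets M"
proof -
  have "(\<lambda>\<omega>. (T \<omega>, change_point L \<omega>)) \<in> M \<rightarrow>\<^sub>M count_space UNIV"
    by (rule measurable_compose_countable[OF _ measurable_T], rule measurable_compose[OF measurable_change_point]) simp
  then have "(\<lambda>\<omega>. (T \<omega>, change_point L \<omega>)) -` {z. P (fst z) (snd z)} \<inter> space M \<in> sets M"
    by (rule measurable_sets) simp
  moreover have "(\<lambda>\<omega>. (T \<omega>, change_point L \<omega>)) -` {z. P (fst z) (snd z)} \<inter> space M = {\<omega> \<in> space M. P (T \<omega>) (change_point L \<omega>)}"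
    by auto
  ultimately show ?thesis by simp
qed

section \<open>Early stops with a small likelihood ratio\<close>

lemma sets_small_likelihood:
  "{\<omega> \<in> space M. T \<omega> = enat t \<and> change_point L \<omega> = enat k \<and> Lik k t (past t \<omega>) \<le> E} \<in> sets M"
proof -
  have "(\<lambda>\<omega>. Lik k t (past t \<omega>)) \<in> borel_measurable M"
    by (rule measurable_compose[OF measurable_hist measurable_Lik])
  then have "{\<omega> \<in> space M. Lik k t (past t \<omega>) \<le> E} \<in> sets M" by (intro borel_measurable_le) auto
  then show ?thesis
    using sets_T_change_point[of "\<lambda>a b. a = enat t"] sets_T_change_point[of "\<lambda>a b. b = enat k"]
    by (intro sets.sets_Collect_conj)
qed

lemma sets_false_alarm: "{\<omega> \<in> space M. T \<omega> = enat t \<and> \<not> L t \<omega>} \<in> sets M"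
  using sets_T_eq[of t] by (intro sets.sets_Collect_conj sets.sets_Collect_neg) auto

lemma emeasure_false_alarm:
  "(\<Sum>t. emeasure M {\<omega> \<in> space M. T \<omega> = enat t \<and> \<not> L t \<omega>}) = emeasure M {\<omega> \<in> space M. T \<omega> < change_point L \<omega>}"
proof -
  have "(\<Sum>t. emeasure M {\<omega> \<in> space M. T \<omega> = enat t \<and> \<not> L t \<omega>}) =
     emeasure M (\<Union>t. {\<omega> \<in> space M. T \<omega> = enat t \<and> \<not> L t \<omega>})"
    by (rule suminf_emeasure) (use sets_false_alarm in \<open>auto simp: disjoint_family_on_def\<close>)
  also have "(\<Union>t. {\<omega> \<in> space M. T \<omega> = enat t \<and> \<not> L t \<omega>}) = {\<omega> \<in> space M. T \<omega> < change_point L \<omega>}"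
    by (auto simp: less_change_point_iff)
  finally show ?thesis .
qed

text \<open>The change of measure trades the weight of \<Theta> = k for \<open>unchanged t\<close>
  times at most \<open>C * E\<close>, and a stop at \<open>t\<close> with no change by time
  \<open>t\<close> is a false alarm.\<close>

lemma emeasure_small_likelihood:
  assumes ac: "\<And>x. x \<in> {1..K} \<Longrightarrow> AE y in \<mu>. f x y = 0 \<longrightarrow> g x y = 0"
    and k: "k \<le> t" and C: "\<And>\<omega>. \<omega> \<in> space M \<Longrightarrow> prior_odds k (past t \<omega>) \<le> C"
  shows "emeasure M {\<omega> \<in> space M. T \<omega> = enat t \<and> change_point L \<omega> = enat k \<and> Lik k t (past t \<omega>) \<le> E}
    \<le> C * E * emeasure M {\<omega> \<in> space M. T \<omega> = enat t \<and> \<not> L t \<omega>}" (is "emeasure M ?S \<le> _")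
proof -
  define h where "h v = (indicator (stop_at t) v * indicator {v \<in> space (hist_space t). Lik k t v \<le> E} v :: ennreal)" for v
  have "{v \<in> space (hist_space t). Lik k t v \<le> E} \<in> sets (hist_space t)"
    using measurable_Lik by (intro borel_measurable_le) auto
  then have h: "h \<in> borel_measurable (hist_space t)"
    unfolding h_def[abs_def] using sets_stop_at by (intro borel_measurable_times_ennreal borel_measurable_indicator)
  have [measurable]: "{\<omega> \<in> space M. T \<omega> = enat t \<and> \<not> L t \<omega>} \<in> sets M" by (rule sets_false_alarm)
  have eqS: "changed_at k \<omega> * h (past t \<omega>) = indicator ?S \<omega>" if "\<omega> \<in> space M" for \<omega>
    using that hist_space_hist[OF that, of t]
    by (auto simp: changed_at_def h_def stop_at_hist change_point_eq_iff indicator_def)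
  have S: "?S \<in> sets M" by (rule sets_small_likelihood)
  have "emeasure M ?S = (\<integral>\<^sup>+\<omega>. changed_at k \<omega> * h (past t \<omega>) \<partial>M)"
    using S by (subst nn_integral_indicator[symmetric]) (auto simp: eqS cong: nn_integral_cong)
  also have "\<dots> = (\<integral>\<^sup>+\<omega>. unchanged t \<omega> * (prior_odds k (past t \<omega>) * (Lik k t (past t \<omega>) * h (past t \<omega>))) \<partial>M)"
    by (rule change_of_measure[OF ac h k])
  also have "\<dots> \<le> (\<integral>\<^sup>+\<omega>. C * E * indicator {\<omega> \<in> space M. T \<omega> = enat t \<and> \<not> L t \<omega>} \<omega> \<partial>M)"
  proof (rule nn_integral_mono)
    fix \<omega> assume \<omega>: "\<omega> \<in> space M"
    show "unchanged t \<omega> * (prior_odds k (past t \<omega>) * (Lik k t (past t \<omega>) * h (past t \<omega>))) \<le>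
      C * E * indicator {\<omega> \<in> space M. T \<omega> = enat t \<and> \<not> L t \<omega>} \<omega>"
      using C[OF \<omega>] \<omega> hist_space_hist[OF \<omega>, of t]
      by (auto simp: unchanged_def h_def stop_at_hist indicator_def intro!: mult_mono)
  qed
  also have "\<dots> = C * E * emeasure M {\<omega> \<in> space M. T \<omega> = enat t \<and> \<not> L t \<omega>}"
    by (rule nn_integral_cmult_indicator) simp
  finally show ?thesis .
qed

text \<open>A given stopping value \<open>t\<close> lies in the windows of at most \<open>N\<close>
  change-points \<open>k\<close>, and false alarms at different \<open>t\<close> are disjoint. Hence
  a factor \<open>N\<close> in place of a sum over all change-points.\<close>

lemma emeasure_early_small_likelihood:
  assumes ac: "\<And>x. x \<in> {1..K} \<Longrightarrow> AE y in \<mu>. f x y = 0 \<longrightarrow> g x y = 0"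
    and C: "\<And>\<omega> k t. \<omega> \<in> space M \<Longrightarrow> k \<le> t \<Longrightarrow> prior_odds k (past t \<omega>) \<le> C"
  shows "emeasure M {\<omega> \<in> space M. \<exists>k t. k \<le> t \<and> t < k + N \<and> T \<omega> = enat t \<and> change_point L \<omega> = enat k \<and> Lik k t (past t \<omega>) \<le> E}
    \<le> of_nat N * (C * E) * emeasure M {\<omega> \<in> space M. T \<omega> < change_point L \<omega>}" (is "emeasure M ?U \<le> _")
proof -
  define S where "S k t = {\<omega> \<in> space M. T \<omega> = enat t \<and> change_point L \<omega> = enat k \<and> Lik k t (past t \<omega>) \<le> E}" for k t
  define I where "I t = {k. k \<le> t \<and> t < k + N}" for t
  have I: "finite (I t)" "card (I t) \<le> N" for t
  proof -
    have sub: "I t \<subseteq> {Suc t - N..<Suc t}" by (auto simp: I_def)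
    then show "finite (I t)" by (rule finite_subset) simp
    have "card (I t) \<le> card {Suc t - N..<Suc t}" using sub by (intro card_mono) simp
    then show "card (I t) \<le> N" by simp
  qed
  have SI: "S k t \<in> sets M" for k t unfolding S_def by (rule sets_small_likelihood)
  have "?U = (\<Union>t. \<Union>k\<in>I t. S k t)" by (auto simp: S_def I_def)
  also have "emeasure M \<dots> \<le> (\<Sum>t. emeasure M (\<Union>k\<in>I t. S k t))"
    using I SI by (intro emeasure_subadditive_countably) auto
  also have "\<dots> \<le> (\<Sum>t. of_nat N * (C * E) * emeasure M {\<omega> \<in> space M. T \<omega> = enat t \<and> \<not> L t \<omega>})"
  proof (rule suminf_le)
    fix t
    let ?e = "C * E * emeasure M {\<omega> \<in> space M. T \<omega> = enat t \<and> \<not> L t \<omega>}"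
    have "emeasure M (\<Union>k\<in>I t. S k t) \<le> (\<Sum>k\<in>I t. emeasure M (S k t))"
      using I SI by (intro emeasure_subadditive_finite) auto
    also have "\<dots> \<le> (\<Sum>k\<in>I t. ?e)"
      unfolding S_def by (intro sum_mono emeasure_small_likelihood ac C) (auto simp: I_def)
    also have "\<dots> = of_nat (card (I t)) * ?e" by simp
    also have "\<dots> \<le> of_nat N * ?e" using I(2)[of t] by (intro mult_right_mono) auto
    finally show "emeasure M (\<Union>k\<in>I t. S k t) \<le> of_nat N * (C * E) * emeasure M {\<omega> \<in> space M. T \<omega> = enat t \<and> \<not> L t \<omega>}"
      by (simp add: mult.assoc)
  qed auto
  also have "\<dots> = of_nat N * (C * E) * emeasure M {\<omega> \<in> space M. T \<omega> < change_point L \<omega>}"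
    by (simp add: ennreal_suminf_cmult emeasure_false_alarm)
  finally show ?thesis .
qed

text \<open>Since \<open>\<Theta> \<le> s\<close> iff \<open>L s\<close>, the first two conditions say that \<open>s\<close> lies in the window \<open>[\<Theta>, \<Theta> + N)\<close>. The event
  is decided before the response at time \<open>s\<close> is seen.\<close>

definition active :: "nat \<Rightarrow> nat \<Rightarrow> 'w \<Rightarrow> real" where
  "active N s \<omega> = (if L s \<omega> \<and> (s < N \<or> \<not> L (s - N) \<omega>) \<and> \<not> T \<omega> \<le> enat (s - 1) then 1 else 0)"

section \<open>Centred log-likelihood ratios up to the stopping time\<close>

definition score :: "(nat \<Rightarrow> real) \<Rightarrow> nat \<Rightarrow> 'y \<Rightarrow> real" where
  "score Iv x y = ln (gK x y / fK x y) - Iv x"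

definition score_sum :: "(nat \<Rightarrow> real) \<Rightarrow> nat \<Rightarrow> nat \<Rightarrow> 'w \<Rightarrow> real" where
  "score_sum Iv N n \<omega> = (\<Sum>s=1..n. active N s \<omega> * score Iv (X s \<omega>) (Y s \<omega>))"

lemma measurable_score: "(\<lambda>(x, y). score Iv x y) \<in> borel_measurable (count_space UNIV \<Otimes>\<^sub>M borel)"
proof -
  have "(\<lambda>z. case_prod gK z) \<in> borel_measurable (count_space UNIV \<Otimes>\<^sub>M borel)"
    "(\<lambda>z. case_prod fK z) \<in> borel_measurable (count_space UNIV \<Otimes>\<^sub>M borel)"
    using measurable_fK_gK by simp_all
  moreover have "(\<lambda>z. Iv (fst z)) \<in> borel_measurable (count_space UNIV \<Otimes>\<^sub>M (borel :: 'y measure))"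
    by (rule measurable_compose[OF measurable_fst]) simp
  ultimately have "(\<lambda>z. ln (case_prod gK z / case_prod fK z) - Iv (fst z)) \<in> borel_measurable (count_space UNIV \<Otimes>\<^sub>M borel)"
    by (intro borel_measurable_diff borel_measurable_ln borel_measurable_divide)
  then show ?thesis by (simp add: score_def case_prod_beta')
qed

lemma measurable_active:
  assumes "s \<in> {1..Suc n}" shows "active N s \<in> borel_measurable (pre_response n)"
proof -
  have [measurable]: "L s \<in> pre_response n \<rightarrow>\<^sub>M count_space UNIV" "L (s - N) \<in> pre_response n \<rightarrow>\<^sub>M count_space UNIV"
    using assms by (intro measurable_L_pre_response; force)+
  have "(\<lambda>\<omega>. restrict (past n \<omega>) {1..s - 1}) \<in> pre_response n \<rightarrow>\<^sub>M hist_space (s - 1)"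
    by (rule measurable_compose[OF measurable_pre_response(2) measurable_restrict_hist]) (use assms in auto)
  from measurable_sets[OF this A]
  have "(\<lambda>\<omega>. restrict (past n \<omega>) {1..s - 1}) -` A (s - 1) \<inter> space (pre_response n) \<in> sets (pre_response n)" .
  also have "(\<lambda>\<omega>. restrict (past n \<omega>) {1..s - 1}) -` A (s - 1) \<inter> space (pre_response n) =
      {\<omega> \<in> space (pre_response n). T \<omega> \<le> enat (s - 1)}"
    using restrict_hist[of "s - 1" n X Y] TA[of _ "s - 1"] assms by auto
  finally have "{\<omega> \<in> space (pre_response n). T \<omega> \<le> enat (s - 1)} \<in> sets (pre_response n)" .
  then have [measurable]: "Measurable.pred (pre_response n) (\<lambda>\<omega>. T \<omega> \<le> enat (s - 1))"
    by (simp add: pred_def)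
  show ?thesis unfolding active_def[abs_def] by measurable
qed

lemma measurable_score_sum: "score_sum Iv N n \<in> borel_measurable (pre_response n)"
  unfolding score_sum_def[abs_def]
proof (intro borel_measurable_sum borel_measurable_times)
  fix s assume s: "s \<in> {1..n}"
  then show "active N s \<in> borel_measurable (pre_response n)" by (intro measurable_active) auto
  have "(\<lambda>\<omega>. case_prod (score Iv) (past n \<omega> s)) \<in> borel_measurable (pre_response n)"
    by (rule measurable_compose[OF measurable_compose[OF measurable_pre_response(2) measurable_component_singleton[OF s]] measurable_score])
  then show "(\<lambda>\<omega>. score Iv (X s \<omega>) (Y s \<omega>)) \<in> borel_measurable (pre_response n)"
    using s by (simp add: hist_apply)
qed

lemma sum_active_le:
  assumes \<omega>: "\<omega> \<in> space M" shows "(\<Sum>s=1..n. active N s \<omega>) \<le> real N"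
proof (cases "\<exists>s. L s \<omega>")
  case False
  then show ?thesis by (simp add: active_def)
next
  case True
  define k where "k = (LEAST s. L s \<omega>)"
  have k: "L k \<omega>" "\<And>s. L s \<omega> \<Longrightarrow> k \<le> s"
    using True by (auto simp: k_def intro: LeastI Least_le)
  have "active N s \<omega> \<le> (if s \<in> {k..<k + N} then 1 else 0)" for s
  proof (cases "s \<in> {k..<k + N}")
    case False
    then have "s < k \<or> k + N \<le> s" by auto
    then have "\<not> (L s \<omega> \<and> (s < N \<or> \<not> L (s - N) \<omega>))"
      using k L_mono_le[OF \<omega>, of k "s - N"] by (auto dest: k(2))
    then show ?thesis using False by (auto simp: active_def)
  qed (auto simp: active_def)
  then have "(\<Sum>s=1..n. active N s \<omega>) \<le> (\<Sum>s=1..n. if s \<in> {k..<k + N} then 1 else 0)"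
    by (rule sum_mono)
  also have "\<dots> = real (card ({1..n} \<inter> {k..<k + N}))"
    by (simp add: sum.If_cases) (rule arg_cong[where f=card], auto)
  also have "card ({1..n} \<inter> {k..<k + N}) \<le> card {k..<k + N}" by (intro card_mono) auto
  finally show ?thesis by simp
qed

text \<open>Before the next response is drawn, the sum so far is a constant \<open>z\<close> and the
  activity indicator a constant \<open>w\<close>, so \<open>mom\<close> bounds the second moment
  after one more score. It is an inequality because one \<open>V\<close> serves all treatments. The
  expected number of active times stays on the right so that the induction closes.\<close>

lemma score_sum_second_moment:
  assumes V: "0 \<le> V"
    and mom: "\<And>x z w. x \<in> {1..K} \<Longrightarrow>
      (\<integral>\<^sup>+y. ennreal (gK x y) * ennreal ((z + w * score Iv x y)\<^sup>2) \<partial>\<mu>) \<le> ennreal (z\<^sup>2 + w\<^sup>2 * V)"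
  shows "(\<integral>\<^sup>+\<omega>. ennreal ((score_sum Iv N n \<omega>)\<^sup>2) \<partial>M) \<le> (\<integral>\<^sup>+\<omega>. ennreal (V * (\<Sum>s=1..n. active N s \<omega>)) \<partial>M)"
proof (induction n)
  case 0
  show ?case by (simp add: score_sum_def)
next
  case (Suc n)
  let ?N = "pre_response n \<Otimes>\<^sub>M \<mu>"
  let ?Z = "score_sum Iv N n" and ?a = "active N (Suc n)"
  define H where "H z = ennreal ((?Z (fst z) + ?a (fst z) * score Iv (X (Suc n) (fst z)) (snd z))\<^sup>2)" for z
  have act: "?a \<in> borel_measurable (pre_response n)" by (rule measurable_active) simp
  have xy: "(\<lambda>z. (X (Suc n) (fst z), snd z)) \<in> ?N \<rightarrow>\<^sub>M count_space UNIV \<Otimes>\<^sub>M borel"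
    by (intro measurable_Pair measurable_compose[OF measurable_fst measurable_pre_response(1)])
       (simp add: measurable_cong_sets[OF refl sets_mu[symmetric]])
  have sc: "(\<lambda>z. score Iv (X (Suc n) (fst z)) (snd z)) \<in> borel_measurable ?N"
    using measurable_compose[OF xy measurable_score] by simp
  have H: "H \<in> borel_measurable ?N"
    unfolding H_def[abs_def]
    by (intro measurable_compose[OF _ measurable_ennreal] borel_measurable_power borel_measurable_add borel_measurable_times sc
        measurable_compose[OF measurable_fst act] measurable_compose[OF measurable_fst measurable_score_sum])
  have toM: "k \<in> borel_measurable M" if "k \<in> borel_measurable (pre_response n)" for k :: "'w \<Rightarrow> real"
    using measurable_from_subalg[OF subalgebra_pre(1) that] .
  have ZM: "?Z \<in> borel_measurable M" and aM: "?a \<in> borel_measurable M"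
    using measurable_score_sum act by (auto intro: toM)
  have a0: "0 \<le> active N s \<omega>" for s \<omega> by (simp add: active_def)
  have "(\<integral>\<^sup>+\<omega>. ennreal ((score_sum Iv N (Suc n) \<omega>)\<^sup>2) \<partial>M) = (\<integral>\<^sup>+\<omega>. H (\<omega>, Y (Suc n) \<omega>) \<partial>M)"
    by (simp add: H_def score_sum_def)
  also have "\<dots> = (\<integral>\<^sup>+\<omega>. \<integral>\<^sup>+y. ennreal ((if L (Suc n) \<omega> then gK else fK) (X (Suc n) \<omega>) y) * H (\<omega>, y) \<partial>\<mu> \<partial>M)"
    by (rule nn_integral_response[OF H])
  also have "\<dots> \<le> (\<integral>\<^sup>+\<omega>. ennreal ((?Z \<omega>)\<^sup>2) + ennreal (V * ?a \<omega>) \<partial>M)"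
  proof (rule nn_integral_mono)
    fix \<omega> assume \<omega>: "\<omega> \<in> space M"
    show "(\<integral>\<^sup>+y. ennreal ((if L (Suc n) \<omega> then gK else fK) (X (Suc n) \<omega>) y) * H (\<omega>, y) \<partial>\<mu>)
      \<le> ennreal ((?Z \<omega>)\<^sup>2) + ennreal (V * ?a \<omega>)"
    proof (cases "L (Suc n) \<omega>")
      case True
      have "(\<integral>\<^sup>+y. ennreal (gK (X (Suc n) \<omega>) y) * H (\<omega>, y) \<partial>\<mu>) \<le> ennreal ((?Z \<omega>)\<^sup>2 + (?a \<omega>)\<^sup>2 * V)"
        unfolding H_def fst_conv snd_conv by (rule mom[OF X_Suc_in[OF \<omega>]])
      also have "(?a \<omega>)\<^sup>2 * V = V * ?a \<omega>" by (simp add: active_def)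
      also have "ennreal ((?Z \<omega>)\<^sup>2 + V * ?a \<omega>) = ennreal ((?Z \<omega>)\<^sup>2) + ennreal (V * ?a \<omega>)"
        using V a0 by (intro ennreal_plus) auto
      finally show ?thesis using True by simp
    next
      case False
      \<comment> \<open>Before the change the response has density \<open>fK\<close>, under which
        the score need not be centred; such times are inactive.\<close>
      then have "?a \<omega> = 0" by (simp add: active_def)
      then have "(\<integral>\<^sup>+y. ennreal (fK (X (Suc n) \<omega>) y) * H (\<omega>, y) \<partial>\<mu>) = (\<integral>\<^sup>+y. ennreal (fK (X (Suc n) \<omega>) y) * ennreal ((?Z \<omega>)\<^sup>2) \<partial>\<mu>)"
        by (simp add: H_def)
      also have "\<dots> = (\<integral>\<^sup>+y. ennreal (fK (X (Suc n) \<omega>) y) \<partial>\<mu>) * ennreal ((?Z \<omega>)\<^sup>2)"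
      proof (rule nn_integral_multc, rule measurable_compose[OF _ measurable_ennreal])
        show "fK (X (Suc n) \<omega>) \<in> borel_measurable \<mu>"
          using measurable_fK_gK_at(1) by (simp add: measurable_cong_sets[OF sets_mu refl])
      qed
      also have "\<dots> = ennreal ((?Z \<omega>)\<^sup>2)" using nn_integral_fK_gK(1)[OF X_Suc_in[OF \<omega>]] by simp
      finally show ?thesis using False by simp
    qed
  qed
  also have "\<dots> = (\<integral>\<^sup>+\<omega>. ennreal ((?Z \<omega>)\<^sup>2) \<partial>M) + (\<integral>\<^sup>+\<omega>. ennreal (V * ?a \<omega>) \<partial>M)"
    by (rule nn_integral_add) (intro measurable_compose[OF _ measurable_ennreal] borel_measurable_power borel_measurable_times ZM aM borel_measurable_const)+
  also have "\<dots> \<le> (\<integral>\<^sup>+\<omega>. ennreal (V * (\<Sum>s=1..n. active N s \<omega>)) \<partial>M) + (\<integral>\<^sup>+\<omega>. ennreal (V * ?a \<omega>) \<partial>M)"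
    by (intro add_right_mono Suc.IH)
  also have "\<dots> = (\<integral>\<^sup>+\<omega>. ennreal (V * (\<Sum>s=1..n. active N s \<omega>)) + ennreal (V * ?a \<omega>) \<partial>M)"
  proof (rule nn_integral_add[symmetric])
    have "active N s \<in> borel_measurable M" if "s \<in> {1..n}" for s
      using that by (intro toM measurable_active) auto
    then show "(\<lambda>\<omega>. ennreal (V * (\<Sum>s=1..n. active N s \<omega>))) \<in> borel_measurable M"
      by (intro measurable_compose[OF _ measurable_ennreal] borel_measurable_times borel_measurable_sum borel_measurable_const)
    show "(\<lambda>\<omega>. ennreal (V * ?a \<omega>)) \<in> borel_measurable M"
      by (intro measurable_compose[OF _ measurable_ennreal] borel_measurable_times aM borel_measurable_const)
  qed
  also have "\<dots> = (\<integral>\<^sup>+\<omega>. ennreal (V * (\<Sum>s=1..Suc n. active N s \<omega>)) \<partial>M)"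
    using V a0 by (intro nn_integral_cong) (simp add: ennreal_plus[symmetric] sum_nonneg distrib_left del: ennreal_plus)
  finally show ?case .
qed

lemma score_sum_stopped:
  assumes "T \<omega> = enat t" "t \<le> n" shows "score_sum Iv N n \<omega> = score_sum Iv N t \<omega>"
  unfolding score_sum_def
proof (rule sum.mono_neutral_right)
  show "\<forall>s\<in>{1..n} - {1..t}. active N s \<omega> * score Iv (X s \<omega>) (Y s \<omega>) = 0"
    using assms by (auto simp: active_def)
qed (use assms in auto)

text \<open>No time after \<open>T\<close> is active, so at a fixed \<open>n \<ge> T\<close> the sum
  already equals the sum at \<open>T\<close>. Chebyshev's inequality at time \<open>n\<close>
  therefore covers all stops up to \<open>n\<close>, with a bound free of \<open>n\<close>, and
  these events increase to the one in question.\<close>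

lemma emeasure_score_sum_large:
  assumes V: "0 \<le> V"
    and mom: "\<And>x z w. x \<in> {1..K} \<Longrightarrow>
      (\<integral>\<^sup>+y. ennreal (gK x y) * ennreal ((z + w * score Iv x y)\<^sup>2) \<partial>\<mu>) \<le> ennreal (z\<^sup>2 + w\<^sup>2 * V)"
    and b: "0 < b"
  shows "emeasure M {\<omega> \<in> space M. \<exists>t. T \<omega> = enat t \<and> b < score_sum Iv N t \<omega>} \<le> ennreal (V * real N / b\<^sup>2)"
proof -
  define S where "S n = {\<omega> \<in> space M. T \<omega> \<le> enat n \<and> b < score_sum Iv N n \<omega>}" for n
  have ZM: "score_sum Iv N n \<in> borel_measurable M" for n
    using measurable_from_subalg[OF subalgebra_pre(1) measurable_score_sum] .
  have S: "S n \<in> sets M" for n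
    unfolding S_def using sets_T_le[of n] ZM[of n] by (intro sets.sets_Collect_conj borel_measurable_less) auto
  have S_iff: "\<omega> \<in> S n \<longleftrightarrow> \<omega> \<in> space M \<and> (\<exists>t\<le>n. T \<omega> = enat t \<and> b < score_sum Iv N t \<omega>)" for \<omega> n
    using score_sum_stopped[of \<omega> _ n Iv N] by (cases "T \<omega>") (auto simp: S_def)
  have bound: "emeasure M (S n) \<le> ennreal (V * real N / b\<^sup>2)" for n
  proof -
    have "ennreal (b\<^sup>2) * emeasure M (S n) = (\<integral>\<^sup>+\<omega>. ennreal (b\<^sup>2) * indicator (S n) \<omega> \<partial>M)"
      using S by (simp add: nn_integral_cmult_indicator)
    also have "\<dots> \<le> (\<integral>\<^sup>+\<omega>. ennreal ((score_sum Iv N n \<omega>)\<^sup>2) \<partial>M)"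
      using b by (intro nn_integral_mono) (auto simp: S_def indicator_def intro!: ennreal_leI power_mono)
    also have "\<dots> \<le> (\<integral>\<^sup>+\<omega>. ennreal (V * (\<Sum>s=1..n. active N s \<omega>)) \<partial>M)"
      by (rule score_sum_second_moment[OF V mom])
    also have "\<dots> \<le> (\<integral>\<^sup>+\<omega>. ennreal (V * real N) \<partial>M)"
      using V sum_active_le by (intro nn_integral_mono ennreal_leI mult_left_mono) auto
    also have "\<dots> = ennreal (V * real N)" by (simp add: emeasure_space_1)
    finally have "b\<^sup>2 * prob (S n) \<le> V * real N"
      using V by (simp add: emeasure_eq_measure ennreal_mult'[symmetric])
    then show ?thesis
      using b by (simp add: emeasure_eq_measure field_simps ennreal_leI)
  qed
  have "{\<omega> \<in> space M. \<exists>t. T \<omega> = enat t \<and> b < score_sum Iv N t \<omega>} = (\<Union>n. S n)"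
    by (auto simp: S_iff)
  moreover have "emeasure M (\<Union>n. S n) = (SUP n. emeasure M (S n))"
    by (rule SUP_emeasure_incseq[symmetric]) (use S in \<open>auto simp: incseq_def S_iff\<close>)
  ultimately show ?thesis using bound by (auto intro: SUP_least)
qed

text \<open>The logarithm of the likelihood ratio is the sum of the scores plus the drift: dividing
  by \<open>1 - \<Pi>\<close> contributes \<open>omega \<Pi>\<close>, and the mean \<open>Iv\<close>
  is subtracted and added back.\<close>

lemma score_sum_gt:
  assumes \<omega>: "\<omega> \<in> space M" and T: "T \<omega> = enat t" and \<Theta>: "change_point L \<omega> = enat k"
    and kt: "k \<le> t" "t < k + N"
    and big: "ennreal (exp a) < Lik k t (past t \<omega>)"
    and drift: "(\<Sum>s\<in>{max 1 k..t}. Iv (X s \<omega>) + omega (Pi_t \<pi> X s \<omega>)) \<le> a - b"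
  shows "b < score_sum Iv N t \<omega>"
proof -
  let ?J = "{max 1 k..t}"
  have Lk: "L s \<omega> \<longleftrightarrow> k \<le> s" for s
    using change_point_le_iff[OF \<omega>, of s] \<Theta> by simp
  define r where "r s = gK (X s \<omega>) (Y s \<omega>) / fK (X s \<omega>) (Y s \<omega>)" for s
  define q where "q s = 1 - Pi_t \<pi> X s \<omega>" for s
  have q: "0 < q s" "q s \<le> 1" for s using Pi_range[OF \<omega>, of s] by (auto simp: q_def)
  have r0: "0 \<le> r s" for s using fK_gK_nonneg by (simp add: r_def)
  have lik: "lik s (past t \<omega>) = ennreal (r s / q s)" if "s \<in> ?J" for s
  proof -
    have "map (\<lambda>r. fst (past t \<omega> r)) [1..<Suc s] = map (\<lambda>s. X s \<omega>) [1..<Suc s]"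
      using that by (intro map_cong) (auto simp: hist_def)
    moreover have "past t \<omega> s = (X s \<omega>, Y s \<omega>)" using that by (intro hist_apply) auto
    ultimately show ?thesis unfolding lik_def r_def q_def Pi_t_def by (simp only: fst_conv snd_conv)
  qed
  have "Lik k t (past t \<omega>) = (\<Prod>s\<in>?J. ennreal (r s / q s))"
    unfolding Lik_def by (rule prod.cong) (use lik in auto)
  also have "\<dots> = ennreal (\<Prod>s\<in>?J. r s / q s)"
    using r0 q by (intro prod_ennreal) (simp add: order_less_imp_le)
  finally have gt: "exp a < (\<Prod>s\<in>?J. r s / q s)" using big by (simp add: ennreal_less_iff)
  \<comment> \<open>A ratio 0 would make the product vanish. It has to be excluded because
    \<open>ln\<close> of a product splits only for nonzero factors.\<close>
  have nz: "r s \<noteq> 0" if "s \<in> ?J" for s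
  proof
    assume "r s = 0"
    then have "(\<Prod>s\<in>?J. r s / q s) = 0" using that by (intro prod_zero) auto
    with gt exp_gt_zero[of a] show False by linarith
  qed
  then have pos: "0 < r s" if "s \<in> ?J" for s using r0[of s] that by (simp add: order_less_le)
  have "a < ln (\<Prod>s\<in>?J. r s / q s)" using gt by (metis exp_gt_zero ln_exp ln_less_cancel_iff order_less_trans)
  also have "\<dots> = (\<Sum>s\<in>?J. ln (r s / q s))"
  proof (rule ln_prod)
    fix s assume "s \<in> ?J"
    then show "r s / q s \<noteq> 0" using nz[of s] q(1)[of s] by auto
  qed simp
  also have "\<dots> = (\<Sum>s\<in>?J. ln (r s) + omega (Pi_t \<pi> X s \<omega>))"
  proof (rule sum.cong)
    fix s assume s: "s \<in> ?J"
    have "omega (Pi_t \<pi> X s \<omega>) = - ln (q s)" unfolding omega_def q_def[symmetric] using q[of s] by simp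
    then show "ln (r s / q s) = ln (r s) + omega (Pi_t \<pi> X s \<omega>)" using pos[OF s] q[of s] by (simp add: ln_div)
  qed simp
  also have "\<dots> = (\<Sum>s\<in>?J. score Iv (X s \<omega>) (Y s \<omega>)) + (\<Sum>s\<in>?J. Iv (X s \<omega>) + omega (Pi_t \<pi> X s \<omega>))"
    by (simp add: score_def r_def sum.distrib sum_subtractf)
  also have "\<dots> \<le> (\<Sum>s\<in>?J. score Iv (X s \<omega>) (Y s \<omega>)) + (a - b)" using drift by simp
  \<comment> \<open>Given \<Theta> = k, T = t and \<open>t < k + N\<close>, the active times among
    \<open>{1..t}\<close> are exactly those from \<open>max 1 k\<close> on.\<close>
  also have "(\<Sum>s\<in>?J. score Iv (X s \<omega>) (Y s \<omega>)) = score_sum Iv N t \<omega>"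
    unfolding score_sum_def
  proof (rule sum.mono_neutral_cong_left)
    show "\<forall>s\<in>{1..t} - ?J. active N s \<omega> * score Iv (X s \<omega>) (Y s \<omega>) = 0"
      by (auto simp: active_def Lk)
    fix s assume "s \<in> ?J"
    then have "active N s \<omega> = 1" using kt by (auto simp: active_def Lk T)
    then show "score Iv (X s \<omega>) (Y s \<omega>) = active N s \<omega> * score Iv (X s \<omega>) (Y s \<omega>)" by simp
  qed auto
  finally show ?thesis by simp
qed

lemma emeasure_early_detection:
  assumes ac: "\<And>x. x \<in> {1..K} \<Longrightarrow> AE y in \<mu>. f x y = 0 \<longrightarrow> g x y = 0"
    and C: "\<And>\<omega> k t. \<omega> \<in> space M \<Longrightarrow> k \<le> t \<Longrightarrow> prior_odds k (past t \<omega>) \<le> C"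
    and V: "0 \<le> V"
    and mom: "\<And>x z w. x \<in> {1..K} \<Longrightarrow>
      (\<integral>\<^sup>+y. ennreal (gK x y) * ennreal ((z + w * score Iv x y)\<^sup>2) \<partial>\<mu>) \<le> ennreal (z\<^sup>2 + w\<^sup>2 * V)"
    and b: "0 < b"
    and drift: "\<And>\<omega> k t. \<omega> \<in> space M \<Longrightarrow> k \<le> t \<Longrightarrow> t < k + N \<Longrightarrow>
      (\<Sum>s\<in>{max 1 k..t}. Iv (X s \<omega>) + omega (Pi_t \<pi> X s \<omega>)) \<le> a - b"
  shows "emeasure M {\<omega> \<in> space M. change_point L \<omega> \<le> T \<omega> \<and> T \<omega> < change_point L \<omega> + enat N}
    \<le> of_nat N * (C * ennreal (exp a)) * emeasure M {\<omega> \<in> space M. T \<omega> < change_point L \<omega>} + ennreal (V * real N / b\<^sup>2)"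
proof -
  let ?U = "{\<omega> \<in> space M. \<exists>k t. k \<le> t \<and> t < k + N \<and> T \<omega> = enat t \<and> change_point L \<omega> = enat k \<and>
      Lik k t (past t \<omega>) \<le> ennreal (exp a)}"
  let ?S = "{\<omega> \<in> space M. \<exists>t. T \<omega> = enat t \<and> b < score_sum Iv N t \<omega>}"
  have SM: "?S \<in> sets M"
  proof -
    have ZM: "score_sum Iv N n \<in> borel_measurable M" for n
      using measurable_from_subalg[OF subalgebra_pre(1) measurable_score_sum] .
    have "?S = (\<Union>t. {\<omega> \<in> space M. T \<omega> = enat t \<and> b < score_sum Iv N t \<omega>})" by auto
    moreover have "{\<omega> \<in> space M. T \<omega> = enat t \<and> b < score_sum Iv N t \<omega>} \<in> sets M" for t
      using sets_T_eq[of t] ZM[of t] by (intro sets.sets_Collect_conj borel_measurable_less) auto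
    ultimately show ?thesis by auto
  qed
  have UM: "?U \<in> sets M"
  proof -
    define B where "B k t = (if k \<le> t \<and> t < k + N then {\<omega> \<in> space M. T \<omega> = enat t \<and> change_point L \<omega> = enat k \<and>
      Lik k t (past t \<omega>) \<le> ennreal (exp a)} else {})" for k t
    have B: "B k t \<in> sets M" for k t
      unfolding B_def using sets_small_likelihood by simp
    have "?U = (\<Union>k. \<Union>t. B k t)" by (auto simp: B_def split: if_splits)
    then show ?thesis using B by (simp only:) (intro sets.countable_UN image_subsetI)
  qed
  have "{\<omega> \<in> space M. change_point L \<omega> \<le> T \<omega> \<and> T \<omega> < change_point L \<omega> + enat N} \<subseteq> ?U \<union> ?S"
  proof
    fix \<omega> assume "\<omega> \<in> {\<omega> \<in> space M. change_point L \<omega> \<le> T \<omega> \<and> T \<omega> < change_point L \<omega> + enat N}"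
    then have \<omega>: "\<omega> \<in> space M" and le: "change_point L \<omega> \<le> T \<omega>" "T \<omega> < change_point L \<omega> + enat N" by auto
    obtain t where t: "T \<omega> = enat t" using le(2) by (cases "T \<omega>") auto
    obtain k where k: "change_point L \<omega> = enat k" using le(1) t by (cases "change_point L \<omega>") auto
    have kt: "k \<le> t" "t < k + N" using le t k by auto
    show "\<omega> \<in> ?U \<union> ?S"
    proof (cases "Lik k t (past t \<omega>) \<le> ennreal (exp a)")
      case True
      then show ?thesis using \<omega> t k kt by auto
    next
      case False
      then have "b < score_sum Iv N t \<omega>"
        by (intro score_sum_gt[OF \<omega> t k kt _ drift[OF \<omega> kt]]) (simp add: not_le)
      then show ?thesis using \<omega> t by auto
    qed
  qed
  then have "emeasure M {\<omega> \<in> space M. change_point L \<omega> \<le> T \<omega> \<and> T \<omega> < change_point L \<omega> + enat N} \<le> emeasure M (?U \<union> ?S)"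
    by (rule emeasure_mono) (intro sets.Un UM SM)
  also have "\<dots> \<le> emeasure M ?U + emeasure M ?S"
    by (rule emeasure_subadditive[OF UM SM])
  also have "\<dots> \<le> of_nat N * (C * ennreal (exp a)) * emeasure M {\<omega> \<in> space M. T \<omega> < change_point L \<omega>} + ennreal (V * real N / b\<^sup>2)"
    by (intro add_mono emeasure_early_small_likelihood[OF ac C] emeasure_score_sum_large[OF V mom b])
  finally show ?thesis .
qed

end

end

section \<open>Switching to a block at the stopping time\<close>

lemma suminf_swap_ennreal:
  fixes a :: "nat \<Rightarrow> nat \<Rightarrow> ennreal"
  shows "(\<Sum>i. \<Sum>j. a i j) = (\<Sum>j. \<Sum>i. a i j)"
proof -
  have "(\<Sum>i. \<Sum>j. a i j) = (\<integral>\<^sup>+i. (\<Sum>j. a i j) \<partial>count_space UNIV)"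
    by (rule nn_integral_count_space_nat[symmetric])
  also have "\<dots> = (\<Sum>j. \<integral>\<^sup>+i. a i j \<partial>count_space UNIV)"
    by (rule nn_integral_suminf) simp
  finally show ?thesis by (simp add: nn_integral_count_space_nat)
qed

lemma suminf_triangle_ennreal:
  fixes a :: "nat \<Rightarrow> nat \<Rightarrow> ennreal"
  shows "(\<Sum>t. \<Sum>m\<le>t. a m t) = (\<Sum>m. \<Sum>j. a m (m + j))"
proof -
  have "(\<Sum>m\<le>t. a m t) = (\<Sum>m. if m \<le> t then a m t else 0)" for t
    by (subst suminf_finite[of "{..t}"]) auto
  then have "(\<Sum>t. \<Sum>m\<le>t. a m t) = (\<Sum>m. \<Sum>t. if m \<le> t then a m t else 0)"
    by (simp add: suminf_swap_ennreal[of "\<lambda>t m. if m \<le> t then a m t else 0"])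
  also have "\<dots> = (\<Sum>m. \<Sum>j. a m (m + j))"
  proof (rule suminf_cong)
    fix m
    have "(\<Sum>t. if m \<le> t then a m t else 0) =
      (\<Sum>j. if m \<le> j + m then a m (j + m) else 0) + (\<Sum>t<m. if m \<le> t then a m t else 0)"
      by (subst suminf_offset[of _ m]) (auto simp: add.commute)
    then show "(\<Sum>t. if m \<le> t then a m t else 0) = (\<Sum>j. a m (m + j))"
      by (simp add: add.commute)
  qed
  finally show ?thesis .
qed

section \<open>The switched rule and the indicators of the stop\<close>

lemma pred_clip:
  fixes S :: "nat \<Rightarrow> (nat \<Rightarrow> nat \<times> 'y::polish_space) set"
  assumes "s \<le> t" "\<And>s. S s \<in> sets (hist_space s)"
  shows "Measurable.pred (\<Pi>\<^sub>M s\<in>{1..t}. count_space A \<Otimes>\<^sub>M borel) (\<lambda>v. clip K s v \<in> S s)"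
proof -
  let ?N = "\<Pi>\<^sub>M s\<in>{1..t}. count_space A \<Otimes>\<^sub>M (borel :: 'y measure)"
  have "clip K s -` S s \<inter> space ?N \<in> sets ?N"
    by (rule measurable_sets[OF measurable_clip[OF _ assms(1)] assms(2)]) simp
  moreover have "clip K s -` S s \<inter> space ?N = {v \<in> space ?N. clip K s v \<in> S s}" by auto
  ultimately show ?thesis unfolding pred_def by (simp only:)
qed

text \<open>The sets \<open>A s\<close> encode the stop, and \<open>clip K s v\<close> reads off
  only the first \<open>s\<close> observations. Since \<open>switch K A \<Xi> \<phi> t\<close>
  chooses the treatment at time \<open>t + 1\<close>, a stop at \<open>s\<close> makes treatment
  \<open>s + 1\<close> the first entry of the block.\<close>

definition switch :: "nat \<Rightarrow> (nat \<Rightarrow> (nat \<Rightarrow> nat \<times> 'y) set) \<Rightarrow> nat list \<Rightarrow> 'y rule \<Rightarrow> 'y rule" where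
  "switch K A \<Xi> \<phi> t v = (if \<exists>s\<le>t. clip K s v \<in> A s
     then \<Xi> ! ((t - (LEAST s. s \<le> t \<and> clip K s v \<in> A s)) mod length \<Xi>) else \<phi> t v)"

lemma block_nth_in: "is_block K \<Xi> \<Longrightarrow> \<Xi> ! (i mod length \<Xi>) \<in> {1..K}"
  using nth_mem[of "i mod length \<Xi>" \<Xi>] unfolding is_block_def by (metis length_greater_0_conv mod_less_divisor subsetD)

lemma assignment_rule_switch:
  assumes rule: "assignment_rule K \<phi>" and A: "\<And>s. A s \<in> sets (hist_space s)" and \<Xi>: "is_block K \<Xi>"
  shows "assignment_rule K (switch K A \<Xi> \<phi>)"
  unfolding assignment_rule_def
proof
  fix t :: nat
  let ?N = "\<Pi>\<^sub>M s\<in>{1..t}. count_space {1..K} \<Otimes>\<^sub>M (borel :: 'a measure)"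
  have P: "Measurable.pred ?N (\<lambda>v. s \<le> t \<and> clip K s v \<in> A s)" for s
    using pred_clip[OF _ A, of s t] by (cases "s \<le> t") auto
  have "(\<lambda>v. LEAST s. s \<le> t \<and> clip K s v \<in> A s) \<in> ?N \<rightarrow>\<^sub>M count_space UNIV"
    by (rule measurable_Least[OF P])
  then have 1: "(\<lambda>v. \<Xi> ! ((t - (LEAST s. s \<le> t \<and> clip K s v \<in> A s)) mod length \<Xi>)) \<in> ?N \<rightarrow>\<^sub>M count_space {1..K}"
    by (rule measurable_compose) (use block_nth_in[OF \<Xi>] in auto)
  have 2: "\<phi> t \<in> ?N \<rightarrow>\<^sub>M count_space {1..K}" using rule by (simp add: assignment_rule_def)
  have "Measurable.pred ?N (\<lambda>v. \<exists>s. s \<le> t \<and> clip K s v \<in> A s)"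
    using P by (rule pred_intros_countable(2))
  then have "{v \<in> space ?N. \<exists>s\<le>t. clip K s v \<in> A s} \<in> sets ?N" unfolding pred_def .
  then show "switch K A \<Xi> \<phi> t \<in> ?N \<rightarrow>\<^sub>M count_space {1..K}"
    unfolding switch_def[abs_def] by (intro measurable_If 1 2)
qed

text \<open>If \<open>A\<close> describes \<open>T\<close>, this is the indicator of T \<ge> t on
  observed histories, and \<open>running K A (Suc t)\<close> stands for T > t. It is a function of
  the history because \<open>T\<close> is not defined on the space of the switched rule.\<close>

definition running :: "nat \<Rightarrow> (nat \<Rightarrow> (nat \<Rightarrow> nat \<times> 'y) set) \<Rightarrow> nat \<Rightarrow> (nat \<Rightarrow> nat \<times> 'y) \<Rightarrow> ennreal" where
  "running K A t v = (if \<forall>s<t. clip K s v \<notin> A s then 1 else 0)"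

definition stopping :: "nat \<Rightarrow> (nat \<Rightarrow> (nat \<Rightarrow> nat \<times> 'y) set) \<Rightarrow> nat \<Rightarrow> (nat \<Rightarrow> nat \<times> 'y) \<Rightarrow> ennreal" where
  "stopping K A t v = (if clip K t v \<in> A t then running K A t v else 0)"

lemma measurable_running:
  fixes S :: "nat \<Rightarrow> (nat \<Rightarrow> nat \<times> 'y::polish_space) set"
  assumes S: "\<And>s. S s \<in> sets (hist_space s)" and "t \<le> Suc r"
  shows "running K S t \<in> borel_measurable (hist_space r)"
proof -
  have P: "Measurable.pred (hist_space r) (\<lambda>v. s < t \<longrightarrow> clip K s v \<notin> S s)" for s
    using pred_clip[where A=UNIV, OF _ S, of s r K] assms(2) by (cases "s < t") auto
  have "Measurable.pred (hist_space r) (\<lambda>v. \<forall>s. s < t \<longrightarrow> clip K s v \<notin> S s)"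
    using P by (rule pred_intros_countable(1))
  then have "{v \<in> space (hist_space r). \<forall>s<t. clip K s v \<notin> S s} \<in> sets (hist_space r)" unfolding pred_def .
  then show ?thesis
    unfolding running_def[abs_def] by (intro measurable_If borel_measurable_const)
qed

lemma measurable_stopping:
  fixes S :: "nat \<Rightarrow> (nat \<Rightarrow> nat \<times> 'y::polish_space) set"
  assumes S: "\<And>s. S s \<in> sets (hist_space s)" and t: "t \<le> r"
  shows "stopping K S t \<in> borel_measurable (hist_space r)"
proof -
  have "{v \<in> space (hist_space r). clip K t v \<in> S t} \<in> sets (hist_space r)"
    using pred_clip[where A=UNIV, OF t S] unfolding pred_def .
  then show ?thesis
    unfolding stopping_def[abs_def] using measurable_running[OF S, of t r K] t
    by (intro measurable_If borel_measurable_const) auto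
qed

lemma running_Suc: "running K A (Suc t) v = (if clip K t v \<in> A t then 0 else running K A t v)"
  by (auto simp: running_def less_Suc_eq)

lemma running_upd: "running K A (Suc t) (v(Suc t := z)) = running K A (Suc t) v"
  by (simp add: running_def clip_fun_upd)

lemma treat_switch: "running K A (Suc t) v = 1 \<Longrightarrow> treat K (switch K A \<Xi> \<phi>) t v = treat K \<phi> t v"
  by (auto simp: treat_def switch_def running_def clip_clip less_Suc_eq_le split: if_splits)

lemma running_partition: "1 \<le> running K A (Suc t) v + (\<Sum>m\<le>t. stopping K A m v)"
proof (cases "\<forall>s\<le>t. clip K s v \<notin> A s")
  case True
  then show ?thesis by (simp add: running_def less_Suc_eq_le)
next
  case False
  define m where "m = (LEAST s. clip K s v \<in> A s)"
  obtain s where s: "s \<le> t" "clip K s v \<in> A s" using False by auto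
  have m: "clip K m v \<in> A m" "m \<le> s" "\<forall>r<m. clip K r v \<notin> A r"
    unfolding m_def using s(2) by (auto intro: LeastI Least_le dest: not_less_Least)
  then have "stopping K A m v = 1" by (simp add: stopping_def running_def)
  moreover have "stopping K A m v \<le> (\<Sum>m\<le>t. stopping K A m v)"
    using m s by (intro member_le_sum) auto
  ultimately show ?thesis by (simp add: add_increasing)
qed

text \<open>Nothing links the two spaces beyond the common \<open>\<mu>\<close>, \<open>f\<close>,
  \<open>g\<close>, \<open>\<pi>\<close>, \<open>K\<close> and the relation between the rules; even
  their types may differ.\<close>

locale switched_models =
  m: ruled_change_point_model M \<mu> f g \<pi> \<phi> L X Y K +
  m': ruled_change_point_model M' \<mu> f g \<pi> "switch K A \<Xi> \<phi>" L' X' Y' K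
  for M :: "'w measure" and \<mu> :: "'y::polish_space measure" and f g \<pi> \<phi> L X Y K
    and M' :: "'v measure" and L' X' Y' and A :: "nat \<Rightarrow> (nat \<Rightarrow> nat \<times> 'y) set" and \<Xi> +
  assumes A: "\<And>s. A s \<in> sets (hist_space s)" and block: "is_block K \<Xi>"
begin

text \<open>The recursion for the unchanged law involves only the chosen treatment, its transition
  probability and the density \<open>f\<close>, all functions of the history. As long as there was
  no stop the two rules choose alike, so the recursions agree. The weight
  \<open>running K A t\<close> still admits a stop at \<open>t\<close> itself, which makes the laws
  comparable up to and including the stop.\<close>

lemma law_before_switch:
  "h \<in> borel_measurable (hist_space t) \<Longrightarrow>
   (\<integral>\<^sup>+\<omega>. m.unchanged t \<omega> * (running K A t (m.past t \<omega>) * h (m.past t \<omega>)) \<partial>M) =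
   (\<integral>\<^sup>+\<omega>. m'.unchanged t \<omega> * (running K A t (m'.past t \<omega>) * h (m'.past t \<omega>)) \<partial>M')"
proof (induction t arbitrary: h)
  case 0
  then show ?case
    using m.nn_integral_unchanged_0 m'.nn_integral_unchanged_0
    by (simp add: hist_0 running_def nn_integral_multc m.measurable_unchanged m'.measurable_unchanged)
next
  case (Suc t)
  define H where "H v = running K A (Suc t) v * h v" for v
  have H: "H \<in> borel_measurable (hist_space (Suc t))"
    unfolding H_def[abs_def] by (intro borel_measurable_times_ennreal measurable_running A Suc.prems) simp
  define r where "r \<psi> v = ennreal (1 - next_prob \<pi> t (treat K \<psi> t v) v) *
      next_exp \<mu> (on_treatments K f) t (treat K \<psi> t v) H v" for \<psi> v
  \<comment> \<open>\<open>running K A (Suc t)\<close> tests only the first \<open>t\<close>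
    observations, so it is constant in the new one and annihilates the whole step after a
    stop.\<close>
  have r0: "r \<psi> v = 0" if "running K A (Suc t) v = 0" for \<psi> v
    using that by (simp add: r_def next_exp_def H_def running_upd)
  have r1: "r (switch K A \<Xi> \<phi>) v = r \<phi> v" for v
  proof (cases "running K A (Suc t) v = 0")
    case False
    then have "running K A (Suc t) v = 1" by (simp add: running_def split: if_splits)
    then show ?thesis by (simp add: r_def treat_switch)
  qed (simp add: r0)
  \<comment> \<open>This inserts the weight \<open>running K A t\<close> that the induction
    hypothesis carries.\<close>
  have r2: "running K A t v * r \<phi> v = r \<phi> v" for v
  proof (cases "running K A t v = 0")
    case True
    then have "running K A (Suc t) v = 0" by (simp add: running_Suc)
    then show ?thesis by (simp add: r0)
  next
    case False
    then have "running K A t v = 1" by (simp add: running_def split: if_splits)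
    then show ?thesis by simp
  qed
  have rm: "r \<phi> \<in> borel_measurable (hist_space t)"
    unfolding r_def[abs_def]
    by (intro borel_measurable_times_ennreal m.measurable_next_hist(1) H measurable_compose[OF _ measurable_ennreal]
        borel_measurable_diff borel_measurable_const measurable_next_prob measurable_treat m.rule m.K_pos)
  have "(\<integral>\<^sup>+\<omega>. m.unchanged (Suc t) \<omega> * H (m.past (Suc t) \<omega>) \<partial>M) = (\<integral>\<^sup>+\<omega>. m.unchanged t \<omega> * r \<phi> (m.past t \<omega>) \<partial>M)"
    unfolding m.nn_integral_unchanged_Suc[OF H]
    by (rule nn_integral_cong) (simp add: r_def m.treat_hist m.next_prob_hist)
  also have "\<dots> = (\<integral>\<^sup>+\<omega>. m'.unchanged t \<omega> * r \<phi> (m'.past t \<omega>) \<partial>M')"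
    using Suc.IH[OF rm] by (simp add: r2)
  also have "\<dots> = (\<integral>\<^sup>+\<omega>. m'.unchanged (Suc t) \<omega> * H (m'.past (Suc t) \<omega>) \<partial>M')"
    unfolding m'.nn_integral_unchanged_Suc[OF H] r1[symmetric]
    by (rule nn_integral_cong) (simp add: r_def m'.treat_hist m'.next_prob_hist)
  finally show ?case by (simp add: H_def)
qed

lemma X_after_switch:
  assumes \<omega>: "\<omega> \<in> space M'" and st: "stopping K A n (m'.past n \<omega>) \<noteq> 0" and "n \<le> t"
  shows "X' (Suc t) \<omega> = \<Xi> ! ((t - n) mod length \<Xi>)"
proof -
  have c: "clip K s (m'.past t \<omega>) = m'.past s \<omega>" if "s \<le> t" for s by (rule m'.clip_hist[OF \<omega> that])
  have n: "m'.past n \<omega> \<in> A n" "\<And>s. s < n \<Longrightarrow> m'.past s \<omega> \<notin> A s"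
    using st by (auto simp: stopping_def running_def m'.clip_hist[OF \<omega>] split: if_splits)
  have "(LEAST s. s \<le> t \<and> clip K s (m'.past t \<omega>) \<in> A s) = n"
  proof (rule Least_equality)
    show "n \<le> t \<and> clip K n (m'.past t \<omega>) \<in> A n" using n c[of n] assms(3) by simp
    fix s assume "s \<le> t \<and> clip K s (m'.past t \<omega>) \<in> A s"
    then show "n \<le> s" using n(2)[of s] c[of s] by (metis not_less)
  qed
  moreover have "\<exists>s\<le>t. clip K s (m'.past t \<omega>) \<in> A s" using n c[of n] assms(3) by auto
  ultimately show ?thesis by (simp add: m'.X_rule[OF \<omega>] switch_def)
qed

text \<open>Conditional probability that after the treatments \<open>z\<close> without a change none
  occurs during the next \<open>j\<close> steps of the block. Summed over \<open>j\<close> these are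
  the terms of \<open>lambda_tilde\<close>, whose leading 1 is the term
  \<open>j = 0\<close>.\<close>

definition survival :: "nat \<Rightarrow> nat list \<Rightarrow> ennreal" where
  "survival j z = (\<Prod>i=1..j. ennreal (1 - \<pi> (z @ block_prefix \<Xi> i)))"

lemma survival_Suc: "survival (Suc j) z = ennreal (1 - \<pi> (z @ block_prefix \<Xi> (Suc j))) * survival j z"
  by (simp add: survival_def mult.commute)

lemma Pi_after_switch:
  assumes \<omega>: "\<omega> \<in> space M'" and st: "stopping K A n (m'.past n \<omega>) \<noteq> 0"
  shows "Pi_t \<pi> X' (Suc (n + j)) \<omega> = \<pi> (map (\<lambda>s. X' s \<omega>) [1..<Suc n] @ block_prefix \<Xi> (Suc j))"
proof -
  have "[1..<Suc (Suc (n + j))] = [1..<Suc n] @ [Suc n..<Suc n + Suc j]"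
    using upt_add_eq_append[of 1 "Suc n" "Suc j"] by simp
  moreover have "map (\<lambda>s. X' s \<omega>) [Suc n..<Suc n + Suc j] = block_prefix \<Xi> (Suc j)"
  proof (rule nth_equalityI)
    show "length (map (\<lambda>s. X' s \<omega>) [Suc n..<Suc n + Suc j]) = length (block_prefix \<Xi> (Suc j))"
      by (simp add: block_prefix_def)
    fix i assume "i < length (map (\<lambda>s. X' s \<omega>) [Suc n..<Suc n + Suc j])"
    then have i: "i < Suc j" by (simp del: upt_Suc)
    have "X' (Suc (n + i)) \<omega> = \<Xi> ! (i mod length \<Xi>)"
      using X_after_switch[OF \<omega> st, of "n + i"] by simp
    then show "map (\<lambda>s. X' s \<omega>) [Suc n..<Suc n + Suc j] ! i = block_prefix \<Xi> (Suc j) ! i"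
      using i unfolding block_prefix_def by (simp del: upt_Suc)
  qed
  ultimately show ?thesis unfolding Pi_t_def by (simp only: map_append)
qed

text \<open>After a stop at \<open>n\<close> the block dictates the treatments, so every later
  transition probability is a function of the history up to \<open>n\<close>. The last such factor
  can be absorbed into the weight \<open>r\<close>, which is why the induction is over arbitrary
  \<open>r\<close>.\<close>

lemma survival_after_switch:
  "r \<in> borel_measurable (hist_space n) \<Longrightarrow>
   (\<integral>\<^sup>+\<omega>. m'.unchanged (n + j) \<omega> * (stopping K A n (m'.past n \<omega>) * r (m'.past n \<omega>)) \<partial>M') =
   (\<integral>\<^sup>+\<omega>. m'.unchanged n \<omega> * (stopping K A n (m'.past n \<omega>) *
      (r (m'.past n \<omega>) * survival j (map (\<lambda>s. fst (m'.past n \<omega> s)) [1..<Suc n]))) \<partial>M')"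
proof (induction j arbitrary: r)
  case 0
  show ?case by (simp add: survival_def)
next
  case (Suc j)
  let ?h = "m'.past n" and ?s = "\<lambda>\<omega>. stopping K A n (m'.past n \<omega>)"
  define q where "q v = ennreal (1 - \<pi> (map (\<lambda>s. fst (v s)) [1..<Suc n] @ block_prefix \<Xi> (Suc j)))" for v :: "nat \<Rightarrow> nat \<times> 'y"
  have q: "q \<in> borel_measurable (hist_space n)"
  proof -
    have "(\<lambda>v. map (\<lambda>s. fst (v s)) [1..<Suc n]) \<in> (hist_space n :: (nat \<Rightarrow> nat \<times> 'y) measure) \<rightarrow>\<^sub>M count_space UNIV"
      by (rule measurable_map_list_count_space, rule measurable_fst_component) auto
    from measurable_compose[OF this, of "\<lambda>z. ennreal (1 - \<pi> (z @ block_prefix \<Xi> (Suc j)))" borel]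
    show ?thesis unfolding q_def[abs_def] by simp
  qed
  \<comment> \<open>The transition formula at time \<open>n + j\<close> wants a function of the
    history up to \<open>n + j\<close>; restriction recovers the history up to
    \<open>n\<close>.\<close>
  define R where "R v = stopping K A n (restrict v {1..n}) * r (restrict v {1..n})" for v
  have res: "(\<lambda>v. restrict v {1..n}) \<in> hist_space (n + j) \<rightarrow>\<^sub>M (hist_space n :: (nat \<Rightarrow> nat \<times> 'y) measure)"
    by (rule measurable_restrict_subset) auto
  have R: "R \<in> borel_measurable (hist_space (n + j))"
    unfolding R_def[abs_def]
    by (intro borel_measurable_times_ennreal measurable_compose[OF res measurable_stopping[OF A order_refl]]
        measurable_compose[OF res Suc.prems])
  have Rh: "R (m'.past (n + j) \<omega>) = ?s \<omega> * r (?h \<omega>)" for \<omega>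
    using restrict_hist[of n "n + j" X' Y' \<omega>] by (simp add: R_def)
  have "(\<integral>\<^sup>+\<omega>. m'.unchanged (n + Suc j) \<omega> * (?s \<omega> * r (?h \<omega>)) \<partial>M') =
    (\<integral>\<^sup>+\<omega>. m'.unchanged (n + j) \<omega> * (ennreal (1 - Pi_t \<pi> X' (Suc (n + j)) \<omega>) * R (m'.past (n + j) \<omega>)) \<partial>M')"
    using m'.nn_integral_transition(1)[OF R] by (simp add: Rh)
  also have "\<dots> = (\<integral>\<^sup>+\<omega>. m'.unchanged (n + j) \<omega> * (?s \<omega> * (r (?h \<omega>) * q (?h \<omega>))) \<partial>M')"
  proof (rule nn_integral_cong)
    fix \<omega> assume \<omega>: "\<omega> \<in> space M'"
    have mp: "map (\<lambda>s. fst (?h \<omega> s)) [1..<Suc n] = map (\<lambda>s. X' s \<omega>) [1..<Suc n]"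
      by (rule map_cong) (auto simp: hist_def)
    have "ennreal (1 - Pi_t \<pi> X' (Suc (n + j)) \<omega>) * ?s \<omega> =
      q (?h \<omega>) * ?s \<omega>"
      using Pi_after_switch[OF \<omega>, of n j] unfolding q_def mp
      by (cases "?s \<omega> = 0") (auto simp del: upt_Suc)
    then have "ennreal (1 - Pi_t \<pi> X' (Suc (n + j)) \<omega>) * ?s \<omega> * r (?h \<omega>) =
      q (?h \<omega>) * ?s \<omega> * r (?h \<omega>)" by (simp only:)
    then show "m'.unchanged (n + j) \<omega> * (ennreal (1 - Pi_t \<pi> X' (Suc (n + j)) \<omega>) * R (m'.past (n + j) \<omega>)) =
      m'.unchanged (n + j) \<omega> * (?s \<omega> * (r (?h \<omega>) * q (?h \<omega>)))"
      unfolding Rh by (simp only: mult_ac)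
  qed
  also have "\<dots> = (\<integral>\<^sup>+\<omega>. m'.unchanged n \<omega> * (?s \<omega> *
      (r (?h \<omega>) * q (?h \<omega>) * survival j (map (\<lambda>s. fst (?h \<omega> s)) [1..<Suc n]))) \<partial>M')"
    by (rule Suc.IH) (intro borel_measurable_times_ennreal Suc.prems q)
  also have "\<dots> = (\<integral>\<^sup>+\<omega>. m'.unchanged n \<omega> * (?s \<omega> *
      (r (?h \<omega>) * survival (Suc j) (map (\<lambda>s. fst (?h \<omega> s)) [1..<Suc n]))) \<partial>M')"
    by (simp only: survival_Suc q_def mult_ac)
  finally show ?case .
qed

lemma suminf_survival_le:
  assumes z: "z \<in> lists {1..K}" shows "(\<Sum>j. survival j z) \<le> lambda_tilde K \<pi> \<Xi>"
proof -
  have bp: "z @ block_prefix \<Xi> i \<in> lists {1..K}" for i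
    using z block_nth_in[OF block] by (auto simp: block_prefix_def)
  have "(\<Sum>j. survival j z) = (\<Sum>j. survival (j + 1) z) + (\<Sum>j<1. survival j z)"
    by (rule suminf_offset) simp
  also have "\<dots> = 1 + (\<Sum>t. ennreal (\<Prod>s=1..Suc t. 1 - \<pi> (z @ block_prefix \<Xi> s)))"
    unfolding survival_def using m.pi_range[OF bp]
    by (subst prod_ennreal) (auto simp: add.commute less_imp_le)
  also have "\<dots> \<le> lambda_tilde K \<pi> \<Xi>"
    unfolding lambda_tilde_def using z by (rule SUP_upper)
  finally show ?thesis .
qed

text \<open>The expectation is the sum over \<open>t\<close> of the probabilities of \<Theta> > t.
  Each is split into no stop up to \<open>t\<close> and a first stop at some
  \<open>n \<le> t\<close>; with \<open>t = n + j\<close> the second part sums over \<open>j\<close>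
  to at most \<open>lambda_tilde\<close> for each stop. The weights that are left concern times up
  to the stop and can be computed under the original rule.\<close>

lemma expect_change_point_switched:
  "expect_enat M' (change_point L') \<le>
     (\<Sum>t. \<integral>\<^sup>+\<omega>. m.unchanged t \<omega> * running K A (Suc t) (m.past t \<omega>) \<partial>M) +
     lambda_tilde K \<pi> \<Xi> * (\<Sum>t. \<integral>\<^sup>+\<omega>. m.unchanged t \<omega> * stopping K A t (m.past t \<omega>) \<partial>M)"
proof -
  let ?R = "\<lambda>t \<omega>. m.unchanged t \<omega> * running K A (Suc t) (m.past t \<omega>)"
  let ?R' = "\<lambda>t \<omega>. m'.unchanged t \<omega> * running K A (Suc t) (m'.past t \<omega>)"
  let ?S = "\<lambda>n \<omega>. m.unchanged n \<omega> * stopping K A n (m.past n \<omega>)"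
  let ?S' = "\<lambda>t n \<omega>. m'.unchanged t \<omega> * stopping K A n (m'.past n \<omega>)"
  let ?lt = "lambda_tilde K \<pi> \<Xi>"
  have unch: "m'.unchanged t \<omega> = indicator {\<omega> \<in> space M'. enat t < change_point L' \<omega>} \<omega>" if "\<omega> \<in> space M'" for t \<omega>
    using that m'.change_point_le_iff[OF that, of t] by (auto simp: m'.unchanged_def indicator_def not_le[symmetric])
  have setsM: "{\<omega> \<in> space M'. enat t < change_point L' \<omega>} \<in> sets M'" for t
  proof -
    have "{\<omega> \<in> space M'. enat t < change_point L' \<omega>} = {\<omega> \<in> space M'. \<not> L' t \<omega>}"
      using m'.change_point_le_iff[of _ t] by (auto simp: not_le[symmetric])
    then show ?thesis by simp
  qed
  have "expect_enat M' (change_point L') = (\<Sum>t. emeasure M' {\<omega> \<in> space M'. enat t < change_point L' \<omega>})"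
    unfolding expect_enat_def by (rule nn_integral_enat_function[OF m'.measurable_change_point])
  also have "\<dots> = (\<Sum>t. \<integral>\<^sup>+\<omega>. m'.unchanged t \<omega> \<partial>M')"
    by (rule suminf_cong, subst nn_integral_indicator[symmetric, OF setsM], rule nn_integral_cong) (simp add: unch)
  also have "\<dots> \<le> (\<Sum>t. (\<integral>\<^sup>+\<omega>. ?R' t \<omega> \<partial>M') +
      (\<Sum>n\<le>t. \<integral>\<^sup>+\<omega>. ?S' t n \<omega> \<partial>M'))"
  proof (rule suminf_le)
    fix t
    have mr: "(\<lambda>\<omega>. ?R' t \<omega>) \<in> borel_measurable M'"
      by (intro borel_measurable_times_ennreal m'.measurable_unchanged measurable_compose[OF m'.measurable_hist measurable_running[OF A]]) simp
    have ms: "(\<lambda>\<omega>. ?S' t n \<omega>) \<in> borel_measurable M'" for n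
      by (intro borel_measurable_times_ennreal m'.measurable_unchanged measurable_compose[OF m'.measurable_hist measurable_stopping[OF A]]) simp
    have "(\<integral>\<^sup>+\<omega>. m'.unchanged t \<omega> \<partial>M') \<le> (\<integral>\<^sup>+\<omega>. ?R' t \<omega> +
      (\<Sum>n\<le>t. ?S' t n \<omega>) \<partial>M')"
    proof (rule nn_integral_mono)
      fix \<omega> assume \<omega>: "\<omega> \<in> space M'"
      have "stopping K A n (m'.past t \<omega>) = stopping K A n (m'.past n \<omega>)" if "n \<le> t" for n
        using that by (auto simp: stopping_def running_def m'.clip_hist[OF \<omega>])
      then have "(\<Sum>n\<le>t. stopping K A n (m'.past t \<omega>)) = (\<Sum>n\<le>t. stopping K A n (m'.past n \<omega>))"
        by (intro sum.cong) auto
      with mult_left_mono[OF running_partition[of K A t "m'.past t \<omega>"], of "m'.unchanged t \<omega>"]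
      show "m'.unchanged t \<omega> \<le> ?R' t \<omega> +
        (\<Sum>n\<le>t. ?S' t n \<omega>)"
        by (simp add: distrib_left sum_distrib_left)
    qed
    also have "\<dots> = (\<integral>\<^sup>+\<omega>. ?R' t \<omega> \<partial>M') +
      (\<Sum>n\<le>t. \<integral>\<^sup>+\<omega>. ?S' t n \<omega> \<partial>M')"
      using mr ms by (simp add: nn_integral_add nn_integral_sum)
    finally show "(\<integral>\<^sup>+\<omega>. m'.unchanged t \<omega> \<partial>M') \<le> (\<integral>\<^sup>+\<omega>. ?R' t \<omega> \<partial>M') +
      (\<Sum>n\<le>t. \<integral>\<^sup>+\<omega>. ?S' t n \<omega> \<partial>M')" .
  qed auto
  also have "\<dots> = (\<Sum>t. \<integral>\<^sup>+\<omega>. ?R' t \<omega> \<partial>M') +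
      (\<Sum>n. \<Sum>j. \<integral>\<^sup>+\<omega>. ?S' (n + j) n \<omega> \<partial>M')"
    by (subst suminf_add[symmetric]) (auto simp: suminf_triangle_ennreal)
  also have "\<dots> \<le> (\<Sum>t. \<integral>\<^sup>+\<omega>. ?R t \<omega> \<partial>M) +
     (\<Sum>n. ?lt * (\<integral>\<^sup>+\<omega>. ?S n \<omega> \<partial>M))"
  proof (rule add_mono)
    show "(\<Sum>t. \<integral>\<^sup>+\<omega>. ?R' t \<omega> \<partial>M') \<le>
      (\<Sum>t. \<integral>\<^sup>+\<omega>. ?R t \<omega> \<partial>M)"
    proof (rule eq_refl, rule suminf_cong)
      fix t
      have e: "running K A t v * running K A (Suc t) v = running K A (Suc t) v" for v
        by (auto simp: running_def)
      show "(\<integral>\<^sup>+\<omega>. ?R' t \<omega> \<partial>M') =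
        (\<integral>\<^sup>+\<omega>. ?R t \<omega> \<partial>M)"
        using law_before_switch[OF measurable_running[OF A, of "Suc t" t K]] by (simp add: e)
    qed
    show "(\<Sum>n. \<Sum>j. \<integral>\<^sup>+\<omega>. ?S' (n + j) n \<omega> \<partial>M') \<le>
      (\<Sum>n. ?lt * (\<integral>\<^sup>+\<omega>. ?S n \<omega> \<partial>M))"
    proof (rule suminf_le)
      fix n
      have e: "running K A n v * stopping K A n v = stopping K A n v" for v
        by (auto simp: running_def stopping_def)
      let ?z = "\<lambda>\<omega>. map (\<lambda>s. fst (m'.past n \<omega> s)) [1..<Suc n]"
      have zm: "(\<lambda>\<omega>. survival j (?z \<omega>)) \<in> borel_measurable M'" for j
      proof -
        have "(\<lambda>v. map (\<lambda>s. fst (v s)) [1..<Suc n]) \<in> (hist_space n :: (nat \<Rightarrow> nat \<times> 'y) measure) \<rightarrow>\<^sub>M count_space UNIV"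
          by (rule measurable_map_list_count_space, rule measurable_fst_component) auto
        from measurable_compose[OF measurable_compose[OF m'.measurable_hist this], of "survival j" borel]
        show ?thesis by simp
      qed
      have us: "(\<lambda>\<omega>. ?S' n n \<omega>) \<in> borel_measurable M'"
        by (intro borel_measurable_times_ennreal m'.measurable_unchanged measurable_compose[OF m'.measurable_hist measurable_stopping[OF A]]) simp
      have "(\<Sum>j. \<integral>\<^sup>+\<omega>. ?S' (n + j) n \<omega> \<partial>M') =
        (\<Sum>j. \<integral>\<^sup>+\<omega>. ?S' n n \<omega> * survival j (?z \<omega>) \<partial>M')"
      proof (rule suminf_cong)
        fix j
        show "(\<integral>\<^sup>+\<omega>. ?S' (n + j) n \<omega> \<partial>M') =
          (\<integral>\<^sup>+\<omega>. ?S' n n \<omega> * survival j (?z \<omega>) \<partial>M')"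
          using survival_after_switch[of "\<lambda>_. 1" n j] by (simp add: mult.assoc del: upt_Suc)
      qed
      also have "\<dots> = (\<integral>\<^sup>+\<omega>. (\<Sum>j. ?S' n n \<omega> * survival j (?z \<omega>)) \<partial>M')"
        by (rule nn_integral_suminf[symmetric]) (intro borel_measurable_times_ennreal[OF us zm])
      also have "\<dots> \<le> (\<integral>\<^sup>+\<omega>. ?S' n n \<omega> * ?lt \<partial>M')"
      proof (rule nn_integral_mono)
        fix \<omega> assume \<omega>: "\<omega> \<in> space M'"
        have "?z \<omega> = map (\<lambda>s. X' s \<omega>) [1..<Suc n]" by (rule map_cong) (auto simp: hist_def)
        then have "?z \<omega> \<in> lists {1..K}" using m'.X_list_in[OF \<omega>, of n] by (simp only:)
        from mult_left_mono[OF suminf_survival_le[OF this], of "?S' n n \<omega>"]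
        show "(\<Sum>j. ?S' n n \<omega> * survival j (?z \<omega>)) \<le>
          ?S' n n \<omega> * ?lt"
          by (simp only: ennreal_suminf_cmult) simp
      qed
      also have "\<dots> = ?lt * (\<integral>\<^sup>+\<omega>. ?S' n n \<omega> \<partial>M')"
        by (rule trans[OF nn_integral_multc[OF us] mult.commute])
      also have "(\<integral>\<^sup>+\<omega>. ?S' n n \<omega> \<partial>M') =
        (\<integral>\<^sup>+\<omega>. ?S n \<omega> \<partial>M)"
        using law_before_switch[OF measurable_stopping[OF A order_refl, of K n]] by (simp add: e)
      finally show "(\<Sum>j. \<integral>\<^sup>+\<omega>. ?S' (n + j) n \<omega> \<partial>M') \<le>
        ?lt * (\<integral>\<^sup>+\<omega>. ?S n \<omega> \<partial>M)" .
    qed auto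
  qed
  finally show ?thesis by simp
qed

end

section \<open>Splitting the expected stopping time\<close>

context ruled_change_point_model
begin

text \<open>The sums of the switching bound are identified: the first is the expectation of
  \<open>min T \<Theta>\<close>, the second the false-alarm probability. The first claim holds
  pointwise, since \<open>min T \<Theta>\<close> plus \<open>N\<close> is at most \<open>T\<close>
  once \<open>\<Theta> + N \<le> T\<close>. The third covers the space by false alarms, stops in the
  window and late stops; sums on the right avoid the truncated subtraction of
  \<open>ennreal\<close>.\<close>

lemma expect_stopping_time_ge:
  assumes A: "\<And>s. A s \<in> sets (hist_space s)"
    and TA: "\<And>s \<omega>. \<omega> \<in> space M \<Longrightarrow> T \<omega> \<le> enat s \<longleftrightarrow> past s \<omega> \<in> A s"
  shows "(\<Sum>t. \<integral>\<^sup>+\<omega>. unchanged t \<omega> * running K A (Suc t) (past t \<omega>) \<partial>M) +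
      of_nat N * emeasure M {\<omega> \<in> space M. change_point L \<omega> + enat N \<le> T \<omega>} \<le> expect_enat M T" (is "?S + _ \<le> _")
    and "(\<Sum>t. \<integral>\<^sup>+\<omega>. unchanged t \<omega> * stopping K A t (past t \<omega>) \<partial>M) =
      emeasure M {\<omega> \<in> space M. T \<omega> < change_point L \<omega>}"
    and "of_nat N \<le> of_nat N * emeasure M {\<omega> \<in> space M. change_point L \<omega> + enat N \<le> T \<omega>} +
      of_nat N * (emeasure M {\<omega> \<in> space M. T \<omega> < change_point L \<omega>} +
        emeasure M {\<omega> \<in> space M. change_point L \<omega> \<le> T \<omega> \<and> T \<omega> < change_point L \<omega> + enat N})"
proof -
  note mT = measurable_T[OF A TA]
  have mm: "(\<lambda>\<omega>. min (T \<omega>) (change_point L \<omega>)) \<in> M \<rightarrow>\<^sub>M count_space UNIV"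
    by (rule measurable_compose_countable[OF _ mT], rule measurable_compose[OF measurable_change_point]) simp
  have PS: "{\<omega> \<in> space M. P (T \<omega>) (change_point L \<omega>)} \<in> sets M" for P
    by (rule sets_T_change_point[OF A TA])
  have eqr: "(\<integral>\<^sup>+\<omega>. unchanged t \<omega> * running K A (Suc t) (past t \<omega>) \<partial>M) =
    emeasure M {\<omega> \<in> space M. enat t < min (T \<omega>) (change_point L \<omega>)}" for t
  proof -
    have "unchanged t \<omega> * running K A (Suc t) (past t \<omega>) = indicator {\<omega> \<in> space M. enat t < min (T \<omega>) (change_point L \<omega>)} \<omega>"
      if \<omega>: "\<omega> \<in> space M" for \<omega>
    proof -
      have "(\<forall>s<Suc t. clip K s (past t \<omega>) \<notin> A s) \<longleftrightarrow> (\<forall>s\<le>t. \<not> T \<omega> \<le> enat s)"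
        using clip_hist[OF \<omega>, of _ t] TA[OF \<omega>] by (auto simp: less_Suc_eq_le)
      also have "\<dots> \<longleftrightarrow> enat t < T \<omega>"
        by (auto simp: not_le) (meson enat_ord_simps(1) le_less_trans)
      finally have eqv: "(\<forall>s<Suc t. clip K s (past t \<omega>) \<notin> A s) \<longleftrightarrow> enat t < T \<omega>" .
      have cp: "enat t < change_point L \<omega> \<longleftrightarrow> \<not> L t \<omega>"
        using change_point_le_iff[OF \<omega>, of t] by (metis not_le)
      show ?thesis
        using \<omega> unfolding unchanged_def running_def eqv by (simp add: indicator_def cp)
    qed
    then show ?thesis
      by (subst nn_integral_indicator[symmetric, OF PS[of "\<lambda>a b. enat t < min a b"]]) (rule nn_integral_cong)
  qed
  have "?S = (\<integral>\<^sup>+\<omega>. ennreal_of_enat (min (T \<omega>) (change_point L \<omega>)) \<partial>M)"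
    unfolding eqr by (rule nn_integral_enat_function[OF mm, symmetric])
  moreover have "of_nat N * emeasure M {\<omega> \<in> space M. change_point L \<omega> + enat N \<le> T \<omega>} =
    (\<integral>\<^sup>+\<omega>. of_nat N * indicator {\<omega> \<in> space M. change_point L \<omega> + enat N \<le> T \<omega>} \<omega> \<partial>M)"
    by (rule nn_integral_cmult_indicator[symmetric, OF PS[of "\<lambda>a b. b + enat N \<le> a"]])
  ultimately have "?S + of_nat N * emeasure M {\<omega> \<in> space M. change_point L \<omega> + enat N \<le> T \<omega>} =
    (\<integral>\<^sup>+\<omega>. ennreal_of_enat (min (T \<omega>) (change_point L \<omega>)) + of_nat N * indicator {\<omega> \<in> space M. change_point L \<omega> + enat N \<le> T \<omega>} \<omega> \<partial>M)"
    using measurable_compose[OF mm, of ennreal_of_enat borel] PS[of "\<lambda>a b. b + enat N \<le> a"]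
    by (subst nn_integral_add) (auto intro!: borel_measurable_times_ennreal borel_measurable_indicator)
  also have "\<dots> \<le> (\<integral>\<^sup>+\<omega>. ennreal_of_enat (T \<omega>) \<partial>M)"
  proof (rule nn_integral_mono)
    fix \<omega> assume "\<omega> \<in> space M"
    show "ennreal_of_enat (min (T \<omega>) (change_point L \<omega>)) + of_nat N * indicator {\<omega> \<in> space M. change_point L \<omega> + enat N \<le> T \<omega>} \<omega>
      \<le> ennreal_of_enat (T \<omega>)"
      by (cases "T \<omega>"; cases "change_point L \<omega>")
         (auto simp: indicator_def min_def of_nat_add[symmetric] simp del: of_nat_add)
  qed
  finally show "?S + of_nat N * emeasure M {\<omega> \<in> space M. change_point L \<omega> + enat N \<le> T \<omega>} \<le> expect_enat M T"
    by (simp add: expect_enat_def)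
  have "(\<integral>\<^sup>+\<omega>. unchanged t \<omega> * stopping K A t (past t \<omega>) \<partial>M) =
    emeasure M {\<omega> \<in> space M. T \<omega> = enat t \<and> \<not> L t \<omega>}" for t
  proof -
    have "unchanged t \<omega> * stopping K A t (past t \<omega>) = indicator {\<omega> \<in> space M. T \<omega> = enat t \<and> \<not> L t \<omega>} \<omega>"
      if \<omega>: "\<omega> \<in> space M" for \<omega>
    proof -
      have "(\<forall>s<t. clip K s (past t \<omega>) \<notin> A s) \<longleftrightarrow> (\<forall>s<t. \<not> T \<omega> \<le> enat s)"
        "clip K t (past t \<omega>) \<in> A t \<longleftrightarrow> T \<omega> \<le> enat t"
        using clip_hist[OF \<omega>, of _ t] TA[OF \<omega>] by auto
      then show ?thesis
        using \<omega> by (auto simp: unchanged_def running_def stopping_def enat_eq_iff_le)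
    qed
    then have "(\<integral>\<^sup>+\<omega>. unchanged t \<omega> * stopping K A t (past t \<omega>) \<partial>M) =
      (\<integral>\<^sup>+\<omega>. indicator {\<omega> \<in> space M. T \<omega> = enat t \<and> \<not> L t \<omega>} \<omega> \<partial>M)" by (rule nn_integral_cong)
    also have "\<dots> = emeasure M {\<omega> \<in> space M. T \<omega> = enat t \<and> \<not> L t \<omega>}"
      by (rule nn_integral_indicator[OF sets_false_alarm[OF A TA]])
    finally show ?thesis .
  qed
  then show "(\<Sum>t. \<integral>\<^sup>+\<omega>. unchanged t \<omega> * stopping K A t (past t \<omega>) \<partial>M) =
      emeasure M {\<omega> \<in> space M. T \<omega> < change_point L \<omega>}"
    using emeasure_false_alarm[OF A TA] by simp
  let ?a = "{\<omega> \<in> space M. change_point L \<omega> + enat N \<le> T \<omega>}"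
  let ?b = "{\<omega> \<in> space M. T \<omega> < change_point L \<omega>}"
  let ?c = "{\<omega> \<in> space M. change_point L \<omega> \<le> T \<omega> \<and> T \<omega> < change_point L \<omega> + enat N}"
  have abc: "?a \<in> sets M" "?b \<in> sets M" "?c \<in> sets M"
    by (rule PS[of "\<lambda>a b. b + enat N \<le> a"], rule PS[of "\<lambda>a b. a < b"], rule PS[of "\<lambda>a b. b \<le> a \<and> a < b + enat N"])
  have "1 = emeasure M (?a \<union> (?b \<union> ?c))"
    by (subst emeasure_space_1[symmetric], rule arg_cong[where f="emeasure M"]) (auto simp: not_le)
  also have "\<dots> \<le> emeasure M ?a + emeasure M (?b \<union> ?c)"
    by (intro emeasure_subadditive abc sets.Un)
  also have "\<dots> \<le> emeasure M ?a + (emeasure M ?b + emeasure M ?c)"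
    by (intro add_left_mono emeasure_subadditive abc)
  finally have "of_nat N * 1 \<le> of_nat N * (emeasure M ?a + (emeasure M ?b + emeasure M ?c))"
    by (intro mult_left_mono) auto
  then show "of_nat N \<le> of_nat N * emeasure M ?a + of_nat N * (emeasure M ?b + emeasure M ?c)"
    by (simp add: distrib_left)
qed

text \<open>For \<open>k = 0\<close> the weight is an odds ratio with denominator at least
  \<open>c\<close>; for \<open>k > 0\<close> it is a probability, and
  \<open>c \<le> 1\<close>.\<close>

lemma prior_odds_le:
  assumes c: "0 < c" "\<And>z. z \<in> lists {1..K} \<Longrightarrow> \<pi> z \<le> 1 - c"
    and \<omega>: "\<omega> \<in> space M" and "k \<le> t"
  shows "prior_odds k (past t \<omega>) \<le> ennreal (1 / c)"
proof (cases "k = 0")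
  case True
  have p: "0 \<le> \<pi> []" "\<pi> [] < 1" "\<pi> [] \<le> 1 - c" using pi_range[of "[]"] c(2)[of "[]"] by auto
  then have "\<pi> [] / (1 - \<pi> []) \<le> 1 / c"
    using c(1) by (intro frac_le) auto
  then show ?thesis using True by (simp add: prior_odds_def ennreal_leI)
next
  case False
  have "map (\<lambda>r. fst (past t \<omega> r)) [1..<Suc k] = map (\<lambda>s. X s \<omega>) [1..<Suc k]"
    using assms(4) by (intro map_cong) (auto simp: hist_def)
  then have "prior_odds k (past t \<omega>) = ennreal (Pi_t \<pi> X k \<omega>)"
    using False unfolding prior_odds_def Pi_t_def by (simp only: if_False)
  also have "Pi_t \<pi> X k \<omega> \<le> 1 - c"
    unfolding Pi_t_def by (rule c(2)[OF X_list_in[OF \<omega>]])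
  then have "Pi_t \<pi> X k \<omega> \<le> 1 / c" "c \<le> 1"
  proof -
    have "0 \<le> \<pi> []" "\<pi> [] \<le> 1 - c" using pi_range[of "[]"] c(2)[of "[]"] by auto
    then show "c \<le> 1" by simp
    then have "1 \<le> 1 / c" using c(1) by simp
    then show "Pi_t \<pi> X k \<omega> \<le> 1 / c" using \<open>Pi_t \<pi> X k \<omega> \<le> 1 - c\<close> c(1) by linarith
  qed
  then have "ennreal (Pi_t \<pi> X k \<omega>) \<le> ennreal (1 / c)" by (intro ennreal_leI)
  finally show ?thesis .
qed

end

text \<open>Switching at time 0 plays the block from the start. The purpose is finiteness of
  \<open>lambda_star\<close>, without which the final quotient cannot be simplified.\<close>

lemma lambda_star_le_lambda_tilde:
  fixes M :: "'y::polish_space rule \<Rightarrow> 'w measure"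
  assumes model: "\<And>\<phi>. assignment_rule K \<phi> \<Longrightarrow> ruled_change_point_model (M \<phi>) \<mu> f g \<pi> \<phi> (L \<phi>) (X \<phi>) (Y \<phi>) K"
    and K: "1 \<le> K" and block: "is_block K \<Xi>"
  shows "lambda_star K M L \<le> lambda_tilde K \<pi> \<Xi>"
proof -
  define \<phi> :: "'y rule" where "\<phi> = (\<lambda>_ _. 1)"
  \<comment> \<open>Every history, the empty one included, triggers the stop, so the constant rule
    never acts.\<close>
  define A :: "nat \<Rightarrow> (nat \<Rightarrow> nat \<times> 'y) set" where "A s = space (hist_space s)" for s
  have rule: "assignment_rule K \<phi>" using K by (simp add: assignment_rule_def \<phi>_def)
  have A: "A s \<in> sets (hist_space s)" for s by (simp add: A_def)
  have rule': "assignment_rule K (switch K A \<Xi> \<phi>)" by (rule assignment_rule_switch[OF rule A block])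
  interpret m: ruled_change_point_model "M \<phi>" \<mu> f g \<pi> \<phi> "L \<phi>" "X \<phi>" "Y \<phi>" K by (rule model[OF rule])
  interpret s: switched_models "M \<phi>" \<mu> f g \<pi> \<phi> "L \<phi>" "X \<phi>" "Y \<phi>" K
    "M (switch K A \<Xi> \<phi>)" "L (switch K A \<Xi> \<phi>)" "X (switch K A \<Xi> \<phi>)" "Y (switch K A \<Xi> \<phi>)" A \<Xi>
    by (intro switched_models.intro switched_models_axioms.intro model rule rule' A block)
  have c0: "clip K 0 v \<in> A 0" for v by (simp add: A_def clip_def space_PiM restrict_def)
  have r: "running K A (Suc t) v = 0" for t v using c0[of v] by (auto simp: running_def)
  have st: "stopping K A t v = (if t = 0 then 1 else 0)" for t v
    using r c0 by (cases t) (auto simp: stopping_def running_def)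
  have "lambda_star K M L \<le> expect_enat (M (switch K A \<Xi> \<phi>)) (change_point (L (switch K A \<Xi> \<phi>)))"
    unfolding lambda_star_def using rule' by (intro INF_lower) simp
  also have "\<dots> \<le> lambda_tilde K \<pi> \<Xi> * (\<Sum>t. \<integral>\<^sup>+\<omega>. m.unchanged t \<omega> * stopping K A t (hist (X \<phi>) (Y \<phi>) t \<omega>) \<partial>M \<phi>)"
    using s.expect_change_point_switched by (simp add: r)
  also have "(\<Sum>t. \<integral>\<^sup>+\<omega>. m.unchanged t \<omega> * stopping K A t (hist (X \<phi>) (Y \<phi>) t \<omega>) \<partial>M \<phi>) = (\<integral>\<^sup>+\<omega>. m.unchanged 0 \<omega> \<partial>M \<phi>)"
    by (subst suminf_finite[of "{0}"]) (auto simp: st)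
  also have "\<dots> \<le> (\<integral>\<^sup>+\<omega>. 1 \<partial>M \<phi>)" by (rule nn_integral_mono) (simp add: m.unchanged_def)
  also have "\<dots> = 1" by (simp add: m.emeasure_space_1)
  finally show ?thesis by (simp add: mult_left_mono)
qed

text \<open>A bound for each procedure and each \<alpha>, before any limit. The term with
  \<open>lambda_tilde\<close> is the price of switching after a false alarm. The sum multiplied by
  \<open>N\<close> bounds the probability of stopping before \<Theta> + N: by a false alarm, with a
  small likelihood ratio, or with a large score.\<close>

lemma detection_lower_bound:
  fixes M :: "'y::polish_space rule \<Rightarrow> 'w measure"
  assumes model: "\<And>\<phi>. assignment_rule K \<phi> \<Longrightarrow> ruled_change_point_model (M \<phi>) \<mu> f g \<pi> \<phi> (L \<phi>) (X \<phi>) (Y \<phi>) K"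
    and block: "is_block K \<Xi>"
    and ac: "\<And>x. x \<in> {1..K} \<Longrightarrow> AE y in \<mu>. f x y = 0 \<longrightarrow> g x y = 0"
    and V: "0 \<le> V"
    and mom: "\<And>x z w. x \<in> {1..K} \<Longrightarrow>
      (\<integral>\<^sup>+y. ennreal (g x y) * ennreal ((z + w * (ln (g x y / f x y) - Iv x))\<^sup>2) \<partial>\<mu>) \<le> ennreal (z\<^sup>2 + w\<^sup>2 * V)"
    and Iv: "\<And>x. x \<in> {1..K} \<Longrightarrow> 0 \<le> Iv x"
    and c: "0 < c" "\<And>z. z \<in> lists {1..K} \<Longrightarrow> \<pi> z \<le> 1 - c"
    and b: "0 < b"
    and drift: "\<And>\<phi> t \<omega>. assignment_rule K \<phi> \<Longrightarrow> \<omega> \<in> space (M \<phi>) \<Longrightarrow>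
      (\<Sum>s=1..N. Iv (X \<phi> (t + s) \<omega>) + omega (Pi_t \<pi> (X \<phi>) (t + s) \<omega>)) \<le> a - b"
    and T: "(\<phi>, T) \<in> procedure_class K M L X Y \<alpha>"
  shows "lambda_star K M L + of_nat N \<le> expect_enat (M \<phi>) T + lambda_tilde K \<pi> \<Xi> * ennreal \<alpha> +
    of_nat N * ennreal (\<alpha> + real N * (exp a / c) * \<alpha> + V * real N / b\<^sup>2)"
proof -
  have rule: "assignment_rule K \<phi>"
    and stop: "enat_stopping_time (obs_filtration (M \<phi>) (X \<phi>) (Y \<phi>)) T"
    and fa: "measure (M \<phi>) {\<omega> \<in> space (M \<phi>). T \<omega> < change_point (L \<phi>) \<omega>} \<le> \<alpha>"
    using T by (auto simp: procedure_class_def)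
  interpret m: ruled_change_point_model "M \<phi>" \<mu> f g \<pi> \<phi> "L \<phi>" "X \<phi>" "Y \<phi>" K by (rule model[OF rule])
  obtain A where A: "\<And>s. A s \<in> sets (hist_space s)"
    and TA: "\<And>s \<omega>. \<omega> \<in> space (M \<phi>) \<Longrightarrow> T \<omega> \<le> enat s \<longleftrightarrow> hist (X \<phi>) (Y \<phi>) s \<omega> \<in> A s"
    using m.stopping_time_hist_events[OF stop] by blast
  have rule': "assignment_rule K (switch K A \<Xi> \<phi>)" by (rule assignment_rule_switch[OF rule A block])
  interpret s: switched_models "M \<phi>" \<mu> f g \<pi> \<phi> "L \<phi>" "X \<phi>" "Y \<phi>" K
    "M (switch K A \<Xi> \<phi>)" "L (switch K A \<Xi> \<phi>)" "X (switch K A \<Xi> \<phi>)" "Y (switch K A \<Xi> \<phi>)" A \<Xi>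
    by (intro switched_models.intro switched_models_axioms.intro model rule rule' A block)
  let ?S = "\<Sum>t. \<integral>\<^sup>+\<omega>. m.unchanged t \<omega> * running K A (Suc t) (hist (X \<phi>) (Y \<phi>) t \<omega>) \<partial>M \<phi>"
  define p where "p = emeasure (M \<phi>) {\<omega> \<in> space (M \<phi>). T \<omega> < change_point (L \<phi>) \<omega>}"
  define e where "e = emeasure (M \<phi>) {\<omega> \<in> space (M \<phi>). change_point (L \<phi>) \<omega> \<le> T \<omega> \<and> T \<omega> < change_point (L \<phi>) \<omega> + enat N}"
  define d where "d = emeasure (M \<phi>) {\<omega> \<in> space (M \<phi>). change_point (L \<phi>) \<omega> + enat N \<le> T \<omega>}"
  have p: "p \<le> ennreal \<alpha>" unfolding p_def m.emeasure_eq_measure using fa by (rule ennreal_leI)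
  have \<alpha>: "0 \<le> \<alpha>" using fa measure_nonneg order_trans by blast
  have fa_sum: "(\<Sum>t. \<integral>\<^sup>+\<omega>. m.unchanged t \<omega> * stopping K A t (hist (X \<phi>) (Y \<phi>) t \<omega>) \<partial>M \<phi>) = p"
    unfolding p_def by (rule m.expect_stopping_time_ge(2)[OF A TA])
  have "lambda_star K M L \<le> expect_enat (M (switch K A \<Xi> \<phi>)) (change_point (L (switch K A \<Xi> \<phi>)))"
    unfolding lambda_star_def using rule' by (intro INF_lower) simp
  also have "\<dots> \<le> ?S + lambda_tilde K \<pi> \<Xi> * p"
    using s.expect_change_point_switched by (simp only: fa_sum)
  also have "\<dots> \<le> ?S + lambda_tilde K \<pi> \<Xi> * ennreal \<alpha>"
    using p by (intro add_left_mono mult_left_mono) auto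
  finally have 1: "lambda_star K M L \<le> ?S + lambda_tilde K \<pi> \<Xi> * ennreal \<alpha>" .
  have sub: "(\<Sum>s\<in>{max 1 k..t}. Iv (X \<phi> s \<omega>) + omega (Pi_t \<pi> (X \<phi>) s \<omega>)) \<le> a - b"
    if \<omega>: "\<omega> \<in> space (M \<phi>)" and kt: "k \<le> t" "t < k + N" for \<omega> k t
  proof -
    let ?F = "\<lambda>s. Iv (X \<phi> s \<omega>) + omega (Pi_t \<pi> (X \<phi>) s \<omega>)"
    \<comment> \<open>The drift hypothesis covers windows of full length \<open>N\<close>, here the
      one beginning at \<open>u + 1\<close>. The possibly shorter window from \<open>max 1 k\<close>
      to \<open>t\<close> is extended to it by nonnegative terms.\<close>
    define u where "u = max 1 k - 1"
    have F0: "0 \<le> ?F s" if "s \<in> {u + 1..u + N}" for s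
      using Iv[OF m.X_in[OF \<omega>, of s s]] that by (simp add: omega_def)
    have "(\<Sum>s\<in>{max 1 k..t}. ?F s) \<le> (\<Sum>s\<in>{u + 1..u + N}. ?F s)"
      by (rule sum_mono2) (use kt F0 in \<open>auto simp: u_def\<close>)
    also have "\<dots> = (\<Sum>s=1..N. ?F (u + s))"
      using sum.shift_bounds_cl_nat_ivl[of ?F 1 u N] by (simp add: add.commute)
    also have "\<dots> \<le> a - b" by (rule drift[OF rule \<omega>])
    finally show ?thesis .
  qed
  have mom': "(\<integral>\<^sup>+y. ennreal (on_treatments K g x y) * ennreal ((z + w * m.score Iv x y)\<^sup>2) \<partial>\<mu>) \<le> ennreal (z\<^sup>2 + w\<^sup>2 * V)"
    if "x \<in> {1..K}" for x z w
    using mom[OF that, of z w] that by (simp add: m.score_def[OF A TA] on_treatments_def)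
  have "e \<le> of_nat N * (ennreal (1 / c) * ennreal (exp a)) * p + ennreal (V * real N / b\<^sup>2)"
    unfolding e_def p_def
    by (rule m.emeasure_early_detection[OF A TA ac m.prior_odds_le[OF c] V mom' b sub])
  also have "\<dots> \<le> of_nat N * (ennreal (1 / c) * ennreal (exp a)) * ennreal \<alpha> + ennreal (V * real N / b\<^sup>2)"
    using p by (intro add_right_mono mult_left_mono) auto
  also have "\<dots> = ennreal (real N * (exp a / c) * \<alpha> + V * real N / b\<^sup>2)"
    using c(1) V \<alpha> by (simp add: ennreal_of_nat_eq_real_of_nat ennreal_mult'[symmetric] ennreal_plus[symmetric] del: ennreal_plus)
  finally have "p + e \<le> ennreal \<alpha> + ennreal (real N * (exp a / c) * \<alpha> + V * real N / b\<^sup>2)"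
    using p by (rule add_mono[rotated])
  also have "\<dots> = ennreal (\<alpha> + real N * (exp a / c) * \<alpha> + V * real N / b\<^sup>2)"
    using c(1) V \<alpha> by (simp add: ennreal_plus[symmetric] add.assoc del: ennreal_plus)
  finally have pe: "p + e \<le> ennreal (\<alpha> + real N * (exp a / c) * \<alpha> + V * real N / b\<^sup>2)" .
  have "lambda_star K M L + of_nat N \<le> (?S + lambda_tilde K \<pi> \<Xi> * ennreal \<alpha>) + (of_nat N * d + of_nat N * (p + e))"
    using m.expect_stopping_time_ge(3)[OF A TA, of N] unfolding p_def e_def d_def by (intro add_mono 1)
  also have "\<dots> = (?S + of_nat N * d) + lambda_tilde K \<pi> \<Xi> * ennreal \<alpha> + of_nat N * (p + e)"
    by (simp only: ac_simps)
  also have "\<dots> \<le> expect_enat (M \<phi>) T + lambda_tilde K \<pi> \<Xi> * ennreal \<alpha> +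
    of_nat N * ennreal (\<alpha> + real N * (exp a / c) * \<alpha> + V * real N / b\<^sup>2)"
    using m.expect_stopping_time_ge(1)[OF A TA, of N] pe unfolding d_def by (intro add_mono mult_left_mono) auto
  finally show ?thesis .
qed

section \<open>Asymptotics\<close>

text \<open>This is the error probability of \<open>detection_lower_bound\<close> with \<alpha> =
  exp (- l), \<open>N\<close> replaced by its bound \<open>l / D0\<close>, and
  \<open>b = \<epsilon> / 8 * l\<close>, whose square produces the 64.\<close>

lemma eventually_error_small:
  fixes \<epsilon> c D0 V :: real
  assumes "0 < \<epsilon>" "0 < c" "0 < D0"
  shows "\<forall>\<^sub>F l in at_top. exp (- l) + l / D0 * (1 / c) * exp (- (\<epsilon> / 8 * l)) + 64 * V / (D0 * \<epsilon>\<^sup>2 * l) \<le> \<epsilon>"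
proof -
  have 1: "((\<lambda>l::real. exp (- l)) \<longlongrightarrow> 0) at_top" by real_asymp
  have 2: "((\<lambda>l::real. l * exp (- (k * l))) \<longlongrightarrow> 0) at_top" if "0 < k" for k
    using that by real_asymp
  have 3: "((\<lambda>l::real. 1 / l) \<longlongrightarrow> 0) at_top" by real_asymp
  have "((\<lambda>l. exp (- l) + 1 / (D0 * c) * (l * exp (- (\<epsilon> / 8 * l))) + 64 * V / (D0 * \<epsilon>\<^sup>2) * (1 / l)) \<longlongrightarrow>
      0 + 1 / (D0 * c) * 0 + 64 * V / (D0 * \<epsilon>\<^sup>2) * 0) at_top"
    using assms by (intro tendsto_add tendsto_mult tendsto_const 1 2 3) auto
  then have "((\<lambda>l. exp (- l) + l / D0 * (1 / c) * exp (- (\<epsilon> / 8 * l)) + 64 * V / (D0 * \<epsilon>\<^sup>2 * l)) \<longlongrightarrow> 0) at_top"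
    by simp
  from order_tendstoD(2)[OF this assms(1)] show ?thesis by eventually_elim simp
qed

lemma filterlim_abs_ln_at_right_0: "filterlim (\<lambda>\<alpha>::real. \<bar>ln \<alpha>\<bar>) at_top (at_right 0)"
  by real_asymp

text \<open>The 4 arises as follows: the window loses \<open>2 * \<epsilon>\<close>, half by its
  definition and half by rounding, and the error probability \<open>\<delta>\<close> and the
  switching cost \<open>q\<close> lose \<epsilon> each. The product of two losses leaves a surplus
  of \<open>2 * \<epsilon>\<^sup>2 * r\<close>.\<close>

lemma lower_bound_algebra:
  fixes lam E q :: ennreal
  assumes lam: "lam < \<infinity>" and r: "0 \<le> r" and \<epsilon>: "0 < \<epsilon>" "\<epsilon> < 1"
    and bound: "lam + of_nat N \<le> E + q + of_nat N * ennreal \<delta>"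
    and q: "q \<le> ennreal \<epsilon> * (lam + ennreal r)" and \<delta>: "0 \<le> \<delta>" "\<delta> \<le> \<epsilon>"
    and N: "(1 - 2 * \<epsilon>) * r \<le> real N"
  shows "ennreal (1 - 4 * \<epsilon>) * (lam + ennreal r) \<le> E"
proof (cases "E = \<infinity> \<or> 1 - 4 * \<epsilon> \<le> 0")
  case True
  then show ?thesis by (auto simp: ennreal_neg)
next
  case False
  then obtain e where e: "E = ennreal e" "0 \<le> e" by (cases E) auto
  obtain m where m: "lam = ennreal m" "0 \<le> m" using lam by (cases lam) auto
  have "lam + of_nat N \<le> E + ennreal \<epsilon> * (lam + ennreal r) + of_nat N * ennreal \<epsilon>"
    using bound q \<delta> by (meson add_mono ennreal_leI mult_left_mono order_refl order_trans zero_le)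
  then have "ennreal (m + real N) \<le> ennreal (e + \<epsilon> * (m + r) + real N * \<epsilon>)"
    using e m r \<epsilon> by (simp add: ennreal_of_nat_eq_real_of_nat ennreal_mult'[symmetric] ennreal_plus[symmetric] del: ennreal_plus)
  then have "m + real N \<le> e + \<epsilon> * (m + r) + real N * \<epsilon>"
    using e m r \<epsilon> by (subst (asm) ennreal_le_iff) auto
  then have "(1 - \<epsilon>) * m + (1 - \<epsilon>) * real N - \<epsilon> * r \<le> e" by (simp add: algebra_simps)
  moreover have "(1 - \<epsilon>) * ((1 - 2 * \<epsilon>) * r) \<le> (1 - \<epsilon>) * real N" using N \<epsilon> by (intro mult_left_mono) auto
  moreover have "(1 - 4 * \<epsilon>) * m \<le> (1 - \<epsilon>) * m" using m \<epsilon> by (intro mult_right_mono) auto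
  moreover have "(1 - 4 * \<epsilon>) * r \<le> (1 - \<epsilon>) * ((1 - 2 * \<epsilon>) * r) - \<epsilon> * r"
  proof -
    have "(1 - \<epsilon>) * ((1 - 2 * \<epsilon>) * r) - \<epsilon> * r - (1 - 4 * \<epsilon>) * r = 2 * \<epsilon>\<^sup>2 * r"
      by (simp add: power2_eq_square algebra_simps)
    moreover have "0 \<le> 2 * \<epsilon>\<^sup>2 * r" using r by simp
    ultimately show ?thesis by linarith
  qed
  ultimately have "(1 - 4 * \<epsilon>) * m + (1 - 4 * \<epsilon>) * r \<le> e" by linarith
  then have "(1 - 4 * \<epsilon>) * (m + r) \<le> e" by (simp add: algebra_simps)
  then show ?thesis
    using e m r False by (simp add: ennreal_mult'[symmetric] ennreal_plus[symmetric] ennreal_leI del: ennreal_plus)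
qed

theorem theorem6p1:
  fixes K :: nat
    and \<mu> :: "'y::polish_space measure"
    and f g :: "nat \<Rightarrow> 'y \<Rightarrow> real"
    and \<pi> :: "real \<Rightarrow> nat list \<Rightarrow> real"
    and M :: "real \<Rightarrow> 'y rule \<Rightarrow> 'w measure"
    and L :: "real \<Rightarrow> 'y rule \<Rightarrow> nat \<Rightarrow> 'w \<Rightarrow> bool"
    and X :: "real \<Rightarrow> 'y rule \<Rightarrow> nat \<Rightarrow> 'w \<Rightarrow> nat"
    and Y :: "real \<Rightarrow> 'y rule \<Rightarrow> nat \<Rightarrow> 'w \<Rightarrow> 'y"
    and D :: "real \<Rightarrow> real"
  assumes K: "2 \<le> K"
    and mu: "sigma_finite_measure \<mu>" "sets \<mu> = sets borel"
    and densities: "\<And>x. x \<in> {1..K} \<Longrightarrow> is_density \<mu> (f x) \<and> is_density \<mu> (g x)"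
    and pi_range: "\<And>\<alpha> z. \<alpha> \<in> {0<..<1} \<Longrightarrow> z \<in> lists {1..K} \<Longrightarrow> 0 \<le> \<pi> \<alpha> z \<and> \<pi> \<alpha> z < 1"
    and model: "\<And>\<alpha> \<phi>. \<alpha> \<in> {0<..<1} \<Longrightarrow> assignment_rule K \<phi> \<Longrightarrow>
        change_point_model (M \<alpha> \<phi>) \<mu> f g (\<pi> \<alpha>) \<phi> (L \<alpha> \<phi>) (X \<alpha> \<phi>) (Y \<alpha> \<phi>)"
    and cond1: "\<And>x. x \<in> {1..K} \<Longrightarrow>
        0 < log_div_var \<mu> (g x) (f x) \<and> log_div_var \<mu> (g x) (f x) < \<infinity> \<and>
        log_div_var \<mu> (f x) (g x) < \<infinity>"
    and cond2: "\<exists>c\<in>{0<..<1}. \<forall>\<^sub>F \<alpha> in at_right 0. (SUP z\<in>lists {1..K}. \<pi> \<alpha> z) \<le> 1 - c"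
    and cond3: "\<exists>\<Xi>. (\<forall>\<alpha>\<in>{0<..<1}. is_block K (\<Xi> \<alpha>)) \<and>
        (\<forall>\<^sub>F \<alpha> in at_right 0. lambda_tilde K (\<pi> \<alpha>) (\<Xi> \<alpha>) < \<infinity>) \<and>
        ((\<lambda>\<alpha>. ennreal \<alpha> * lambda_tilde K (\<pi> \<alpha>) (\<Xi> \<alpha>)
               / (lambda_star K (M \<alpha>) (L \<alpha>) + ennreal \<bar>ln \<alpha>\<bar>)) \<longlongrightarrow> 0) (at_right 0)"
    and D_pos: "\<And>\<alpha>. \<alpha> \<in> {0<..<1} \<Longrightarrow> 0 < D \<alpha>"
    and D_bigo: "Limsup (at_right 0) (\<lambda>\<alpha>. ereal (D \<alpha>)) < \<infinity>"
    and cond4: "\<And>\<epsilon>. \<epsilon> \<in> {0<..<1} \<Longrightarrow>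
        Limsup (at_right 0) (\<lambda>\<alpha>.
          let N = nat \<lfloor>(1 - \<epsilon>) * \<bar>ln \<alpha>\<bar> / D \<alpha>\<rfloor> in
          SUP t. SUP \<phi>\<in>{\<phi>. assignment_rule K \<phi>}. SUP \<omega>\<in>space (M \<alpha> \<phi>).
            (\<Sum>s=1..N. log_div \<mu> (g (X \<alpha> \<phi> (t + s) \<omega>)) (f (X \<alpha> \<phi> (t + s) \<omega>))
                      + ereal (omega (Pi_t (\<pi> \<alpha>) (X \<alpha> \<phi>) (t + s) \<omega>)))
            / ereal (D \<alpha> * real N))
        \<le> ereal (1 + \<epsilon> / 2)"
  shows "1 \<le> Liminf (at_right 0) (\<lambda>\<alpha>.
           (INF (\<phi>, T)\<in>procedure_class K (M \<alpha>) (L \<alpha>) (X \<alpha>) (Y \<alpha>) \<alpha>. expect_enat (M \<alpha> \<phi>) T)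
           / (lambda_star K (M \<alpha>) (L \<alpha>) + ennreal (\<bar>ln \<alpha>\<bar> / D \<alpha>)))"
proof -
  define l where "l \<alpha> = \<bar>ln \<alpha>\<bar>" for \<alpha> :: real
  define Q where "Q x I V \<longleftrightarrow> log_div \<mu> (g x) (f x) = ereal I \<and> 0 < I \<and> 0 \<le> V \<and> (AE y in \<mu>. f x y = 0 \<longrightarrow> g x y = 0) \<and>
    (\<forall>z w. (\<integral>\<^sup>+y. ennreal (g x y) * ennreal ((z + w * (ln (g x y / f x y) - I))\<^sup>2) \<partial>\<mu>) = ennreal (z\<^sup>2 + w\<^sup>2 * V))"
    for x I V
  have "\<exists>I V. Q x I V" if x: "x \<in> {1..K}" for x
  proof -
    obtain I V where "log_div \<mu> (g x) (f x) = ereal I" "0 < I" "0 \<le> V" "AE y in \<mu>. f x y = 0 \<longrightarrow> g x y = 0"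
      "\<And>z w. (\<integral>\<^sup>+y. ennreal (g x y) * ennreal ((z + w * (ln (g x y / f x y) - I))\<^sup>2) \<partial>\<mu>) = ennreal (z\<^sup>2 + w\<^sup>2 * V)"
      using log_div_moments[of \<mu> "g x" "f x"] densities[OF x] cond1[OF x] by blast
    then show ?thesis unfolding Q_def by (intro exI[of _ I] exI[of _ V] conjI allI)
  qed
  then obtain Iv Vv where "\<And>x. x \<in> {1..K} \<Longrightarrow> Q x (Iv x) (Vv x)" by metis
  then have moments: "log_div \<mu> (g x) (f x) = ereal (Iv x)" "0 < Iv x" "0 \<le> Vv x" "AE y in \<mu>. f x y = 0 \<longrightarrow> g x y = 0"
      "(\<integral>\<^sup>+y. ennreal (g x y) * ennreal ((z + w * (ln (g x y / f x y) - Iv x))\<^sup>2) \<partial>\<mu>) = ennreal (z\<^sup>2 + w\<^sup>2 * Vv x)"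
    if "x \<in> {1..K}" for x z w
    using that unfolding Q_def by blast+
  \<comment> \<open>The sum dominates each variance and gives one constant for all
    treatments.\<close>
  define V where "V = (\<Sum>x\<in>{1..K}. Vv x)"
  have V: "0 \<le> V" unfolding V_def by (intro sum_nonneg moments)
  have Vle: "Vv x \<le> V" if "x \<in> {1..K}" for x
    unfolding V_def using that by (intro member_le_sum) (auto intro: moments)
  have mom: "(\<integral>\<^sup>+y. ennreal (g x y) * ennreal ((z + w * (ln (g x y / f x y) - Iv x))\<^sup>2) \<partial>\<mu>) \<le> ennreal (z\<^sup>2 + w\<^sup>2 * V)"
    if "x \<in> {1..K}" for x z w
  proof -
    have "z\<^sup>2 + w\<^sup>2 * Vv x \<le> z\<^sup>2 + w\<^sup>2 * V" using Vle[OF that] by (intro add_left_mono mult_left_mono) auto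
    then show ?thesis unfolding moments(5)[OF that] by (rule ennreal_leI)
  qed
  define I0 where "I0 = Min (Iv ` {1..K})"
  have I0: "0 < I0" "\<And>x. x \<in> {1..K} \<Longrightarrow> I0 \<le> Iv x"
    using K by (auto simp: I0_def intro: moments)
  have ruled: "ruled_change_point_model (M \<alpha> \<phi>) \<mu> f g (\<pi> \<alpha>) \<phi> (L \<alpha> \<phi>) (X \<alpha> \<phi>) (Y \<alpha> \<phi>) K"
    if "\<alpha> \<in> {0<..<1}" "assignment_rule K \<phi>" for \<alpha> \<phi>
    by (intro ruled_change_point_model.intro ruled_change_point_model_axioms.intro model that mu densities)
       (use pi_range that in auto)
  obtain \<Xi> where block: "\<And>\<alpha>. \<alpha> \<in> {0<..<1} \<Longrightarrow> is_block K (\<Xi> \<alpha>)"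
    and lt_fin: "\<forall>\<^sub>F \<alpha> in at_right 0. lambda_tilde K (\<pi> \<alpha>) (\<Xi> \<alpha>) < \<infinity>"
    and lt_lim: "((\<lambda>\<alpha>. ennreal \<alpha> * lambda_tilde K (\<pi> \<alpha>) (\<Xi> \<alpha>)
               / (lambda_star K (M \<alpha>) (L \<alpha>) + ennreal \<bar>ln \<alpha>\<bar>)) \<longlongrightarrow> 0) (at_right 0)"
    using cond3 by blast
  obtain c where c: "0 < c" and c_ev: "\<forall>\<^sub>F \<alpha> in at_right 0. (SUP z\<in>lists {1..K}. \<pi> \<alpha> z) \<le> 1 - c"
    using cond2 by auto
  \<comment> \<open>The bound on \<open>D\<close> serves twice: it makes \<open>l / D\<close> large,
    and it converts the normalisation of \<open>cond3\<close> by \<open>l\<close> into one by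
    \<open>l / D\<close>.\<close>
  obtain D1 where D1: "1 \<le> D1" and D1_ev: "\<forall>\<^sub>F \<alpha> in at_right 0. D \<alpha> < D1"
  proof -
    obtain n :: nat where "Limsup (at_right 0) (\<lambda>\<alpha>. ereal (D \<alpha>)) < ereal (real n)"
      using D_bigo less_PInf_Ex_of_nat[of "Limsup (at_right 0) (\<lambda>\<alpha>. ereal (D \<alpha>))"] by auto
    from Limsup_lessD[OF this] show thesis
      by (intro that[of "max 1 (real n)"]) (auto elim: eventually_mono)
  qed
  let ?ratio = "\<lambda>\<alpha>. (INF (\<phi>, T)\<in>procedure_class K (M \<alpha>) (L \<alpha>) (X \<alpha>) (Y \<alpha>) \<alpha>. expect_enat (M \<alpha> \<phi>) T)
           / (lambda_star K (M \<alpha>) (L \<alpha>) + ennreal (\<bar>ln \<alpha>\<bar> / D \<alpha>))"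
  have main: "\<forall>\<^sub>F \<alpha> in at_right 0. ennreal (1 - 4 * \<epsilon>) \<le> ?ratio \<alpha>" if \<epsilon>: "0 < \<epsilon>" "\<epsilon> < 1" for \<epsilon> :: real
  proof -
    define D0 where "D0 = I0 / 2"
    have D0: "0 < D0" using I0 by (simp add: D0_def)
    have l_large: "\<forall>\<^sub>F \<alpha> in at_right 0. P (l \<alpha>)" if "\<forall>\<^sub>F l in at_top. P l" for P
      unfolding l_def using that filterlim_abs_ln_at_right_0 by (rule eventually_compose_filterlim)
    have ev_\<alpha>: "\<forall>\<^sub>F \<alpha>::real in at_right 0. \<alpha> \<in> {0<..<1}"
      by (rule eventually_at_right_real) simp
    \<comment> \<open>\<open>cond4\<close> bounds only the limit superior by
      \<open>1 + \<epsilon> / 2\<close>. The larger \<open>1 + 3 * \<epsilon> / 4\<close> holds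
      eventually, and its product with \<open>1 - \<epsilon>\<close> is still at most
      \<open>1 - \<epsilon> / 4\<close>.\<close>
    have "\<epsilon> \<in> {0<..<1}" and "ereal (1 + \<epsilon> / 2) < ereal (1 + 3 * \<epsilon> / 4)" using \<epsilon> by auto
    note drift_ev = Limsup_lessD[OF le_less_trans[OF cond4[OF this(1)] this(2)]]
    have "0 < ennreal (\<epsilon> / D1)" using \<epsilon> D1 by simp
    note lt_ev = order_tendstoD(2)[OF lt_lim this]
    show ?thesis
      using ev_\<alpha> drift_ev lt_ev lt_fin c_ev D1_ev
        l_large[OF eventually_ge_at_top[of "D1 / (1 - \<epsilon>)"]] l_large[OF eventually_ge_at_top[of "D1 / \<epsilon>"]]
        l_large[OF eventually_error_small[OF \<epsilon>(1) c D0, of V]]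
    proof eventually_elim
      case (elim \<alpha>)
      define N where "N = nat \<lfloor>(1 - \<epsilon>) * l \<alpha> / D \<alpha>\<rfloor>"
      let ?info = "\<lambda>\<phi> t \<omega> s. Iv (X \<alpha> \<phi> (t + s) \<omega>) + omega (Pi_t (\<pi> \<alpha>) (X \<alpha> \<phi>) (t + s) \<omega>)"
      let ?lam = "lambda_star K (M \<alpha>) (L \<alpha>)" and ?r = "l \<alpha> / D \<alpha>"
      have \<alpha>: "0 < \<alpha>" "\<alpha> < 1" using elim(1) by auto
      have D: "0 < D \<alpha>" "D \<alpha> < D1" using D_pos[OF elim(1)] elim(6) by auto
      have \<alpha>l: "\<alpha> = exp (- l \<alpha>)" using \<alpha> by (simp add: l_def)
      have lpos: "0 < l \<alpha>" using elim(8) \<epsilon> D1 by (meson divide_pos_pos less_le_trans zero_less_one)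
      \<comment> \<open>Eventually \<open>l\<close> exceeds both
        \<open>D1 / (1 - \<epsilon>)\<close> and \<open>D1 / \<epsilon>\<close>. The first gives
        \<open>N \<ge> 1\<close>, so that division by \<open>N\<close> is meaningful; the second
        bounds the loss by rounding by a fraction \<epsilon> of \<open>l / D\<close>.\<close>
      have r1: "1 \<le> (1 - \<epsilon>) * ?r"
      proof -
        have "D \<alpha> \<le> (1 - \<epsilon>) * l \<alpha>" using elim(7) D \<epsilon> by (simp add: pos_divide_le_eq mult.commute)
        then show ?thesis using D by (simp add: field_simps)
      qed
      have r2: "1 \<le> \<epsilon> * ?r"
      proof -
        have "D \<alpha> \<le> \<epsilon> * l \<alpha>" using elim(8) D \<epsilon> by (simp add: pos_divide_le_eq mult.commute)
        then show ?thesis using D by (simp add: field_simps)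
      qed
      have Nr: "real N = of_int \<lfloor>(1 - \<epsilon>) * ?r\<rfloor>" using r1 by (simp add: N_def)
      have N1: "1 \<le> N" using r1 by (simp add: N_def le_nat_iff)
      have N_up: "real N \<le> (1 - \<epsilon>) * ?r" unfolding Nr by simp
      have N_lo: "(1 - 2 * \<epsilon>) * ?r \<le> real N"
      proof -
        have "(1 - 2 * \<epsilon>) * r = (1 - \<epsilon>) * r - \<epsilon> * r" for r by (simp add: algebra_simps)
        from this[of ?r] have "(1 - 2 * \<epsilon>) * ?r \<le> (1 - \<epsilon>) * ?r - 1" using r2 by linarith
        also have "\<dots> \<le> real N" unfolding Nr by linarith
        finally show ?thesis .
      qed
      have sum_le: "(\<Sum>s=1..N. ?info \<phi> t \<omega> s) \<le> (1 + 3 * \<epsilon> / 4) * (D \<alpha> * real N)"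
        if \<phi>: "assignment_rule K \<phi>" and \<omega>: "\<omega> \<in> space (M \<alpha> \<phi>)" for \<phi> t \<omega>
      proof -
        interpret m: ruled_change_point_model "M \<alpha> \<phi>" \<mu> f g "\<pi> \<alpha>" \<phi> "L \<alpha> \<phi>" "X \<alpha> \<phi>" "Y \<alpha> \<phi>" K
          by (rule ruled[OF elim(1) \<phi>])
        let ?F = "\<lambda>t \<phi> \<omega>. (\<Sum>s=1..N. log_div \<mu> (g (X \<alpha> \<phi> (t + s) \<omega>)) (f (X \<alpha> \<phi> (t + s) \<omega>))
                      + ereal (omega (Pi_t (\<pi> \<alpha>) (X \<alpha> \<phi>) (t + s) \<omega>))) / ereal (D \<alpha> * real N)"
        have "?F t \<phi> \<omega> \<le> (SUP \<omega>\<in>space (M \<alpha> \<phi>). ?F t \<phi> \<omega>)" using \<omega> by (rule SUP_upper)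
        also have "\<dots> \<le> (SUP \<phi>\<in>{\<phi>. assignment_rule K \<phi>}. SUP \<omega>\<in>space (M \<alpha> \<phi>). ?F t \<phi> \<omega>)"
          using \<phi> by (intro SUP_upper) simp
        also have "\<dots> \<le> (SUP t. SUP \<phi>\<in>{\<phi>. assignment_rule K \<phi>}. SUP \<omega>\<in>space (M \<alpha> \<phi>). ?F t \<phi> \<omega>)"
          by (rule SUP_upper) simp
        also have "\<dots> \<le> ereal (1 + 3 * \<epsilon> / 4)"
          using elim(2) unfolding Let_def N_def l_def by (rule less_imp_le)
        finally have F: "?F t \<phi> \<omega> \<le> ereal (1 + 3 * \<epsilon> / 4)" .
        have "X \<alpha> \<phi> (t + s) \<omega> \<in> {1..K}" if "s \<in> {1..N}" for s
          using that by (intro m.X_in[OF \<omega>, of _ "t + s"]) auto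
        then have "(\<Sum>s=1..N. log_div \<mu> (g (X \<alpha> \<phi> (t + s) \<omega>)) (f (X \<alpha> \<phi> (t + s) \<omega>)) + ereal (omega (Pi_t (\<pi> \<alpha>) (X \<alpha> \<phi>) (t + s) \<omega>))) =
          (\<Sum>s=1..N. ereal (?info \<phi> t \<omega> s))"
          by (intro sum.cong) (simp_all add: moments(1))
        also have "\<dots> = ereal (\<Sum>s=1..N. ?info \<phi> t \<omega> s)"
          by (rule sum_ereal)
        finally have "(\<Sum>s=1..N. ?info \<phi> t \<omega> s) / (D \<alpha> * real N) \<le> 1 + 3 * \<epsilon> / 4"
          using F D N1 by simp
        then show ?thesis using D N1 by (simp add: pos_divide_le_eq)
      qed
      \<comment> \<open>\<open>cond4\<close> itself bounds \<open>D\<close> from below: every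
        summand is at least \<open>I0\<close>, so a full window gives
        \<open>N * I0 \<le> 2 * (D \<alpha> * N)\<close>. Any rule is a witness, here the constant
        one. The consequence is that \<open>N\<close> is at most of order \<open>l\<close>, which
        makes the variance term vanish.\<close>
      have D0_le: "D0 \<le> D \<alpha>"
      proof -
        define \<phi> :: "'y rule" where "\<phi> = (\<lambda>_ _. 1)"
        have \<phi>: "assignment_rule K \<phi>" using K by (simp add: assignment_rule_def \<phi>_def)
        interpret m: ruled_change_point_model "M \<alpha> \<phi>" \<mu> f g "\<pi> \<alpha>" \<phi> "L \<alpha> \<phi>" "X \<alpha> \<phi>" "Y \<alpha> \<phi>" K
          by (rule ruled[OF elim(1) \<phi>])
        obtain \<omega> where \<omega>: "\<omega> \<in> space (M \<alpha> \<phi>)" using m.not_empty by auto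
        have "real N * I0 = (\<Sum>s=1..N. I0)" by simp
        also have "\<dots> \<le> (\<Sum>s=1..N. ?info \<phi> 0 \<omega> s)"
        proof (rule sum_mono)
          fix s assume "s \<in> {1..N}"
          then have "X \<alpha> \<phi> (0 + s) \<omega> \<in> {1..K}" by (intro m.X_in[OF \<omega>, of _ s]) auto
          from I0(2)[OF this] show "I0 \<le> ?info \<phi> 0 \<omega> s"
            unfolding omega_def by linarith
        qed
        also have "\<dots> \<le> (1 + 3 * \<epsilon> / 4) * (D \<alpha> * real N)" by (rule sum_le[OF \<phi> \<omega>])
        also have "\<dots> \<le> 2 * (D \<alpha> * real N)" using \<epsilon> D by (intro mult_right_mono) auto
        finally have "I0 \<le> 2 * D \<alpha>" using N1 by (simp add: mult.commute)
        then show ?thesis by (simp add: D0_def)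
      qed
      have N_D0: "real N \<le> l \<alpha> / D0"
      proof -
        have "real N \<le> 1 * ?r" using N_up \<epsilon> D lpos by (elim order_trans, intro mult_right_mono) auto
        also have "\<dots> \<le> l \<alpha> / D0" using D0_le D0 lpos by (simp add: frac_le)
        finally show ?thesis .
      qed
      \<comment> \<open>The drift over a window is at most \<open>(1 - \<epsilon> / 4) * l\<close>.
        The threshold \<open>a\<close> lies halfway between this and \<open>l\<close>: the gap
        \<open>b\<close> below it is left to the scores, the gap above it gives
        \<open>exp a * \<alpha> = exp (- (\<epsilon> / 8 * l))\<close>.\<close>
      define a b where "a = (1 - \<epsilon> / 8) * l \<alpha>" and "b = \<epsilon> / 8 * l \<alpha>"
      have b: "0 < b" using \<epsilon> lpos by (simp add: b_def)
      have drift: "(\<Sum>s=1..N. ?info \<phi> t \<omega> s) \<le> a - b"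
        if "assignment_rule K \<phi>" "\<omega> \<in> space (M \<alpha> \<phi>)" for \<phi> t \<omega>
      proof -
        have "D \<alpha> * real N \<le> (1 - \<epsilon>) * l \<alpha>" using N_up D by (simp add: field_simps)
        then have "(1 + 3 * \<epsilon> / 4) * (D \<alpha> * real N) \<le> (1 + 3 * \<epsilon> / 4) * ((1 - \<epsilon>) * l \<alpha>)"
          using \<epsilon> by (intro mult_left_mono) auto
        also have "\<dots> \<le> a - b"
        proof -
          have "a - b - (1 + 3 * \<epsilon> / 4) * ((1 - \<epsilon>) * l \<alpha>) = 3 * \<epsilon>\<^sup>2 / 4 * l \<alpha>"
            by (simp add: a_def b_def power2_eq_square field_simps)
          moreover have "0 \<le> 3 * \<epsilon>\<^sup>2 / 4 * l \<alpha>" using lpos by simp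
          ultimately show ?thesis by linarith
        qed
        finally show ?thesis using sum_le[OF that, of t] by linarith
      qed
      define \<delta> where "\<delta> = \<alpha> + real N * (exp a / c) * \<alpha> + V * real N / b\<^sup>2"
      have \<delta>0: "0 \<le> \<delta>" using \<alpha> c V by (simp add: \<delta>_def)
      have \<delta>: "\<delta> \<le> \<epsilon>"
      proof -
        have "real N * (exp a / c) * \<alpha> = real N * (1 / c) * (exp a * \<alpha>)" by simp
        also have "exp a * \<alpha> = exp (- (\<epsilon> / 8 * l \<alpha>))"
          by (subst \<alpha>l) (simp add: exp_add[symmetric] a_def algebra_simps)
        also have "real N * (1 / c) * exp (- (\<epsilon> / 8 * l \<alpha>)) \<le> l \<alpha> / D0 * (1 / c) * exp (- (\<epsilon> / 8 * l \<alpha>))"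
          using N_D0 c by (intro mult_right_mono) auto
        finally have 1: "real N * (exp a / c) * \<alpha> \<le> l \<alpha> / D0 * (1 / c) * exp (- (\<epsilon> / 8 * l \<alpha>))" .
        have "V * real N / b\<^sup>2 \<le> V * (l \<alpha> / D0) / b\<^sup>2"
          using N_D0 V by (intro divide_right_mono mult_left_mono) auto
        also have "\<dots> = 64 * V / (D0 * \<epsilon>\<^sup>2 * l \<alpha>)"
          using lpos \<epsilon> D0 by (simp add: b_def power2_eq_square field_simps)
        finally have 2: "V * real N / b\<^sup>2 \<le> 64 * V / (D0 * \<epsilon>\<^sup>2 * l \<alpha>)" .
        have "\<delta> \<le> exp (- l \<alpha>) + l \<alpha> / D0 * (1 / c) * exp (- (\<epsilon> / 8 * l \<alpha>)) + 64 * V / (D0 * \<epsilon>\<^sup>2 * l \<alpha>)"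
          unfolding \<delta>_def using 1 2 \<alpha>l by linarith
        also have "\<dots> \<le> \<epsilon>" by (rule elim(9))
        finally show ?thesis .
      qed
      have lam: "?lam < \<infinity>"
        using lambda_star_le_lambda_tilde[where M="M \<alpha>" and L="L \<alpha>", OF ruled[OF elim(1)] _ block[OF elim(1)]] K elim(4)
        by (auto intro: le_less_trans)
      have pi_le: "\<pi> \<alpha> z \<le> 1 - c" if "z \<in> lists {1..K}" for z
      proof -
        \<comment> \<open>A real-valued \<open>SUP\<close> is known to bound its members only when
          the family is bounded above.\<close>
        have "bdd_above (\<pi> \<alpha> ` lists {1..K})"
          using pi_range[OF elim(1)] by (intro bdd_aboveI[of _ 1]) (auto intro: less_imp_le)
        from cSUP_upper[OF that this] show ?thesis using elim(5) by linarith
      qed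
      \<comment> \<open>The hypothesis is normalised with \<open>l\<close>, the claim with
        \<open>l / D\<close>. Since \<open>D < D1\<close> and \<open>1 \<le> D1\<close>, the smaller
        target \<open>\<epsilon> / D1\<close> pays for the difference.\<close>
      have q: "lambda_tilde K (\<pi> \<alpha>) (\<Xi> \<alpha>) * ennreal \<alpha> \<le> ennreal \<epsilon> * (?lam + ennreal ?r)"
      proof -
        have ne: "?lam + ennreal (l \<alpha>) \<noteq> 0" "?lam + ennreal (l \<alpha>) < \<top>" using lpos lam by auto
        have "ennreal \<alpha> * lambda_tilde K (\<pi> \<alpha>) (\<Xi> \<alpha>) < ennreal (\<epsilon> / D1) * (?lam + ennreal (l \<alpha>))"
          using elim(3) divide_less_ennreal[OF ne] unfolding l_def by simp
        also have "\<dots> = ennreal (\<epsilon> / D1) * ?lam + ennreal (\<epsilon> / D1 * l \<alpha>)"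
          using \<epsilon> D1 lpos by (subst ennreal_mult) (auto simp: distrib_left)
        also have "\<dots> \<le> ennreal \<epsilon> * ?lam + ennreal (\<epsilon> * ?r)"
        proof (intro add_mono mult_right_mono ennreal_leI)
          show "\<epsilon> / D1 \<le> \<epsilon>" using \<epsilon> D1 by (simp add: divide_le_eq)
          have "l \<alpha> / D1 \<le> ?r" using D lpos by (intro divide_left_mono) auto
          then show "\<epsilon> / D1 * l \<alpha> \<le> \<epsilon> * ?r" using \<epsilon> mult_left_mono[of "l \<alpha> / D1" ?r \<epsilon>] by simp
        qed simp
        also have "\<dots> = ennreal \<epsilon> * (?lam + ennreal ?r)"
          using \<epsilon> D lpos by (subst ennreal_mult) (auto simp: distrib_left)
        finally show ?thesis by (simp add: mult.commute)
      qed
      have "ennreal (1 - 4 * \<epsilon>) * (?lam + ennreal ?r) \<le>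
        (INF (\<phi>, T)\<in>procedure_class K (M \<alpha>) (L \<alpha>) (X \<alpha>) (Y \<alpha>) \<alpha>. expect_enat (M \<alpha> \<phi>) T)"
      proof (rule INF_greatest, clarify)
        fix \<phi> T assume T: "(\<phi>, T) \<in> procedure_class K (M \<alpha>) (L \<alpha>) (X \<alpha>) (Y \<alpha>) \<alpha>"
        have "?lam + of_nat N \<le> expect_enat (M \<alpha> \<phi>) T + lambda_tilde K (\<pi> \<alpha>) (\<Xi> \<alpha>) * ennreal \<alpha> + of_nat N * ennreal \<delta>"
          unfolding \<delta>_def
          by (rule detection_lower_bound[OF ruled[OF elim(1)] block[OF elim(1)] _ V mom _ c pi_le b drift T])
             (assumption | rule moments(4) | rule less_imp_le[OF moments(2)])+
        from lower_bound_algebra[OF lam _ \<epsilon> this q \<delta>0 \<delta> N_lo]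
        show "ennreal (1 - 4 * \<epsilon>) * (?lam + ennreal ?r) \<le> expect_enat (M \<alpha> \<phi>) T"
          using lpos D by simp
      qed
      from divide_right_mono_ennreal[OF this, of "?lam + ennreal ?r"]
      show ?case
        using lam lpos D unfolding l_def[symmetric] by (subst (asm) mult_divide_eq_ennreal) auto
    qed
  qed
  have bnd: "ennreal (1 - 4 * \<epsilon>) \<le> Liminf (at_right 0) ?ratio" if "0 < \<epsilon>" "\<epsilon> < 1" for \<epsilon> :: real
    by (rule Liminf_bounded[OF main[OF that]])
  show ?thesis
  proof (rule ccontr)
    assume "\<not> 1 \<le> Liminf (at_right 0) ?ratio"
    then obtain r where r: "Liminf (at_right 0) ?ratio = ennreal r" "0 \<le> r" "r < 1"
      by (cases "Liminf (at_right 0) ?ratio") (auto simp: not_le)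
    \<comment> \<open>With this choice of \<epsilon>, \<open>1 - 4 * \<epsilon>\<close> equals
      \<open>(1 + r) / 2\<close>, which exceeds \<open>r\<close>.\<close>
    from bnd[of "(1 - r) / 8"] r have "1 - 4 * ((1 - r) / 8) \<le> r"
      by (simp add: ennreal_le_iff)
    then show False using r by (simp add: field_simps)
  qed
qed

end
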